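(* Let $G$ be a reductive algebraic group over an algebraically closed field $\mathbb{K}$ of characteristic $p>0$ and let $r\in\mathbb{N}$. The centre $Z(U^{[r]}(G))$ of $U^{[r]}(G)$ is a finitely generated algebra over $\mathbb{K}$, and $U^{[r]}(G)$ is finitely generated as a $Z(U^{[r]}(G))$-module.
   Context: $\mathbb{N}=\{0,1,2,\dots\}$. With $I_1=\{f\in\mathbb{K}[G]: f(1)=0\}$, $\mathrm{Dist}_k(G)$ is the space of linear maps $\mu:\mathbb{K}[G]\to\mathbb{K}$ with $\mu(I_1^{k+1})=0$, $\mathrm{Dist}_k^{+}(G)=\{\mu\in\mathrm{Dist}_k(G):\mu(1)=0\}$, and $\mathrm{Dist}(G)=\bigcup_k\mathrm{Dist}_k(G)$ with product $\mu\rho=(\mu\otimes\rho)\circ\Delta$. One has $\mu\rho\in\mathrm{Dist}^+_{i+j}(G)$ and $[\mu,\rho]\in\mathrm{Dist}^+_{i+j-1}(G)$ for $\mu\in\mathrm{Dist}^+_i(G)$, $\rho\in\mathrm{Dist}^+_j(G)$. The higher universal enveloping algebra is $U^{[r]}(G)=T(\mathrm{Dist}^+_{p^{r+1}-1}(G))/Q$, where $T$ is the tensor algebra and $Q$ is the two-sided ideal generated by the relations (i) $x\otimes y=xy$ for $x\in\mathrm{Dist}^+_i(G)$, $y\in\mathrm{Dist}^+_j(G)$ with $i+j<p^{r+1}$; (ii) $x\otimes y-y\otimes x=[x,y]$ for $x\in\mathrm{Dist}^+_i(G)$, $y\in\mathrm{Dist}^+_j(G)$ with $i+j\le p^{r+1}$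 (products and commutators on the right-hand sides taken in $\mathrm{Dist}(G)$). *)

theory Defs
  imports
    "HOL-Analysis.Abstract_Topology"
    "HOL-Algebra.Embedded_Algebras"
    "HOL-Algebra.Generated_Rings"
    "HOL-Algebra.Ideal_Product"
    "HOL-Algebra.QuotRing"
    "HOL-Computational_Algebra.Computational_Algebra"
begin

section \<open>Algebras over a field\<close>

text \<open>
  A \<open>K\<close>-algebra is a ring \<open>R\<close> with a structure map \<open>\<kappa>\<close> sending \<open>c\<close> to \<open>c \<cdot> 1\<close>.  The subalgebra
  generated by \<open>S\<close> is then the subring generated by \<open>S\<close> and the range of \<open>\<kappa>\<close>.
\<close>

definition fin_gen_algebra :: "('a, 'm) ring_scheme \<Rightarrow> ('k \<Rightarrow> 'a) \<Rightarrow> 'a set \<Rightarrow> bool"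
  where "fin_gen_algebra R \<kappa> B \<longleftrightarrow>
    (\<exists>S. finite S \<and> S \<subseteq> B \<and> B = generate_ring R (range \<kappa> \<union> S))"

definition ring_centre :: "('a, 'm) ring_scheme \<Rightarrow> 'a set"
  where "ring_centre R = {z \<in> carrier R. \<forall>x\<in>carrier R. z \<otimes>\<^bsub>R\<^esub> x = x \<otimes>\<^bsub>R\<^esub> z}"

text \<open>\<open>R\<close> as a left module over its subring \<open>B\<close>.\<close>

definition fin_gen_module_over :: "('a, 'm) ring_scheme \<Rightarrow> 'a set \<Rightarrow> bool"
  where "fin_gen_module_over R B \<longleftrightarrow>
    (\<exists>us. set us \<subseteq> carrier R \<and> ring.Span R B us = carrier R)"

primrec ideal_power :: "('a, 'm) ring_scheme \<Rightarrow> 'a set \<Rightarrow> nat \<Rightarrow> 'a set"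
  where
    "ideal_power R I 0 = carrier R"
  | "ideal_power R I (Suc n) = ideal_prod R I (ideal_power R I n)"


section \<open>Affine varieties and affine algebraic groups\<close>

text \<open>
  Functions on \<open>X\<close> are represented by functions on the ambient type that vanish outside \<open>X\<close>, so that
  equality of functions on \<open>X\<close> is equality in HOL.
\<close>

definition ext0 :: "'g set \<Rightarrow> ('g \<Rightarrow> 'k::zero) \<Rightarrow> 'g \<Rightarrow> 'k"
  where "ext0 X f = (\<lambda>x. if x \<in> X then f x else 0)"

definition const_fun :: "'g set \<Rightarrow> 'k::zero \<Rightarrow> 'g \<Rightarrow> 'k"
  where "const_fun X c = ext0 X (\<lambda>_. c)"

definition coord_ring :: "'g set \<Rightarrow> ('g \<Rightarrow> 'k::field) set \<Rightarrow> ('g \<Rightarrow> 'k) ring"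
  where "coord_ring X A =
    \<lparr>carrier = A, monoid.mult = (\<lambda>f g x. f x * g x), one = const_fun X 1,
     zero = (\<lambda>x. 0), add = (\<lambda>f g x. f x + g x)\<rparr>"

text \<open>
  An affine variety over an algebraically closed field is given by its points \<open>X\<close> and its finitely
  generated algebra \<open>A = K[X]\<close> of regular functions, such that the points are exactly the
  \<open>K\<close>-algebra homomorphisms \<open>A \<rightarrow> K\<close>.
\<close>

locale affine_variety =
  fixes X :: "'g set" and A :: "('g \<Rightarrow> 'k::alg_closed_field) set"
  assumes zero_outside: "f \<in> A \<Longrightarrow> x \<notin> X \<Longrightarrow> f x = 0"
    and const_closed: "const_fun X c \<in> A"
    and add_closed: "f \<in> A \<Longrightarrow> g \<in> A \<Longrightarrow> (\<lambda>x. f x + g x) \<in> A"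
    and mult_closed: "f \<in> A \<Longrightarrow> g \<in> A \<Longrightarrow> (\<lambda>x. f x * g x) \<in> A"
    and finitely_generated: "fin_gen_algebra (coord_ring X A) (const_fun X) A"
    and points:
      "(\<forall>c. \<phi> (const_fun X c) = c) \<Longrightarrow>
       (\<forall>f\<in>A. \<forall>g\<in>A. \<phi> (\<lambda>x. f x + g x) = \<phi> f + \<phi> g \<and> \<phi> (\<lambda>x. f x * g x) = \<phi> f * \<phi> g) \<Longrightarrow>
       \<exists>!x. x \<in> X \<and> (\<forall>f\<in>A. \<phi> f = f x)"

definition zariski :: "('g \<Rightarrow> 'k::zero) set \<Rightarrow> 'g topology"
  where "zariski A = topology_generated_by ((\<lambda>f. {x. f x \<noteq> 0}) ` A)"

text \<open>
  The multiplication is a morphism \<open>G \<times> G \<rightarrow> G\<close>: the function \<open>(x, y) \<mapsto> f (x y)\<close> lies in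
  \<open>K[G \<times> G] = K[G] \<otimes> K[G]\<close>, for every \<open>f\<close> in \<open>K[G]\<close>.
\<close>

locale affine_algebraic_group =
  group G + affine_variety "carrier G" A
  for G :: "('g, 'm) monoid_scheme" (structure) and A :: "('g \<Rightarrow> 'k::alg_closed_field) set" +
  assumes mult_morphism: "f \<in> A \<Longrightarrow>
      \<exists>n u v. (\<forall>i<n. u i \<in> A \<and> v i \<in> A) \<and>
        (\<forall>x\<in>carrier G. \<forall>y\<in>carrier G. f (x \<otimes> y) = (\<Sum>i<(n::nat). u i x * v i y))"
    and inv_morphism: "f \<in> A \<Longrightarrow> ext0 (carrier G) (\<lambda>x. f (inv x)) \<in> A"


section \<open>Reductive groups\<close>

text \<open>
  An element \<open>u\<close> is unipotent if right translation \<open>\<rho>\<^sub>u\<close>, \<open>(\<rho>\<^sub>u f) x = f (x u)\<close>, is a locally unipotent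
  operator on \<open>K[G]\<close>, i.e. \<open>\<rho>\<^sub>u - 1\<close> is locally nilpotent.
\<close>

definition unipotent_element :: "('g, 'm) monoid_scheme \<Rightarrow> ('g \<Rightarrow> 'k::field) set \<Rightarrow> 'g \<Rightarrow> bool"
  where "unipotent_element G A u \<longleftrightarrow>
    (\<forall>f\<in>A. \<exists>n. ((\<lambda>h. ext0 (carrier G) (\<lambda>x. h (x \<otimes>\<^bsub>G\<^esub> u) - h x)) ^^ n) f = (\<lambda>_. 0))"

text \<open>
  The largest closed connected normal unipotent subgroup, written as the union of all closed
  connected normal unipotent subgroups.
\<close>

definition unipotent_radical :: "('g, 'm) monoid_scheme \<Rightarrow> ('g \<Rightarrow> 'k::field) set \<Rightarrow> 'g set"
  where "unipotent_radical G A =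
    \<Union>{N. N \<lhd> G \<and> closedin (zariski A) N \<and> connectedin (zariski A) N \<and>
         (\<forall>u\<in>N. unipotent_element G A u)}"

definition reductive_group ::
    "('g, 'm) monoid_scheme \<Rightarrow> ('g \<Rightarrow> 'k::alg_closed_field) set \<Rightarrow> bool"
  where "reductive_group G A \<longleftrightarrow>
    affine_algebraic_group G A \<and> unipotent_radical G A = {\<one>\<^bsub>G\<^esub>}"


section \<open>Distributions\<close>

definition aug_ideal :: "('g, 'm) monoid_scheme \<Rightarrow> ('g \<Rightarrow> 'k::field) set \<Rightarrow> ('g \<Rightarrow> 'k) set"
  where "aug_ideal G A = {f \<in> A. f \<one>\<^bsub>G\<^esub> = 0}"

text \<open>
  Linear maps \<open>K[G] \<rightarrow> K\<close> are extended by \<open>0\<close> outside \<open>K[G]\<close>.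
\<close>

definition Dist :: "('g, 'm) monoid_scheme \<Rightarrow> ('g \<Rightarrow> 'k::field) set \<Rightarrow> nat \<Rightarrow>
    (('g \<Rightarrow> 'k) \<Rightarrow> 'k) set"
  where "Dist G A k = {\<mu>.
    (\<forall>f. f \<notin> A \<longrightarrow> \<mu> f = 0) \<and>
    (\<forall>f\<in>A. \<forall>g\<in>A. \<mu> (\<lambda>x. f x + g x) = \<mu> f + \<mu> g) \<and>
    (\<forall>c. \<forall>f\<in>A. \<mu> (\<lambda>x. c * f x) = c * \<mu> f) \<and>
    (\<forall>f\<in>ideal_power (coord_ring (carrier G) A) (aug_ideal G A) (k + 1). \<mu> f = 0)}"

definition Dist_plus :: "('g, 'm) monoid_scheme \<Rightarrow> ('g \<Rightarrow> 'k::field) set \<Rightarrow> nat \<Rightarrow>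
    (('g \<Rightarrow> 'k) \<Rightarrow> 'k) set"
  where "Dist_plus G A k = {\<mu> \<in> Dist G A k. \<mu> (const_fun (carrier G) 1) = 0}"

text \<open>
  The comultiplication of \<open>K[G]\<close>, with values in functions on \<open>G \<times> G\<close>, and \<open>\<mu> \<otimes> \<rho>\<close> on such functions:
  apply \<open>\<rho>\<close> in the second variable, then \<open>\<mu>\<close> in the first.
\<close>

definition comult :: "('g, 'm) monoid_scheme \<Rightarrow> ('g \<Rightarrow> 'k::field) \<Rightarrow> 'g \<Rightarrow> 'g \<Rightarrow> 'k"
  where "comult G f =
    (\<lambda>x y. if x \<in> carrier G \<and> y \<in> carrier G then f (x \<otimes>\<^bsub>G\<^esub> y) else 0)"

definition tensor_dist :: "(('g \<Rightarrow> 'k) \<Rightarrow> 'k) \<Rightarrow> (('g \<Rightarrow> 'k) \<Rightarrow> 'k) \<Rightarrow> ('g \<Rightarrow> 'g \<Rightarrow> 'k) \<Rightarrow> 'k"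
  where "tensor_dist \<mu> \<rho> F = \<mu> (\<lambda>x. \<rho> (F x))"

definition dist_mult :: "('g, 'm) monoid_scheme \<Rightarrow> ('g \<Rightarrow> 'k::field) set \<Rightarrow>
    (('g \<Rightarrow> 'k) \<Rightarrow> 'k) \<Rightarrow> (('g \<Rightarrow> 'k) \<Rightarrow> 'k) \<Rightarrow> ('g \<Rightarrow> 'k) \<Rightarrow> 'k"
  where "dist_mult G A \<mu> \<rho> = ext0 A (\<lambda>f. tensor_dist \<mu> \<rho> (comult G f))"

definition dist_commutator :: "('g, 'm) monoid_scheme \<Rightarrow> ('g \<Rightarrow> 'k::field) set \<Rightarrow>
    (('g \<Rightarrow> 'k) \<Rightarrow> 'k) \<Rightarrow> (('g \<Rightarrow> 'k) \<Rightarrow> 'k) \<Rightarrow> ('g \<Rightarrow> 'k) \<Rightarrow> 'k"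
  where "dist_commutator G A \<mu> \<rho> = (\<lambda>f. dist_mult G A \<mu> \<rho> f - dist_mult G A \<rho> \<mu> f)"

context affine_algebraic_group
begin

lemma ext0_carrier: "f \<in> A \<Longrightarrow> ext0 (carrier G) f = f"
  using zero_outside by (auto simp: ext0_def)

lemma zero_in: "(\<lambda>x. 0) \<in> A"
  using const_closed[of 0] by (simp add: const_fun_def ext0_def cong: if_cong)

lemma scale_in:
  assumes "f \<in> A" shows "(\<lambda>x. c * f x) \<in> A"
proof -
  have "(\<lambda>x. const_fun (carrier G) c x * f x) = (\<lambda>x. c * f x)"
    using zero_outside[OF assms] by (auto simp: const_fun_def ext0_def)
  then show ?thesis
    using mult_closed[OF const_closed[of c] assms] by simp
qed

lemma lincomb_in:
  assumes "\<forall>i<n. u i \<in> A" shows "(\<lambda>x. \<Sum>i<(n::nat). c i * u i x) \<in> A"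
  using assms
proof (induction n)
  case 0
  then show ?case by (simp add: zero_in)
next
  case (Suc n)
  then show ?case
    using add_closed[of "\<lambda>x. \<Sum>i<n. c i * u i x" "\<lambda>x. c n * u n x"] scale_in by simp
qed

lemma Dist_add: "\<mu> \<in> Dist G A k \<Longrightarrow> f \<in> A \<Longrightarrow> g \<in> A \<Longrightarrow> \<mu> (\<lambda>x. f x + g x) = \<mu> f + \<mu> g"
  by (simp add: Dist_def)

lemma Dist_scale: "\<mu> \<in> Dist G A k \<Longrightarrow> f \<in> A \<Longrightarrow> \<mu> (\<lambda>x. c * f x) = c * \<mu> f"
  by (simp add: Dist_def)

lemma Dist_lincomb:
  assumes "\<mu> \<in> Dist G A k" and "\<forall>i<n. u i \<in> A"
  shows "\<mu> (\<lambda>x. \<Sum>i<(n::nat). c i * u i x) = (\<Sum>i<n. c i * \<mu> (u i))"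
  using assms(2)
proof (induction n)
  case 0
  show ?case
    using Dist_scale[OF assms(1) zero_in, of 0] by simp
next
  case (Suc n)
  have "(\<lambda>x. \<Sum>i<n. c i * u i x) \<in> A" "(\<lambda>x. c n * u n x) \<in> A"
    using Suc.prems lincomb_in scale_in by auto
  then have "\<mu> (\<lambda>x. (\<Sum>i<n. c i * u i x) + c n * u n x)
      = \<mu> (\<lambda>x. \<Sum>i<n. c i * u i x) + \<mu> (\<lambda>x. c n * u n x)"
    by (rule Dist_add[OF assms(1)])
  moreover have "\<mu> (\<lambda>x. c n * u n x) = c n * \<mu> (u n)"
    using Suc.prems by (intro Dist_scale[OF assms(1)]) simp
  ultimately show ?case using Suc by simp
qed

text \<open>The product in Sweedler form: \<open>(\<mu>\<rho>)(f) = \<Sum> \<mu>(u\<^sub>i) \<rho>(v\<^sub>i)\<close> whenever \<open>\<Delta> f = \<Sum> u\<^sub>i \<otimes> v\<^sub>i\<close>.\<close>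

lemma dist_mult_eq:
  assumes "\<mu> \<in> Dist G A k" "\<rho> \<in> Dist G A l" "f \<in> A"
    and uv: "\<forall>i<n. u i \<in> A \<and> v i \<in> A"
    and f: "\<forall>x\<in>carrier G. \<forall>y\<in>carrier G. f (x \<otimes> y) = (\<Sum>i<(n::nat). u i x * v i y)"
  shows "dist_mult G A \<mu> \<rho> f = (\<Sum>i<n. \<mu> (u i) * \<rho> (v i))"
proof -
  have "comult G f = (\<lambda>x y. \<Sum>i<n. u i x * v i y)"
  proof (intro ext)
    fix x y
    show "comult G f x y = (\<Sum>i<n. u i x * v i y)"
      using f uv zero_outside by (cases "x \<in> carrier G"; cases "y \<in> carrier G")
        (auto simp: comult_def ext0_def intro!: sum.neutral)
  qed
  then have "\<mu> (\<lambda>x. \<rho> (comult G f x)) = \<mu> (\<lambda>x. \<Sum>i<n. \<rho> (v i) * u i x)"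
    using Dist_lincomb[OF assms(2), of n v "\<lambda>i. u i _"] uv by (simp add: mult.commute)
  also have "\<dots> = (\<Sum>i<n. \<mu> (u i) * \<rho> (v i))"
    using Dist_lincomb[OF assms(1), of n u] uv by (simp add: mult.commute)
  finally show ?thesis
    using \<open>f \<in> A\<close> by (simp add: dist_mult_def ext0_def tensor_dist_def)
qed

end


section \<open>The tensor algebra\<close>

text \<open>
  The free associative algebra on a set \<open>V\<close>: finitely supported functions on words over \<open>V\<close>, with
  convolution along concatenation.
\<close>

definition free_algebra :: "'v set \<Rightarrow> ('v list \<Rightarrow> 'k::field) ring"
  where "free_algebra V =
    \<lparr>carrier = {a. finite {w. a w \<noteq> 0} \<and> {w. a w \<noteq> 0} \<subseteq> lists V},
     monoid.mult = (\<lambda>a b w. \<Sum>n\<le>length w. a (take n w) * b (drop n w)),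
     one = (\<lambda>w. if w = [] then 1 else 0),
     zero = (\<lambda>w. 0),
     add = (\<lambda>a b w. a w + b w)\<rparr>"

definition free_scalar :: "'k::field \<Rightarrow> 'v list \<Rightarrow> 'k"
  where "free_scalar c = (\<lambda>w. if w = [] then c else 0)"

definition free_gen :: "'v \<Rightarrow> 'v list \<Rightarrow> 'k::field"
  where "free_gen x = (\<lambda>w. if w = [x] then 1 else 0)"

lemma free_algebra_mult_assoc:
  fixes a b c :: "'v list \<Rightarrow> 'k::field"
  shows "(\<Sum>n\<le>length w. (\<Sum>m\<le>length (take n w). a (take m (take n w)) * b (drop m (take n w))) * c (drop n w))
    = (\<Sum>m\<le>length w. a (take m w) *
        (\<Sum>l\<le>length (drop m w). b (take l (drop m w)) * c (drop l (drop m w))))" (is "?L = ?R")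
proof -
  have "?L = (\<Sum>n\<le>length w. \<Sum>m\<le>n. a (take m w) * b (drop m (take n w)) * c (drop n w))"
    by (intro sum.cong) (auto simp: sum_distrib_right min_def intro!: sum.cong)
  also have "\<dots> = (\<Sum>(n, m)\<in>Sigma {..length w} (\<lambda>n. {..n}).
      a (take m w) * b (drop m (take n w)) * c (drop n w))"
    by (simp add: sum.Sigma)
  also have "\<dots> = (\<Sum>(m, l)\<in>Sigma {..length w} (\<lambda>m. {..length w - m}).
      a (take m w) * (b (take l (drop m w)) * c (drop l (drop m w))))"
    by (rule sum.reindex_bij_witness[of _ "\<lambda>(m, l). (m + l, m)" "\<lambda>(n, m). (m, n - m)"])
      (auto simp: drop_take mult.assoc)
  also have "\<dots> = ?R"
    by (simp add: sum.Sigma sum_distrib_left)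
  finally show ?thesis .
qed

lemma free_algebra_mult_closed:
  assumes "a \<in> carrier (free_algebra V)" "b \<in> carrier (free_algebra V)"
  shows "a \<otimes>\<^bsub>free_algebra V\<^esub> b \<in> carrier (free_algebra V)"
proof -
  let ?S = "\<lambda>a :: 'a list \<Rightarrow> 'b. {w. a w \<noteq> 0}"
  have *: "w \<in> (\<lambda>(u, v). u @ v) ` (?S a \<times> ?S b)"
    if "(a \<otimes>\<^bsub>free_algebra V\<^esub> b) w \<noteq> 0" for w
  proof -
    from that obtain n where "a (take n w) * b (drop n w) \<noteq> 0"
      by (auto simp: free_algebra_def elim!: sum.not_neutral_contains_not_neutral)
    then have "(take n w, drop n w) \<in> ?S a \<times> ?S b"
      by auto
    then show ?thesis
      by (metis (mono_tags, lifting) append_take_drop_id image_eqI split_conv)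
  qed
  then have sub: "?S (a \<otimes>\<^bsub>free_algebra V\<^esub> b) \<subseteq> (\<lambda>(u, v). u @ v) ` (?S a \<times> ?S b)"
    by auto
  have ab: "finite (?S a)" "finite (?S b)" "?S a \<subseteq> lists V" "?S b \<subseteq> lists V"
    using assms by (auto simp: free_algebra_def)
  have "finite (?S (a \<otimes>\<^bsub>free_algebra V\<^esub> b))"
    using finite_subset[OF sub] ab by blast
  moreover have "?S (a \<otimes>\<^bsub>free_algebra V\<^esub> b) \<subseteq> lists V"
    using sub ab by fastforce
  ultimately show ?thesis
    by (simp add: free_algebra_def)
qed

lemma free_algebra_add_closed:
  assumes "a \<in> carrier (free_algebra V)" "b \<in> carrier (free_algebra V)"
  shows "(\<lambda>w. a w + b w) \<in> carrier (free_algebra V)"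
proof -
  have "{w. a w + b w \<noteq> 0} \<subseteq> {w. a w \<noteq> 0} \<union> {w. b w \<noteq> 0}"
    by auto
  with assms show ?thesis
    by (auto simp: free_algebra_def intro: finite_subset)
qed

lemma free_algebra_smult_closed:
  assumes "a \<in> carrier (free_algebra V)"
  shows "(\<lambda>w. c * a w) \<in> carrier (free_algebra V)"
proof -
  have "{w. c * a w \<noteq> 0} \<subseteq> {w. a w \<noteq> 0}"
    by auto
  with assms show ?thesis
    by (auto simp: free_algebra_def intro: finite_subset)
qed

lemma free_algebra_ring: "ring (free_algebra V :: ('v list \<Rightarrow> 'k::field) ring)" (is "ring ?F")
proof (rule ringI)
  show "abelian_group ?F"
  proof (rule abelian_groupI)
    fix a assume a: "a \<in> carrier ?F"
    show "\<exists>b\<in>carrier ?F. b \<oplus>\<^bsub>?F\<^esub> a = \<zero>\<^bsub>?F\<^esub>"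
      by (rule bexI[OF _ free_algebra_smult_closed[OF a, of "-1"]]) (simp add: free_algebra_def)
  qed (use free_algebra_add_closed[where V = V] in \<open>auto simp: free_algebra_def algebra_simps\<close>)
next
  show "monoid ?F"
  proof (rule monoidI)
    fix a b c :: "'v list \<Rightarrow> 'k"
    show "a \<otimes>\<^bsub>?F\<^esub> b \<otimes>\<^bsub>?F\<^esub> c = a \<otimes>\<^bsub>?F\<^esub> (b \<otimes>\<^bsub>?F\<^esub> c)"
      using free_algebra_mult_assoc[where a = a and b = b and c = c] by (simp add: free_algebra_def)
  next
    fix a :: "'v list \<Rightarrow> 'k"
    show "\<one>\<^bsub>?F\<^esub> \<otimes>\<^bsub>?F\<^esub> a = a"
    proof
      fix w
      have "(\<Sum>n\<le>length w. (if take n w = [] then 1 else 0) * a (drop n w))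
          = (\<Sum>n\<le>length w. if n = 0 then a w else 0)"
        by (intro sum.cong) auto
      then show "(\<one>\<^bsub>?F\<^esub> \<otimes>\<^bsub>?F\<^esub> a) w = a w"
        by (simp add: free_algebra_def)
    qed
    show "a \<otimes>\<^bsub>?F\<^esub> \<one>\<^bsub>?F\<^esub> = a"
    proof
      fix w
      have "(\<Sum>n\<le>length w. a (take n w) * (if drop n w = [] then 1 else 0))
          = (\<Sum>n\<le>length w. if n = length w then a w else 0)"
        by (intro sum.cong) auto
      then show "(a \<otimes>\<^bsub>?F\<^esub> \<one>\<^bsub>?F\<^esub>) w = a w"
        by (simp add: free_algebra_def)
    qed
  next
    show "\<one>\<^bsub>?F\<^esub> \<in> carrier ?F"
      by (auto simp: free_algebra_def)
  qed (rule free_algebra_mult_closed)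
qed (auto simp: free_algebra_def algebra_simps sum.distrib)

lemma free_gen_closed: "x \<in> V \<Longrightarrow> free_gen x \<in> carrier (free_algebra V)"
  by (auto simp: free_gen_def free_algebra_def)

text \<open>
  For a vector space \<open>V\<close> (of \<open>K\<close>-valued functions) the tensor algebra \<open>T(V)\<close> is the free algebra on the
  set \<open>V\<close> modulo the relations making the canonical map from \<open>V\<close> linear.
\<close>

definition linear_relations :: "('a \<Rightarrow> 'k::field) set \<Rightarrow> (('a \<Rightarrow> 'k) list \<Rightarrow> 'k) set"
  where "linear_relations V =
    {(\<lambda>w. free_gen (\<lambda>t. x t + y t) w - free_gen x w - free_gen y w) |x y. x \<in> V \<and> y \<in> V} \<union>
    {(\<lambda>w. free_gen (\<lambda>t. c * x t) w - c * free_gen x w) |c x. x \<in> V}"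

definition linear_ideal :: "('a \<Rightarrow> 'k::field) set \<Rightarrow> (('a \<Rightarrow> 'k) list \<Rightarrow> 'k) set"
  where "linear_ideal V = genideal (free_algebra V) (linear_relations V)"

definition tensor_algebra :: "('a \<Rightarrow> 'k::field) set \<Rightarrow> (('a \<Rightarrow> 'k) list \<Rightarrow> 'k) set ring"
  where "tensor_algebra V = free_algebra V Quot linear_ideal V"

definition tensor_scalar :: "('a \<Rightarrow> 'k::field) set \<Rightarrow> 'k \<Rightarrow> (('a \<Rightarrow> 'k) list \<Rightarrow> 'k) set"
  where "tensor_scalar V c = linear_ideal V +>\<^bsub>free_algebra V\<^esub> free_scalar c"

definition tensor_gen :: "('a \<Rightarrow> 'k::field) set \<Rightarrow> ('a \<Rightarrow> 'k) \<Rightarrow> (('a \<Rightarrow> 'k) list \<Rightarrow> 'k) set"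
  where "tensor_gen V x = linear_ideal V +>\<^bsub>free_algebra V\<^esub> free_gen x"

lemma tensor_algebra_ring:
  assumes add: "\<And>x y. x \<in> V \<Longrightarrow> y \<in> V \<Longrightarrow> (\<lambda>t. x t + y t) \<in> V"
    and scale: "\<And>c x. x \<in> V \<Longrightarrow> (\<lambda>t. c * x t) \<in> V"
  shows "ideal (linear_ideal V) (free_algebra V)" and "ring (tensor_algebra V)"
proof -
  have "linear_relations V \<subseteq> carrier (free_algebra V)"
  proof
    fix a assume "a \<in> linear_relations V"
    then consider
        x y where "x \<in> V" "y \<in> V" "a = (\<lambda>w. free_gen (\<lambda>t. x t + y t) w - free_gen x w - free_gen y w)"
      | c x where "x \<in> V" "a = (\<lambda>w. free_gen (\<lambda>t. c * x t) w - c * free_gen x w)"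
      unfolding linear_relations_def by blast
    then show "a \<in> carrier (free_algebra V)"
    proof cases
      case 1
      have "(\<lambda>w. (free_gen (\<lambda>t. x t + y t) w + (-1) * free_gen x w) + (-1) * free_gen y w)
          \<in> carrier (free_algebra V)"
        by (intro free_algebra_add_closed free_algebra_smult_closed free_gen_closed add 1)
      then show ?thesis using 1 by simp
    next
      case 2
      have "(\<lambda>w. free_gen (\<lambda>t. c * x t) w + (-c) * free_gen x w) \<in> carrier (free_algebra V)"
        by (intro free_algebra_add_closed free_algebra_smult_closed free_gen_closed scale 2)
      then show ?thesis using 2 by simp
    qed
  qed
  then show *: "ideal (linear_ideal V) (free_algebra V)"
    unfolding linear_ideal_def by (rule ring.genideal_ideal[OF free_algebra_ring])
  show "ring (tensor_algebra V)"
    unfolding tensor_algebra_def by (rule ideal.quotient_is_ring[OF *])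
qed


section \<open>The higher universal enveloping algebra\<close>

definition env_space :: "('g, 'm) monoid_scheme \<Rightarrow> ('g \<Rightarrow> 'k::field) set \<Rightarrow> nat \<Rightarrow>
    (('g \<Rightarrow> 'k) \<Rightarrow> 'k) set"
  where "env_space G A r = Dist_plus G A (CHAR('k) ^ (r + 1) - 1)"

text \<open>
  The requirement that \<open>x\<close> and \<open>y\<close> lie in the generating space only matters for the second family, in the
  degenerate case \<open>{i, j} = {0, p ^ (r + 1)}\<close>: there one of \<open>x\<close>, \<open>y\<close> is \<open>0\<close>, but the other one need not
  define an element of the tensor algebra.
\<close>

definition env_relations :: "('g, 'm) monoid_scheme \<Rightarrow> ('g \<Rightarrow> 'k::field) set \<Rightarrow> nat \<Rightarrow>
    ((('g \<Rightarrow> 'k) \<Rightarrow> 'k) list \<Rightarrow> 'k) set set"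
  where "env_relations G A r =
    (let p = CHAR('k); V = env_space G A r; T = tensor_algebra V; \<iota> = tensor_gen V in
      {\<iota> x \<otimes>\<^bsub>T\<^esub> \<iota> y \<ominus>\<^bsub>T\<^esub> \<iota> (dist_mult G A x y) |x y i j.
         x \<in> V \<and> y \<in> V \<and> x \<in> Dist_plus G A i \<and> y \<in> Dist_plus G A j \<and> i + j < p ^ (r + 1)} \<union>
      {(\<iota> x \<otimes>\<^bsub>T\<^esub> \<iota> y \<ominus>\<^bsub>T\<^esub> \<iota> y \<otimes>\<^bsub>T\<^esub> \<iota> x) \<ominus>\<^bsub>T\<^esub> \<iota> (dist_commutator G A x y) |x y i j.
         x \<in> V \<and> y \<in> V \<and> x \<in> Dist_plus G A i \<and> y \<in> Dist_plus G A j \<and> i + j \<le> p ^ (r + 1)})"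

definition env_ideal :: "('g, 'm) monoid_scheme \<Rightarrow> ('g \<Rightarrow> 'k::field) set \<Rightarrow> nat \<Rightarrow>
    ((('g \<Rightarrow> 'k) \<Rightarrow> 'k) list \<Rightarrow> 'k) set set"
  where "env_ideal G A r = genideal (tensor_algebra (env_space G A r)) (env_relations G A r)"

definition higher_env :: "('g, 'm) monoid_scheme \<Rightarrow> ('g \<Rightarrow> 'k::field) set \<Rightarrow> nat \<Rightarrow>
    ((('g \<Rightarrow> 'k) \<Rightarrow> 'k) list \<Rightarrow> 'k) set set ring"
  where "higher_env G A r = tensor_algebra (env_space G A r) Quot env_ideal G A r"

definition higher_env_scalar :: "('g, 'm) monoid_scheme \<Rightarrow> ('g \<Rightarrow> 'k::field) set \<Rightarrow> nat \<Rightarrow> 'k \<Rightarrow>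
    ((('g \<Rightarrow> 'k) \<Rightarrow> 'k) list \<Rightarrow> 'k) set set"
  where "higher_env_scalar G A r c =
    env_ideal G A r +>\<^bsub>tensor_algebra (env_space G A r)\<^esub> tensor_scalar (env_space G A r) c"

end

theory Submission
  imports Defs "HOL-Library.Function_Algebras" "HOL-Library.Poly_Mapping"
begin

text \<open>
  Write \<open>q = p\<^sup>r\<^sup>+\<^sup>1\<close>, \<open>s = p\<^sup>r\<close>, let \<open>V\<^sub>m\<close> be the space of distributions of order at most \<open>m\<close> that vanish
  on constants, and let \<open>U\<close> be the higher enveloping algebra, which is generated by the image of
  \<open>V\<^sub>q\<^sub>-\<^sub>1\<close>.  The point is that \<open>U\<close> is finite over a polynomial algebra in finitely many central elements;
  everything claimed about the centre then follows because polynomial algebras are Noetherian.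

  Modulo higher order the coproduct of a function is symmetric, so commutators drop the
  order (\<open>commutator_V\<close>).  If \<open>m\<close> is not a power of \<open>p\<close>, then \<open>V\<^sub>m\<close> is spanned by products of
  distributions of lower positive orders, modulo \<open>V\<^sub>m\<^sub>-\<^sub>1\<close> (\<open>D_decomposition\<close>); the
  exceptional \<open>m\<close> are those for which all binomial coefficients \<open>m choose i\<close> with \<open>0 < i < m\<close> vanish
  modulo \<open>p\<close>.  Hence \<open>U\<close> is generated by finitely many \<open>letters\<close>, namely spanning
  sets of \<open>V\<^bsub>p^k\<^esub>\<close> with \<open>k \<le> r\<close>.  Give such a letter the weight \<open>p\<^sup>k\<close>; the relations of \<open>U\<close> say that the
  commutator of two letters lies in lower filtration than their product (\<open>commuting_letters\<close>).

  The \<open>p\<close>-th power of a distribution of order \<open>n\<close> has order less than \<open>p n\<close>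
  (\<open>dpow_p\<close>).  So the letters with \<open>k < r\<close> are nilpotent modulo lower filtration and generate a
  finite-dimensional subalgebra \<open>Dd\<close>.  It contains the images of the distributions of order below
  \<open>q\<close> supported on the \<open>r\<close>-th Frobenius kernel (\<open>g_D_Dd\<close>), and as that kernel is normal, \<open>V\<^sub>s\<close>
  normalizes \<open>Dd\<close> (\<open>commutator_D\<close>, \<open>ad_Dd\<close>).

  Let \<open>w\<close> come from \<open>V\<^sub>s\<close>.  The space \<open>E = Dd + V\<^sub>s Dd\<close> is finite-dimensional,
  stable under commutation with \<open>V\<^sub>s\<close>, and contains all letters.  In characteristic \<open>p\<close> commutation
  with \<open>w\<^bsup>p^i\<^esup>\<close> is the \<open>p\<^sup>i\<close>-th iterate of commutation with \<open>w\<close>, and these operators on \<open>E\<close> are linearly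
  dependent.  As in Jacobson's treatment of Lie algebras in characteristic \<open>p\<close>, some \<open>p\<close>-polynomial
  \<open>w\<^bsup>p^N\<^esup> - \<Sum>\<^bsub>i<N\<^esub> a\<^sub>i w\<^bsup>p^i\<^esup>\<close> therefore commutes with \<open>E\<close>, hence is central (\<open>central_p_polynomial\<close>).

  Every letter has a power that is central modulo lower filtration, so words in which
  some letter occurs often can be rewritten with a central factor in front, and \<open>U\<close> is spanned by
  finitely many words over the algebra generated by these central elements
  (\<open>finite_over_central_powers\<close>).  The centre is a submodule of \<open>U\<close>, hence finitely generated over that
  algebra, hence a finitely generated algebra (\<open>centre_finiteness\<close>).

  The ring \<open>U\<close> is a quotient of a quotient with an explicit carrier.  The computations are therefore
  made in a ring type, the free algebra of finitely supported functions on words, modulo an ideal \<open>Q\<close>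
  with quotient \<open>U\<close>, and centrality and finiteness are expressed by congruences modulo \<open>Q\<close>.
\<close>

section \<open>Algebras filtered by weighted, almost commuting generators\<close>

text \<open>
  A sequence in a finite-dimensional vector space cannot stay linearly independent, so some term is a
  combination of its predecessors.  The coordinates are indexed by \<open>X\<close>, and the coefficients do not
  depend on the coordinate.
\<close>

lemma eventually_recurrent:
  fixes c :: "nat \<Rightarrow> 'x \<Rightarrow> 'k::field"
  assumes "finite X"
  shows "\<exists>N a. \<forall>x\<in>X. c N x = (\<Sum>i<N. a i * c i x)"
proof -
  interpret V: vector_space "\<lambda>(c::'k) (f::'x \<Rightarrow> 'k) x. c * f x"
    by unfold_locales (auto simp: fun_eq_iff algebra_simps)
  define v where "v i = (\<lambda>x. if x \<in> X then c i x else 0)" for i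
  define \<delta> :: "'x \<Rightarrow> 'x \<Rightarrow> 'k" where "\<delta> x = (\<lambda>y. if y = x then 1 else 0)" for x
  have sum_app: "(\<Sum>i\<in>S. f i) x = (\<Sum>i\<in>S. f i x)" for S and f :: "'z \<Rightarrow> 'x \<Rightarrow> 'k" and x
    by (induction S rule: infinite_finite_induct) auto
  have v_span: "v i \<in> V.span (\<delta> ` X)" for i
  proof -
    have "v i = (\<Sum>x\<in>X. (\<lambda>y. c i x * \<delta> x y))"
      using assms by (auto simp: v_def \<delta>_def fun_eq_iff sum_app if_distrib cong: if_cong)
    also have "\<dots> \<in> V.span (\<delta> ` X)"
      by (intro V.span_sum V.span_scale V.span_base imageI)
    finally show ?thesis .
  qed
  have "\<exists>N. v N \<in> V.span (v ` {..<N})"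
  proof (rule ccontr)
    assume "\<nexists>N. v N \<in> V.span (v ` {..<N})"
    then have *: "v N \<notin> V.span (v ` {..<N})" for N
      by simp
    have "V.independent (v ` {..<n}) \<and> card (v ` {..<n}) = n" for n
    proof (induction n)
      case (Suc n)
      have "v n \<notin> v ` {..<n}"
        using *[of n] V.span_base[of "v n" "v ` {..<n}"] by argo
      then show ?case
        using Suc * by (simp add: lessThan_Suc V.independent_insertI)
    qed (simp add: V.independent_empty)
    then have "Suc (card (\<delta> ` X)) \<le> card (\<delta> ` X)"
      using V.independent_span_bound[of "\<delta> ` X" "v ` {..<Suc (card (\<delta> ` X))}"] assms v_span
      by (metis finite_imageI image_subsetI)
    then show False by simp
  qed
  then obtain N where "v N \<in> V.span (v ` {..<N})" ..
  moreover have "V.span (v ` {..<n}) \<subseteq> {f. \<exists>a. f = (\<lambda>x. \<Sum>i<n. a i * v i x)}" for n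
  proof (rule V.span_minimal)
    show "v ` {..<n} \<subseteq> {f. \<exists>a. f = (\<lambda>x. \<Sum>i<n. a i * v i x)}"
    proof clarify
      fix j assume "j < n"
      then show "\<exists>a. v j = (\<lambda>x. \<Sum>i<n. a i * v i x)"
        by (intro exI[of _ "\<lambda>i. if i = j then 1 else 0"]) (simp add: mult_delta_left)
    qed
    show "V.subspace {f. \<exists>a. f = (\<lambda>x. \<Sum>i<n. a i * v i x)}"
    proof (rule V.subspaceI)
      show "0 \<in> {f. \<exists>a. f = (\<lambda>x. \<Sum>i<n. a i * v i x)}"
        by (auto intro!: exI[of _ "\<lambda>_. 0"])
    next
      fix f g assume "f \<in> {f. \<exists>a. f = (\<lambda>x. \<Sum>i<n. a i * v i x)}" "g \<in> {f. \<exists>a. f = (\<lambda>x. \<Sum>i<n. a i * v i x)}"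
      then obtain a b where "f = (\<lambda>x. \<Sum>i<n. a i * v i x)" "g = (\<lambda>x. \<Sum>i<n. b i * v i x)"
        by auto
      then show "f + g \<in> {f. \<exists>a. f = (\<lambda>x. \<Sum>i<n. a i * v i x)}"
        by (auto intro!: exI[of _ "\<lambda>i. a i + b i"] simp: algebra_simps sum.distrib)
    next
      fix c f assume "f \<in> {f. \<exists>a. f = (\<lambda>x. \<Sum>i<n. a i * v i x)}"
      then obtain a where "f = (\<lambda>x. \<Sum>i<n. a i * v i x)"
        by auto
      then show "(\<lambda>x. c * f x) \<in> {f. \<exists>a. f = (\<lambda>x. \<Sum>i<n. a i * v i x)}"
        by (auto intro!: exI[of _ "\<lambda>i. c * a i"] simp: algebra_simps sum_distrib_left)
    qed
  qed
  ultimately obtain a where a: "v N = (\<lambda>x. \<Sum>i<N. a i * v i x)"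
    by blast
  have "c N x = (\<Sum>i<N. a i * c i x)" if "x \<in> X" for x
    using fun_cong[OF a, of x] that by (simp add: v_def)
  then show ?thesis by blast
qed

text \<open>
  An algebra over a field as a ring type with a structure map into its centre, in place of a type class
  for the scalar action.
\<close>

locale central_scalars =
  fixes \<kappa> :: "'k::field \<Rightarrow> 'a::ring_1"
  assumes scal_add: "\<kappa> (c + d) = \<kappa> c + \<kappa> d"
    and scal_mult: "\<kappa> (c * d) = \<kappa> c * \<kappa> d"
    and scal_one [simp]: "\<kappa> 1 = 1"
    and scal_central: "\<kappa> c * x = x * \<kappa> c"
begin

sublocale vs: vector_space "\<lambda>c x. \<kappa> c * x"
  by unfold_locales (auto simp: algebra_simps scal_add scal_mult)

lemma scal_zero [simp]: "\<kappa> 0 = 0"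
  using scal_add[of 0 0] by simp

lemma scal_assoc: "x * (\<kappa> c * y) = \<kappa> c * (x * y)"
  by (metis mult.assoc scal_central)

lemma scal_of_nat: "\<kappa> (of_nat n) = of_nat n"
  by (induction n) (auto simp: scal_add)

text \<open>Bilinearity reduces membership of a product in a subspace to spanning sets of the factors.\<close>

lemma span_mult:
  assumes M: "vs.subspace M" and *: "\<And>a b. a \<in> S \<Longrightarrow> b \<in> T \<Longrightarrow> a * b \<in> M"
    and x: "x \<in> vs.span S" and y: "y \<in> vs.span T"
  shows "x * y \<in> M"
proof -
  have 1: "a * y \<in> M" if "a \<in> S" for a
    using y
  proof (induction rule: vs.span_induct_alt)
    case base show ?case using M by (simp add: vs.subspace_0)
  next
    case (step c t u)
    then show ?case
      using *[OF that] M by (simp add: distrib_left scal_assoc vs.subspace_add vs.subspace_scale)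
  qed
  show ?thesis
    using x
  proof (induction rule: vs.span_induct_alt)
    case base show ?case using M by (simp add: vs.subspace_0)
  next
    case (step c t u)
    then show ?case
      using 1 M by (simp add: distrib_right mult.assoc vs.subspace_add vs.subspace_scale)
  qed
qed

end

text \<open>
  The ideal \<open>Q\<close> is carried along and nothing is divided out: spans always contain \<open>Q\<close>, and equations are
  replaced by membership of a difference in \<open>Q\<close>.
\<close>

locale algebra_quotient = central_scalars \<kappa> for \<kappa> :: "'k::field \<Rightarrow> 'a::ring_1" +
  fixes Q :: "'a set"
  assumes Q_zero: "0 \<in> Q" and Q_add: "x \<in> Q \<Longrightarrow> y \<in> Q \<Longrightarrow> x + y \<in> Q"
    and Q_left: "x \<in> Q \<Longrightarrow> a * x \<in> Q" and Q_right: "x \<in> Q \<Longrightarrow> x * a \<in> Q"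
begin

lemma Q_subspace: "vs.subspace Q"
  by (auto intro!: vs.subspaceI Q_zero Q_add Q_left)

lemma Q_diff: "x \<in> Q \<Longrightarrow> y \<in> Q \<Longrightarrow> x - y \<in> Q"
  by (rule vs.subspace_diff[OF Q_subspace])

lemma in_span_finite_modD:
  assumes "finite B" "x \<in> vs.span (B \<union> Q)"
  shows "\<exists>c. x - (\<Sum>b\<in>B. \<kappa> (c b) * b) \<in> Q"
proof -
  obtain y z where x: "x = y + z" "y \<in> vs.span B" "z \<in> vs.span Q"
    using assms(2) by (auto simp: vs.span_Un)
  then obtain c where "y = (\<Sum>b\<in>B. \<kappa> (c b) * b)"
    using assms(1) by (auto simp: vs.span_finite)
  moreover have "z \<in> Q"
    using x(3) vs.span_minimal[OF order_refl Q_subspace] by blast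
  ultimately show ?thesis
    using x by (intro exI[of _ c]) simp
qed

definition ad :: "'a \<Rightarrow> 'a \<Rightarrow> 'a"
  where "ad w y = w * y - y * w"

lemma ad_in_Q: "y \<in> Q \<Longrightarrow> ad w y \<in> Q"
  by (simp add: ad_def Q_diff Q_left Q_right)

lemma ad_mult: "ad w (x * y) = ad w x * y + x * ad w y"
  by (simp add: ad_def algebra_simps)

lemma ad_add: "ad w (x + y) = ad w x + ad w y"
  by (simp add: ad_def algebra_simps)

lemma ad_scal: "ad w (\<kappa> c * x) = \<kappa> c * ad w x"
  by (simp add: ad_def right_diff_distrib scal_assoc mult.assoc)

lemma ad_span:
  assumes M: "vs.subspace M" and *: "\<And>a. a \<in> S \<Longrightarrow> ad w a \<in> M" and x: "x \<in> vs.span S"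
  shows "ad w x \<in> M"
  using x
proof (induction rule: vs.span_induct_alt)
  case base show ?case using M by (simp add: vs.subspace_0 ad_def)
next
  case (step c t u)
  then show ?case
    using * M by (simp add: ad_add ad_scal vs.subspace_add vs.subspace_scale)
qed

text \<open>The preimage of the centre of the quotient by \<open>Q\<close>.\<close>

definition centre_mod :: "'a set"
  where "centre_mod = {z. \<forall>x. ad z x \<in> Q}"

lemma centre_modD: "z \<in> centre_mod \<Longrightarrow> z * x - x * z \<in> Q"
  by (simp add: centre_mod_def ad_def)

lemma centre_mod_add: "x \<in> centre_mod \<Longrightarrow> y \<in> centre_mod \<Longrightarrow> x + y \<in> centre_mod"
proof -
  have "ad (x + y) u = ad x u + ad y u" for u
    by (simp add: ad_def algebra_simps)
  then show "x \<in> centre_mod \<Longrightarrow> y \<in> centre_mod \<Longrightarrow> x + y \<in> centre_mod"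
    by (simp add: centre_mod_def Q_add)
qed

lemma centre_mod_mult: "x \<in> centre_mod \<Longrightarrow> y \<in> centre_mod \<Longrightarrow> x * y \<in> centre_mod"
proof -
  assume xy: "x \<in> centre_mod" "y \<in> centre_mod"
  have "ad (x * y) u \<in> Q" for u
  proof -
    have "ad (x * y) u = x * ad y u + ad x u * y"
      by (simp add: ad_def algebra_simps)
    then show ?thesis
      using xy by (simp add: centre_mod_def Q_add Q_left Q_right)
  qed
  then show ?thesis by (simp add: centre_mod_def)
qed

lemma centre_mod_scal: "\<kappa> c \<in> centre_mod"
  by (simp add: centre_mod_def ad_def scal_central Q_zero)

lemma Q_centre_mod: "Q \<subseteq> centre_mod"
  by (auto simp: centre_mod_def ad_def Q_diff Q_left Q_right)

lemma centre_mod_subspace: "vs.subspace centre_mod"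
  using Q_centre_mod Q_zero by (auto intro!: vs.subspaceI centre_mod_add centre_mod_mult centre_mod_scal)

lemma ad_centralizer_mult:
  "ad z x \<in> Q \<Longrightarrow> ad z y \<in> Q \<Longrightarrow> ad z (x * y) \<in> Q"
  by (simp add: ad_mult Q_add Q_left Q_right)

text \<open>
  Left multiplication by \<open>w\<close> is the sum of the commuting operators \<open>ad w\<close> and right multiplication by
  \<open>w\<close>; this is the binomial theorem for their sum.
\<close>

lemma power_mult_left:
  "w ^ n * y = (\<Sum>k\<le>n. of_nat (n choose k) * (ad w ^^ k) y * w ^ (n - k))"
proof (induction n)
  case (Suc n)
  let ?t = "\<lambda>k. (ad w ^^ k) y"
  have "w ^ Suc n * y = (\<Sum>k\<le>n. of_nat (n choose k) * (w * ?t k) * w ^ (n - k))"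
    unfolding power_Suc mult.assoc[of w] Suc.IH sum_distrib_left
    by (intro sum.cong refl) (metis mult.assoc mult_of_nat_commute)
  also have "\<dots> = (\<Sum>k\<le>n. of_nat (n choose k) * ?t (Suc k) * w ^ (n - k))
      + (\<Sum>k\<le>n. of_nat (n choose k) * ?t k * w ^ (Suc n - k))"
    unfolding sum.distrib[symmetric]
    by (intro sum.cong refl) (simp add: ad_def algebra_simps Suc_diff_le)
  also have "(\<Sum>k\<le>n. of_nat (n choose k) * ?t k * w ^ (Suc n - k))
      = (\<Sum>k\<le>Suc n. of_nat (n choose k) * ?t k * w ^ (Suc n - k))"
    by (simp add: binomial_eq_0)
  also have "\<dots> = y * w ^ Suc n + (\<Sum>k\<le>n. of_nat (n choose Suc k) * ?t (Suc k) * w ^ (n - k))"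
    by (subst sum.atMost_Suc_shift) simp
  also have "(\<Sum>k\<le>n. of_nat (n choose k) * ?t (Suc k) * w ^ (n - k)) +
      (y * w ^ Suc n + (\<Sum>k\<le>n. of_nat (n choose Suc k) * ?t (Suc k) * w ^ (n - k)))
      = y * w ^ Suc n + (\<Sum>k\<le>n. of_nat (Suc n choose Suc k) * ?t (Suc k) * w ^ (n - k))"
    by (simp add: sum.distrib distrib_right add_ac del: power_Suc)
  also have "\<dots> = (\<Sum>k\<le>Suc n. of_nat (Suc n choose k) * ?t k * w ^ (Suc n - k))"
    unfolding sum.atMost_Suc_shift[of _ n] by simp
  finally show ?case .
qed simp

text \<open>
  In the binomial expansion of \<open>w ^ p * y\<close> only the first and the last term survive modulo \<open>p\<close>.
\<close>

lemma ad_power_prime: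
  assumes "prime p" "CHAR('k) = p"
  shows "ad (w ^ (p ^ k)) = ad w ^^ (p ^ k)"
proof -
  have zero: "of_nat m = (0 :: 'a)" if "p dvd m" for m
  proof -
    have "of_nat m = (0 :: 'k)"
      using that assms(2) by (simp add: of_nat_eq_0_iff_char_dvd)
    then show ?thesis
      using scal_of_nat[of m] by simp
  qed
  have *: "ad (w ^ p) y = (ad w ^^ p) y" for w y
  proof -
    have p0: "p > 0" using assms(1) by (rule prime_gt_0_nat)
    have "w ^ p * y = (\<Sum>k\<in>{0, p}. of_nat (p choose k) * (ad w ^^ k) y * w ^ (p - k))"
      unfolding power_mult_left
    proof (intro sum.mono_neutral_right ballI)
      fix k assume "k \<in> {..p} - {0, p}"
      then show "of_nat (p choose k) * (ad w ^^ k) y * w ^ (p - k) = 0"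
        using zero[OF dvd_choose_prime[of k p]] assms(1) by auto
    qed auto
    then show ?thesis
      using p0 by (simp add: ad_def)
  qed
  show ?thesis
  proof (induction k)
    case (Suc k)
    have "ad (w ^ (p ^ Suc k)) = ad ((w ^ (p ^ k)) ^ p)"
      by (simp add: power_mult[symmetric] mult.commute)
    also have "\<dots> = (ad w ^^ (p ^ k)) ^^ p"
      by (intro ext) (simp only: * Suc)
    finally show ?case
      by (simp only: funpow_mult power_Suc2)
  qed (simp add: fun_eq_iff)
qed

text \<open>
  The operators \<open>ad (w ^ (p ^ i)) = ad w ^^ (p ^ i)\<close> all act on the finite-dimensional quotient of
  \<open>span (B \<union> Q)\<close> by \<open>Q\<close>, so their matrices satisfy a linear dependency with leading coefficient \<open>1\<close>.
\<close>

lemma p_polynomial_centralizes: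
  assumes p: "prime p" "CHAR('k) = p" and B: "finite B"
    and stable: "\<And>y. y \<in> vs.span (B \<union> Q) \<Longrightarrow> ad w y \<in> vs.span (B \<union> Q)"
  shows "\<exists>N a. \<forall>y\<in>vs.span (B \<union> Q). ad (w ^ (p ^ N) - (\<Sum>i<N. \<kappa> (a i) * w ^ (p ^ i))) y \<in> Q"
proof -
  let ?E = "vs.span (B \<union> Q)"
  have "(ad w ^^ n) y \<in> ?E" if "y \<in> ?E" for n y
    using that stable by (induction n) auto
  then have adE: "ad (w ^ (p ^ i)) b \<in> ?E" if "b \<in> B" for i b
    using that unfolding ad_power_prime[OF p] by (simp add: vs.span_base)
  have ex: "\<exists>c. ad (w ^ (p ^ i)) b - (\<Sum>b'\<in>B. \<kappa> (c b') * b') \<in> Q" if "b \<in> B" for i b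
    by (rule in_span_finite_modD[OF B adE[OF that]])
  define c where "c i b = (SOME c. ad (w ^ (p ^ i)) b - (\<Sum>b'\<in>B. \<kappa> (c b') * b') \<in> Q)" for i b
  have c: "ad (w ^ (p ^ i)) b - (\<Sum>b'\<in>B. \<kappa> (c i b b') * b') \<in> Q" if "b \<in> B" for i b
    using someI_ex[OF ex[OF that, of i]] unfolding c_def .
  obtain N a where Na: "\<forall>x\<in>B \<times> B. c N (fst x) (snd x) = (\<Sum>i<N. a i * c i (fst x) (snd x))"
    using eventually_recurrent[of "B \<times> B" "\<lambda>i x. c i (fst x) (snd x)"] B by auto
  define z where "z = w ^ (p ^ N) - (\<Sum>i<N. \<kappa> (a i) * w ^ (p ^ i))"
  have ad_z: "ad z y = ad (w ^ (p ^ N)) y - (\<Sum>i<N. \<kappa> (a i) * ad (w ^ (p ^ i)) y)" for y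
  proof -
    have "(\<Sum>i<N. \<kappa> (a i) * w ^ (p ^ i)) * y - y * (\<Sum>i<N. \<kappa> (a i) * w ^ (p ^ i))
        = (\<Sum>i<N. \<kappa> (a i) * ad (w ^ (p ^ i)) y)"
      by (simp add: ad_def sum_distrib_right sum_distrib_left sum_subtractf right_diff_distrib
          scal_assoc mult.assoc)
    then show ?thesis
      by (simp add: z_def ad_def algebra_simps)
  qed
  have "ad z b \<in> Q" if "b \<in> B" for b
  proof -
    have scal_sum: "\<kappa> (\<Sum>i<n. g i) = (\<Sum>i<n. \<kappa> (g i))" for g :: "nat \<Rightarrow> 'k" and n
      by (induction n) (auto simp: scal_add)
    have "(\<Sum>i<N. \<kappa> (a i) * (\<Sum>b'\<in>B. \<kappa> (c i b b') * b'))
        = (\<Sum>i<N. \<Sum>b'\<in>B. \<kappa> (a i * c i b b') * b')"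
      by (simp add: sum_distrib_left)
    also have "\<dots> = (\<Sum>b'\<in>B. \<Sum>i<N. \<kappa> (a i * c i b b') * b')"
      by (rule sum.swap)
    also have "\<dots> = (\<Sum>b'\<in>B. \<kappa> (\<Sum>i<N. a i * c i b b') * b')"
      by (simp add: scal_sum sum_distrib_right)
    also have "\<dots> = (\<Sum>b'\<in>B. \<kappa> (c N b b') * b')"
      using Na that by (intro sum.cong) auto
    finally have "ad z b = (ad (w ^ (p ^ N)) b - (\<Sum>b'\<in>B. \<kappa> (c N b b') * b'))
        - (\<Sum>i<N. \<kappa> (a i) * (ad (w ^ (p ^ i)) b - (\<Sum>b'\<in>B. \<kappa> (c i b b') * b')))"
      by (simp add: ad_z right_diff_distrib sum_subtractf)
    also have "\<dots> \<in> Q"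
      by (intro Q_diff vs.subspace_sum[OF Q_subspace] Q_left c that)
    finally show ?thesis .
  qed
  then have "\<forall>y\<in>?E. ad z y \<in> Q"
    using ad_span[OF Q_subspace, of "B \<union> Q" z] ad_in_Q by (meson UnE)
  then show ?thesis
    unfolding z_def by (rule exI[where x = a, THEN exI[where x = N]])
qed

end

text \<open>
  The filtration of the algebra by the total weight of words in given letters.  Positivity of the
  weights makes each filtration step finite-dimensional modulo \<open>Q\<close>.
\<close>

locale weighted_letters = algebra_quotient \<kappa> Q for \<kappa> :: "'k::field \<Rightarrow> 'a::ring_1" and Q +
  fixes I :: "'i set" and w :: "'i \<Rightarrow> 'a" and d :: "'i \<Rightarrow> nat"
  assumes finite_letters: "finite I" and weight_pos: "i \<in> I \<Longrightarrow> d i > 0"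
begin

definition word :: "'i list \<Rightarrow> 'a" where "word l = prod_list (map w l)"
definition weight :: "'i list \<Rightarrow> nat" where "weight l = sum_list (map d l)"
definition filt :: "nat \<Rightarrow> 'a set"
  where "filt n = vs.span (word ` {l. set l \<subseteq> I \<and> weight l \<le> n} \<union> Q)"

lemma word_simps [simp]: "word [] = 1" "word (i # l) = w i * word l" "word (l @ l') = word l * word l'"
  "word (replicate n i) = w i ^ n"
  by (induction n) (auto simp: word_def)

lemma weight_simps [simp]: "weight [] = 0" "weight (i # l) = d i + weight l"
  "weight (l @ l') = weight l + weight l'" "weight (replicate n i) = n * d i"
  by (induction n) (auto simp: weight_def)

lemma filt_subspace: "vs.subspace (filt n)"
  by (simp add: filt_def)

lemma filt_mono: "m \<le> n \<Longrightarrow> filt m \<subseteq> filt n"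
  unfolding filt_def by (intro vs.span_mono) auto

lemma Q_filt: "Q \<subseteq> filt n"
  unfolding filt_def using vs.span_superset by blast

lemma word_filt: "set l \<subseteq> I \<Longrightarrow> weight l \<le> n \<Longrightarrow> word l \<in> filt n"
  unfolding filt_def by (intro vs.span_base) auto

lemma letter_filt: "i \<in> I \<Longrightarrow> d i \<le> n \<Longrightarrow> w i \<in> filt n"
  using word_filt[of "[i]" n] by simp

lemma filt_minimal:
  assumes "vs.subspace M" "Q \<subseteq> M" "\<And>l. set l \<subseteq> I \<Longrightarrow> weight l \<le> n \<Longrightarrow> word l \<in> M"
  shows "filt n \<subseteq> M"
  unfolding filt_def using assms by (intro vs.span_minimal) auto

lemma filt_mult: "x \<in> filt m \<Longrightarrow> y \<in> filt n \<Longrightarrow> x * y \<in> filt (m + n)"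
proof (rule span_mult[OF filt_subspace])
  fix a b
  assume ab: "a \<in> word ` {l. set l \<subseteq> I \<and> weight l \<le> m} \<union> Q"
    "b \<in> word ` {l. set l \<subseteq> I \<and> weight l \<le> n} \<union> Q"
  show "a * b \<in> filt (m + n)"
  proof (cases "a \<in> Q \<or> b \<in> Q")
    case True
    then show ?thesis using Q_filt Q_left Q_right by blast
  next
    case False
    with ab obtain l l' where "a = word l" "b = word l'" "set l \<subseteq> I" "set l' \<subseteq> I"
      "weight l \<le> m" "weight l' \<le> n" by auto
    then show ?thesis
      using word_filt[of "l @ l'" "m + n"] by auto
  qed
qed (auto simp: filt_def)

lemma finite_words: "finite {l. set l \<subseteq> I \<and> weight l \<le> n}"
proof -
  have "length l \<le> weight l" if "set l \<subseteq> I" for l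
    using that
  proof (induction l)
    case (Cons a l)
    then show ?case using weight_pos[of a] by simp
  qed simp
  then have "{l. set l \<subseteq> I \<and> weight l \<le> n} \<subseteq> {l. set l \<subseteq> I \<and> length l \<le> n}"
    by (auto intro: le_trans)
  then show ?thesis
    using finite_lists_length_le[OF finite_letters, of n] finite_subset by blast
qed

end

text \<open>
  The associated graded algebra is generated by commuting elements; this is the half of
  the Poincare-Birkhoff-Witt theorem that bounds the algebra from above.
\<close>

locale almost_commuting_letters = weighted_letters +
  assumes commutator_filt: "i \<in> I \<Longrightarrow> j \<in> I \<Longrightarrow> ad (w i) (w j) \<in> filt (d i + d j - 1)"
begin

lemma move_to_front:
  "set (a # u) \<subseteq> I \<Longrightarrow> word (u @ [a]) - word (a # u) \<in> filt (weight (a # u) - 1)"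
proof (induction u)
  case Nil
  show ?case using Q_zero Q_filt by auto
next
  case (Cons b u)
  have pos: "d a > 0" "d b > 0"
    using Cons.prems weight_pos by auto
  have "word ((b # u) @ [a]) - word (a # b # u)
      = w b * (word (u @ [a]) - word (a # u)) + ad (w b) (w a) * word u"
    by (simp add: ad_def algebra_simps)
  moreover have "w b * (word (u @ [a]) - word (a # u)) \<in> filt (d b + (weight (a # u) - 1))"
    using Cons by (intro filt_mult letter_filt) auto
  moreover have "ad (w b) (w a) * word u \<in> filt ((d b + d a - 1) + weight u)"
    using Cons.prems by (intro filt_mult commutator_filt word_filt) auto
  ultimately show ?case
    using pos by (simp add: vs.subspace_add[OF filt_subspace] add_ac)
qed

text \<open>
  Commutators lower the filtration, so the order of the letters in a word matters only up to lower
  terms.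
\<close>

lemma word_perm:
  "set l \<subseteq> I \<Longrightarrow> mset l = mset l' \<Longrightarrow> word l - word l' \<in> filt (weight l - 1)"
proof (induction l arbitrary: l')
  case Nil
  then show ?case using Q_zero Q_filt by auto
next
  case (Cons a l)
  have "a \<in> set l'"
    using Cons.prems(2) by (metis list.set_intros(1) set_mset_mset)
  then obtain u v where l': "l' = u @ a # v"
    by (auto simp: in_set_conv_decomp)
  have ml: "mset l = mset (u @ v)"
    using Cons.prems(2) l' by simp
  then have sl: "set l = set u \<union> set v"
    by (metis mset_eq_setD set_append)
  have wt: "weight l = weight u + weight v"
    using arg_cong[OF ml, of "\<lambda>M. sum_mset (image_mset d M)"] unfolding weight_def
    by (simp flip: sum_mset_sum_list)
  have pos: "d a > 0"
    using Cons.prems weight_pos by auto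
  have "word (a # l) - word l' = w a * (word l - word (u @ v)) - (word (u @ [a]) - word (a # u)) * word v"
    by (simp add: l' algebra_simps)
  moreover have "w a * (word l - word (u @ v)) \<in> filt (weight (a # l) - 1)"
  proof (cases "l = []")
    case True
    then show ?thesis using ml Q_zero Q_filt by auto
  next
    case False
    then have "weight l > 0"
      using Cons.prems weight_pos by (cases l) auto
    moreover have "w a * (word l - word (u @ v)) \<in> filt (d a + (weight l - 1))"
      using Cons.prems by (intro filt_mult letter_filt Cons.IH[OF _ ml]) auto
    ultimately show ?thesis by simp
  qed
  moreover have "(word (u @ [a]) - word (a # u)) * word v \<in> filt ((weight (a # u) - 1) + weight v)"
    using Cons.prems sl by (intro filt_mult move_to_front word_filt) auto
  moreover have "(weight (a # u) - 1) + weight v = weight (a # l) - 1"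
    using pos wt by simp
  ultimately show ?case
    using vs.subspace_diff[OF filt_subspace] by metis
qed

lemma weight_count: "set l \<subseteq> I \<Longrightarrow> weight l = (\<Sum>i\<in>I. count_list l i * d i)"
proof (induction l)
  case (Cons a l)
  then have "(\<Sum>i\<in>I. count_list (a # l) i * d i) = (\<Sum>i\<in>I. (if i = a then d i else 0) + count_list l i * d i)"
    by (intro sum.cong) auto
  then show ?case
    using Cons finite_letters by (simp add: sum.distrib)
qed simp

text \<open>
  A word of large weight contains some letter \<open>i\<close> more than \<open>m i\<close> times.  Move \<open>m i\<close> copies of it to the
  front and replace them by \<open>z i\<close>; both steps change the word by terms of lower filtration, to which the
  induction hypothesis applies.
\<close>

lemma filt_stabilizes:
  assumes pow: "\<And>i. i \<in> I \<Longrightarrow> m i > 0 \<and> w i ^ m i - z i \<in> filt (m i * d i - 1)"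
    and M: "vs.subspace M" "filt (\<Sum>i\<in>I. m i * d i) \<subseteq> M" "\<And>i x. i \<in> I \<Longrightarrow> x \<in> M \<Longrightarrow> z i * x \<in> M"
  shows "filt n \<subseteq> M"
proof (induction n rule: less_induct)
  case (less n)
  show ?case
  proof (rule filt_minimal[OF M(1)])
    show "Q \<subseteq> M" using Q_filt M(2) by blast
    fix l assume l: "set l \<subseteq> I" "weight l \<le> n"
    show "word l \<in> M"
    proof (cases "\<forall>i\<in>I. count_list l i \<le> m i")
      case True
      then have "weight l \<le> (\<Sum>i\<in>I. m i * d i)"
        unfolding weight_count[OF l(1)] by (intro sum_mono) auto
      then show ?thesis using M(2) word_filt l by blast
    next
      case False
      then obtain i where i: "i \<in> I" "count_list l i > m i"
        by (auto simp: not_le)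
      have "count (mset l) i \<ge> m i"
        using i by (simp add: count_mset)
      then have "replicate_mset (m i) i \<subseteq># mset l"
        by (simp add: subseteq_mset_def)
      then obtain N where "mset l = replicate_mset (m i) i + N"
        by (metis subset_mset.add_diff_inverse)
      then obtain l' where ml: "mset l = mset (replicate (m i) i @ l')"
        by (metis ex_mset mset_append mset_replicate)
      have sl: "set l' \<subseteq> I"
        using l(1) mset_eq_setD[OF ml] by auto
      have wt: "weight l = m i * d i + weight l'"
        using arg_cong[OF ml, of "\<lambda>M. sum_mset (image_mset d M)"] unfolding weight_def
        by (simp flip: sum_mset_sum_list add: sum_mset_replicate_mset)
      have pos: "m i * d i > 0"
        using pow[OF i(1)] weight_pos[OF i(1)] by simp
      have lower: "filt (weight l - 1) \<subseteq> M" "filt (weight l') \<subseteq> M"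
        by (rule less.IH, use l(2) pos wt in linarith)+
      have "word l - word (replicate (m i) i @ l') \<in> M"
        using word_perm[OF l(1) ml] lower by blast
      moreover have "(w i ^ m i - z i) * word l' \<in> M"
      proof -
        have "(w i ^ m i - z i) * word l' \<in> filt ((m i * d i - 1) + weight l')"
          using pow i sl by (intro filt_mult word_filt) auto
        then show ?thesis
          using lower wt pos by auto
      qed
      moreover have "z i * word l' \<in> M"
        using M(3)[OF i(1)] lower(2) word_filt[OF sl] by blast
      moreover have "word l = (word l - word (replicate (m i) i @ l')) + (w i ^ m i - z i) * word l' + z i * word l'"
        by (simp add: algebra_simps)
      ultimately show ?thesis
        using M(1) vs.subspace_add by metis
    qed
  qed
qed

end

section \<open>Finiteness of the centre of an algebra finite over central elements\<close>

text \<open>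
  Dickson's lemma, by induction on the length: finitely many tails dominate all tails from below, which
  handles every list whose head is at least the largest head \<open>m\<close> of chosen witnesses; the finitely many
  smaller heads are treated one at a time.
\<close>

lemma dickson:
  fixes L :: "nat list set"
  assumes "\<And>x. x \<in> L \<Longrightarrow> length x = t"
  shows "\<exists>L0. finite L0 \<and> L0 \<subseteq> L \<and> (\<forall>x\<in>L. \<exists>y\<in>L0. list_all2 (\<le>) y x)"
  using assms
proof (induction t arbitrary: L)
  case 0
  then have "L \<subseteq> {[]}" by auto
  then show ?case
    by (intro exI[of _ L]) (auto intro: finite_subset)
next
  case (Suc t)
  have slice: "\<exists>S. finite S \<and> S \<subseteq> X \<and> (\<forall>x\<in>X. \<exists>y\<in>S. list_all2 (\<le>) y x)"
    if "\<And>x. x \<in> X \<Longrightarrow> length x = t" for X :: "nat list set"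
    by (rule Suc.IH) (rule that)
  obtain S where S: "finite S" "S \<subseteq> tl ` L" "\<forall>x\<in>tl ` L. \<exists>y\<in>S. list_all2 (\<le>) y x"
  proof -
    have "\<And>x. x \<in> tl ` L \<Longrightarrow> length x = t"
      using Suc.prems by auto
    from slice[OF this] show ?thesis using that by blast
  qed
  then obtain S' where S': "finite S'" "S' \<subseteq> L" "S = tl ` S'"
    using finite_subset_image by meson
  obtain m where m: "\<And>y. y \<in> S' \<Longrightarrow> hd y \<le> m"
    using finite_nat_set_iff_bounded_le[of "hd ` S'"] S'(1) by auto
  have "\<forall>j. \<exists>T. finite T \<and> T \<subseteq> {x. j # x \<in> L} \<and> (\<forall>x\<in>{x. j # x \<in> L}. \<exists>y\<in>T. list_all2 (\<le>) y x)"
    by (intro allI slice) (use Suc.prems in force)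
  then obtain T where T: "\<And>j. finite (T j)" "\<And>j. T j \<subseteq> {x. j # x \<in> L}"
    "\<And>j x. j # x \<in> L \<Longrightarrow> \<exists>y\<in>T j. list_all2 (\<le>) y x"
    by (metis mem_Collect_eq)
  show ?case
  proof (intro exI[of _ "S' \<union> (\<Union>j<m. (#) j ` T j)"] conjI ballI)
    show "finite (S' \<union> (\<Union>j<m. (#) j ` T j))"
      using S'(1) T(1) by auto
    show "S' \<union> (\<Union>j<m. (#) j ` T j) \<subseteq> L"
      using S'(2) T(2) by auto
    fix x assume x: "x \<in> L"
    then obtain j u where ju: "x = j # u"
      using Suc.prems[OF x] by (cases x) auto
    show "\<exists>y\<in>S' \<union> (\<Union>j<m. (#) j ` T j). list_all2 (\<le>) y x"
    proof (cases "j < m")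
      case True
      then show ?thesis
        using T(3)[of j u] x ju by auto
    next
      case False
      obtain y where y: "y \<in> S'" "list_all2 (\<le>) (tl y) u"
        using S(3) x ju S'(3) by force
      moreover have "y \<noteq> []"
        using y(1) S'(2) Suc.prems[of y] by auto
      ultimately have "list_all2 (\<le>) y x"
        using m[of y] False ju by (cases y) auto
      then show ?thesis using y(1) by blast
    qed
  qed
qed

lemma lex_shift:
  "(x, y) \<in> lex less_than \<Longrightarrow> length b = length y \<Longrightarrow> (map2 (+) x b, map2 (+) y b) \<in> lex less_than"
proof (induction x arbitrary: y b)
  case (Cons a x)
  obtain a' y' where "y = a' # y'"
    using Cons.prems(1) by (cases y) auto
  moreover obtain c b' where "b = c # b'"
    using Cons.prems(2) calculation by (cases b) auto
  ultimately show ?case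
    using Cons by auto
qed simp

lemma lex_linear:
  "length x = length y \<Longrightarrow> (x, y) \<in> lex less_than \<or> x = y \<or> (y, x) \<in> lex less_than"
proof -
  have "\<forall>a b. (a, b) \<in> less_than \<or> a = b \<or> (b, a) \<in> less_than"
    by auto
  then show "length x = length y \<Longrightarrow> ?thesis"
    using lexord_linear[of less_than x y] by (auto simp: lexord_lex)
qed

lemma lex_less_than_trans:
  "(x, y) \<in> lex less_than \<Longrightarrow> (y, z) \<in> lex less_than \<Longrightarrow> (x, z) \<in> lex less_than"
  using lexord_trans[OF _ _ trans_less_than, of x y z] by (auto simp: lexord_lex)

context algebra_quotient
begin

fun monomial :: "'a list \<Rightarrow> nat list \<Rightarrow> 'a" where
  "monomial (z # zs) (a # as) = z ^ a * monomial zs as"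
| "monomial _ _ = 1"

lemma centre_mod_power: "z \<in> centre_mod \<Longrightarrow> z ^ n \<in> centre_mod"
  using centre_mod_scal[of 1] by (induction n) (auto intro: centre_mod_mult)

text \<open>Central elements commute with everything modulo \<open>Q\<close>, so exponents add.\<close>

lemma monomial_add:
  "set zs \<subseteq> centre_mod \<Longrightarrow> length a = length zs \<Longrightarrow> length b = length zs \<Longrightarrow>
    monomial zs b * monomial zs a - monomial zs (map2 (+) a b) \<in> Q"
proof (induction zs arbitrary: a b)
  case (Cons z zs)
  obtain i a' j b' where ab: "a = i # a'" "b = j # b'"
    using Cons.prems by (cases a; cases b) auto
  let ?u = "monomial zs b'" and ?v = "monomial zs a'"
  have "monomial (z # zs) b * monomial (z # zs) a - monomial (z # zs) (map2 (+) a b)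
      = - (z ^ j * ((z ^ i * ?u - ?u * z ^ i) * ?v)) + z ^ (i + j) * (?u * ?v - monomial zs (map2 (+) a' b'))"
    by (simp add: ab algebra_simps power_add[symmetric] flip: mult.assoc)
  moreover have "z ^ i * ?u - ?u * z ^ i \<in> Q"
    using centre_modD[OF centre_mod_power] Cons.prems by auto
  moreover have "?u * ?v - monomial zs (map2 (+) a' b') \<in> Q"
    using Cons ab by auto
  ultimately show ?case
    using Q_add Q_left Q_right vs.subspace_neg[OF Q_subspace] by metis
qed (simp add: Q_zero)

lemma monomial_submodule:
  assumes "\<And>z x. z \<in> set zs \<Longrightarrow> x \<in> N \<Longrightarrow> z * x \<in> N"
  shows "x \<in> N \<Longrightarrow> monomial zs a * x \<in> N"
  using assms
proof (induction zs a rule: monomial.induct)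
  case (1 z zs i as)
  have "z ^ n * y \<in> N" if "y \<in> N" for n y
    using that 1(3) by (induction n) (auto simp: mult.assoc)
  then show ?case
    using 1 by (simp add: mult.assoc)
qed auto

text \<open>
  Hilbert's basis theorem for submodules of a finitely generated module over a polynomial ring, proved
  as in Groebner basis theory.  Order the terms (monomial times generator) lexicographically; modulo \<open>Q\<close>
  every element outside \<open>Q\<close> has a leading term (\<open>leading\<close>), and multiplication by a monomial shifts leading
  terms (\<open>shift_below\<close>).  By Dickson's lemma the leading terms of elements of \<open>N\<close> are multiples of
  finitely many of them; subtracting multiples of the corresponding elements of \<open>N\<close> lowers the leading
  term (\<open>reduce\<close>).  The terms may be linearly dependent, so an element can have several leading terms; any
  of them serves.
\<close>

lemma submodule_finitely_generated:
  assumes zs: "set zs \<subseteq> centre_mod"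
    and N: "vs.subspace N" "Q \<subseteq> N" "\<And>z x. z \<in> set zs \<Longrightarrow> x \<in> N \<Longrightarrow> z * x \<in> N"
    and fin: "finite B" and gen: "N \<subseteq> vs.span ({monomial zs a * b | a b. length a = length zs \<and> b \<in> B} \<union> Q)"
  shows "\<exists>H. finite H \<and> H \<subseteq> N \<and> N \<subseteq> vs.span ({monomial zs a * h | a h. length a = length zs \<and> h \<in> H} \<union> Q)"
proof -
  obtain gs where gs: "set gs = B"
    using finite_list[OF fin] ..
  define t where "t = length zs"
  \<comment> \<open>the term \<open>e (k # a)\<close> is the monomial with exponents \<open>a\<close> times the \<open>k\<close>-th generator\<close>
  define T where "T = {k # a | k a. k < length gs \<and> length a = t}"
  define e where "e \<tau> = monomial zs (tl \<tau>) * gs ! hd \<tau>" for \<tau>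
  define below where "below \<tau> = vs.span (e ` {\<sigma> \<in> T. (\<sigma>, \<tau>) \<in> lex less_than} \<union> Q)" for \<tau>
  have below_sub: "vs.subspace (below \<tau>)" for \<tau>
    by (simp add: below_def)
  have below_mono: "below \<sigma> \<subseteq> below \<tau>" if "(\<sigma>, \<tau>) \<in> lex less_than" for \<sigma> \<tau>
    unfolding below_def using that by (intro vs.span_mono) (auto intro: lex_less_than_trans)
  have below_base: "e \<sigma> \<in> below \<tau>" if "\<sigma> \<in> T" "(\<sigma>, \<tau>) \<in> lex less_than" for \<sigma> \<tau>
    unfolding below_def using that by (intro vs.span_base) auto
  have Q_below: "Q \<subseteq> below \<tau>" for \<tau>
    unfolding below_def using vs.span_superset by blast
  have leading: "x \<in> Q \<or> (\<exists>\<sigma>\<in>T. (\<sigma>, \<tau>) \<in> lex less_than \<and> (\<exists>c. x - \<kappa> c * e \<sigma> \<in> below \<sigma>))"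
    if "x \<in> below \<tau>" for x \<tau>
    using that unfolding below_def[of \<tau>]
  proof (induction rule: vs.span_induct_alt)
    case base
    show ?case using Q_zero by blast
  next
    case (step c u x)
    show ?case
    proof (cases "u \<in> Q")
      case True
      have "\<kappa> c * u + x - v = \<kappa> c * u + (x - v)" for v by simp
      moreover have cu: "\<kappa> c * u \<in> Q" using True Q_left by blast
      ultimately show ?thesis
        using step.IH Q_add[OF cu] vs.subspace_add[OF below_sub] Q_below by (metis subsetD)
    next
      case False
      with step.hyps obtain \<rho> where \<rho>: "\<rho> \<in> T" "(\<rho>, \<tau>) \<in> lex less_than" "u = e \<rho>"
        by auto
      show ?thesis
        using step.IH
      proof (elim disjE bexE conjE exE)
        assume "x \<in> Q"
        then show ?thesis
          using \<rho> Q_below by (intro disjI2 bexI[of _ \<rho>] conjI exI[of _ c]) auto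
      next
        fix \<sigma> d assume \<sigma>: "\<sigma> \<in> T" "(\<sigma>, \<tau>) \<in> lex less_than" "x - \<kappa> d * e \<sigma> \<in> below \<sigma>"
        have "length \<rho> = length \<sigma>"
          using \<rho>(1) \<sigma>(1) by (auto simp: T_def)
        then consider "(\<rho>, \<sigma>) \<in> lex less_than" | "\<rho> = \<sigma>" | "(\<sigma>, \<rho>) \<in> lex less_than"
          using lex_linear by blast
        then show ?thesis
        proof cases
          case 1
          have "\<kappa> c * u + x - \<kappa> d * e \<sigma> = \<kappa> c * e \<rho> + (x - \<kappa> d * e \<sigma>)"
            using \<rho> by simp
          also have "\<dots> \<in> below \<sigma>"
            using \<sigma> below_base[OF \<rho>(1) 1] by (intro vs.subspace_add vs.subspace_scale below_sub)
          finally show ?thesis using \<sigma> by blast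
        next
          case 2
          have "\<kappa> c * u + x - \<kappa> (c + d) * e \<sigma> = x - \<kappa> d * e \<sigma>"
            using \<rho> 2 by (simp add: scal_add algebra_simps)
          then show ?thesis using \<sigma> by metis
        next
          case 3
          have "\<kappa> c * u + x - \<kappa> c * e \<rho> = \<kappa> d * e \<sigma> + (x - \<kappa> d * e \<sigma>)"
            using \<rho> by simp
          also have "\<dots> \<in> below \<rho>"
            using \<sigma> below_base[OF \<sigma>(1) 3] below_mono[OF 3]
            by (intro vs.subspace_add vs.subspace_scale below_sub) auto
          finally show ?thesis using \<rho> by blast
        qed
      qed
    qed
  qed
  define shift where "shift \<tau> b = hd \<tau> # map2 (+) (tl \<tau>) b" for \<tau> b :: "nat list"
  have shift_e: "monomial zs b * e \<tau> - e (shift \<tau> b) \<in> Q" if "\<tau> \<in> T" "length b = t" for \<tau> b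
  proof -
    have "(monomial zs b * monomial zs (tl \<tau>) - monomial zs (map2 (+) (tl \<tau>) b)) * gs ! hd \<tau> \<in> Q"
      using that by (intro Q_right monomial_add zs) (auto simp: T_def t_def)
    then show ?thesis
      by (simp add: e_def shift_def left_diff_distrib mult.assoc)
  qed
  have shift_below: "monomial zs b * x \<in> below (shift \<tau> b)" if x: "x \<in> below \<tau>" and b: "\<tau> \<in> T" "length b = t" for x \<tau> b
    using x unfolding below_def[of \<tau>]
  proof (induction rule: vs.span_induct_alt)
    case base
    show ?case using Q_zero Q_below by auto
  next
    case (step c u x)
    have "monomial zs b * u \<in> below (shift \<tau> b)"
    proof (cases "u \<in> Q")
      case True
      then show ?thesis using Q_left Q_below by blast
    next
      case False
      with step.hyps obtain \<sigma> where \<sigma>: "\<sigma> \<in> T" "(\<sigma>, \<tau>) \<in> lex less_than" "u = e \<sigma>"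
        by auto
      have "(shift \<sigma> b, shift \<tau> b) \<in> lex less_than"
        using lex_shift[of \<sigma> \<tau> "0 # b"] \<sigma> b by (auto simp: T_def shift_def)
      moreover have "shift \<sigma> b \<in> T"
        using \<sigma> b by (auto simp: T_def shift_def)
      ultimately have "(monomial zs b * e \<sigma> - e (shift \<sigma> b)) + e (shift \<sigma> b) \<in> below (shift \<tau> b)"
        using shift_e[OF \<sigma>(1) b(2)] Q_below by (intro vs.subspace_add below_sub below_base) auto
      then show ?thesis using \<sigma> by simp
    qed
    then show ?case
      using step by (simp add: distrib_left scal_assoc vs.subspace_add[OF below_sub] vs.subspace_scale[OF below_sub])
  qed
  define L where "L = {\<tau> \<in> T. \<exists>x\<in>N. x - e \<tau> \<in> below \<tau>}"
  have "\<exists>S. finite S \<and> S \<subseteq> {a. k # a \<in> L} \<and> (\<forall>x\<in>{a. k # a \<in> L}. \<exists>y\<in>S. list_all2 (\<le>) y x)" for k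
    by (rule dickson[of _ t]) (auto simp: L_def T_def)
  then obtain S where S: "\<And>k. finite (S k)" "\<And>k. S k \<subseteq> {a. k # a \<in> L}"
    "\<And>k x. k # x \<in> L \<Longrightarrow> \<exists>y\<in>S k. list_all2 (\<le>) y x"
    by (metis mem_Collect_eq)
  define h where "h \<tau> = (SOME x. x \<in> N \<and> x - e \<tau> \<in> below \<tau>)" for \<tau>
  have h: "h \<tau> \<in> N \<and> h \<tau> - e \<tau> \<in> below \<tau>" if "\<tau> \<in> L" for \<tau>
    unfolding h_def by (rule someI_ex) (use that in \<open>auto simp: L_def\<close>)
  define H where "H = h ` (\<Union>k<length gs. (#) k ` S k)"
  let ?M = "vs.span ({monomial zs a * h | a h. length a = length zs \<and> h \<in> H} \<union> Q)"
  have H: "finite H" "H \<subseteq> N"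
    using S(1,2) h by (auto simp: H_def)
  have reduce: "x \<in> ?M" if "x \<in> N" "x \<in> below \<tau>" for x \<tau>
    using that
  proof (induction \<tau> arbitrary: x rule: wf_induct_rule[OF wf_lex[OF wf_less_than]])
    case (1 \<tau>)
    from leading[OF 1(3)] show ?case
    proof (elim disjE bexE conjE exE)
      assume "x \<in> Q"
      then show ?thesis using vs.span_superset by blast
    next
      fix \<sigma> c assume \<sigma>: "\<sigma> \<in> T" "(\<sigma>, \<tau>) \<in> lex less_than" "x - \<kappa> c * e \<sigma> \<in> below \<sigma>"
      show ?thesis
      proof (cases "c = 0")
        case True
        then show ?thesis using \<sigma> 1 by auto
      next
        case False
        have "\<kappa> (inverse c) * (x - \<kappa> c * e \<sigma>) \<in> below \<sigma>"
          by (intro vs.subspace_scale below_sub \<sigma>)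
        then have "\<kappa> (inverse c) * x - e \<sigma> \<in> below \<sigma>"
          using False by (simp add: right_diff_distrib)
        then have "\<sigma> \<in> L"
          using \<sigma>(1) vs.subspace_scale[OF N(1) 1(2)] by (auto simp: L_def)
        moreover obtain k a where ka: "\<sigma> = k # a" "k < length gs" "length a = t"
          using \<sigma>(1) by (auto simp: T_def)
        ultimately obtain y where y: "y \<in> S k" "list_all2 (\<le>) y a"
          using S(3) by blast
        define b where "b = map2 (-) a y"
        have ly: "length y = t"
          using y(2) ka by (auto dest: list_all2_lengthD)
        have lb: "length b = t"
          using ly ka by (simp add: b_def)
        have shift: "shift (k # y) b = \<sigma>"
          using y(2) ly ka by (auto simp: shift_def b_def list_all2_conv_all_nth intro!: nth_equalityI)
        have kyL: "k # y \<in> L" and kyT: "k # y \<in> T"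
          using S(2) y(1) by (auto simp: L_def)
        let ?y = "monomial zs b * h (k # y)"
        have "h (k # y) \<in> H"
          using y(1) ka by (auto simp: H_def)
        then have yM: "?y \<in> ?M"
          using lb unfolding t_def by (intro vs.span_base UnI1 CollectI exI[of _ b] exI[of _ "h (k # y)"] conjI) auto
        have yN: "?y \<in> N"
          using monomial_submodule[OF N(3)] h[OF kyL] by blast
        have "monomial zs b * (h (k # y) - e (k # y)) \<in> below \<sigma>"
          using shift_below[OF _ kyT lb] h[OF kyL] shift by auto
        moreover have "monomial zs b * e (k # y) - e \<sigma> \<in> below \<sigma>"
          using shift_e[OF kyT lb] shift Q_below by auto
        ultimately have "monomial zs b * (h (k # y) - e (k # y)) + (monomial zs b * e (k # y) - e \<sigma>) \<in> below \<sigma>"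
          by (intro vs.subspace_add below_sub)
        then have y\<sigma>: "?y - e \<sigma> \<in> below \<sigma>"
          by (simp add: right_diff_distrib)
        have "(x - \<kappa> c * e \<sigma>) - \<kappa> c * (?y - e \<sigma>) \<in> below \<sigma>"
          by (rule vs.subspace_diff[OF below_sub \<sigma>(3) vs.subspace_scale[OF below_sub y\<sigma>]])
        then have "x - \<kappa> c * ?y \<in> below \<sigma>"
          by (simp add: right_diff_distrib)
        moreover have "x - \<kappa> c * ?y \<in> N"
          by (intro vs.subspace_diff vs.subspace_scale N(1) yN 1)
        ultimately have "x - \<kappa> c * ?y \<in> ?M"
          using 1(1)[OF \<sigma>(2)] by blast
        then have "(x - \<kappa> c * ?y) + \<kappa> c * ?y \<in> ?M"
          using yM by (intro vs.span_add vs.span_scale)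
        then show ?thesis by simp
      qed
    qed
  qed
  have "N \<subseteq> below (length gs # replicate t 0)"
  proof -
    have "{monomial zs a * b | a b. length a = length zs \<and> b \<in> B}
        \<subseteq> e ` {\<sigma> \<in> T. (\<sigma>, length gs # replicate t 0) \<in> lex less_than}"
    proof clarify
      fix a :: "nat list" and b assume "length a = length zs" "b \<in> B"
      moreover then obtain k where "k < length gs" "b = gs ! k"
        using gs by (auto simp: in_set_conv_nth)
      ultimately show "monomial zs a * b \<in> e ` {\<sigma> \<in> T. (\<sigma>, length gs # replicate t 0) \<in> lex less_than}"
        by (intro image_eqI[of _ _ "k # a"]) (auto simp: T_def t_def e_def)
    qed
    then show ?thesis
      unfolding below_def by (intro order_trans[OF gen] vs.span_mono Un_mono order_refl)
  qed
  then show ?thesis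
    using reduce H by (intro exI[of _ H]) blast
qed

lemma monomial_unit:
  "j < length zs \<Longrightarrow> \<exists>a. length a = length zs \<and> monomial zs a = zs ! j"
proof (induction zs arbitrary: j)
  case (Cons z zs)
  have one: "\<exists>a. length a = length zs \<and> monomial zs a = 1"
    by (rule exI[of _ "replicate (length zs) 0"], induction zs) auto
  show ?case
  proof (cases j)
    case 0
    obtain a where "length a = length zs" "monomial zs a = 1"
      using one by blast
    then show ?thesis
      using 0 by (intro exI[of _ "1 # a"]) simp
  next
    case (Suc j')
    then obtain a where "length a = length zs" "monomial zs a = zs ! j'"
      using Cons by auto
    then show ?thesis
      using Suc by (intro exI[of _ "0 # a"]) simp
  qed
qed simp

lemma monomial_span_submodule:
  assumes zs: "set zs \<subseteq> centre_mod" and z: "z \<in> set zs"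
    and x: "x \<in> vs.span ({monomial zs a * b | a b. length a = length zs \<and> b \<in> B} \<union> Q)" (is "_ \<in> ?M")
  shows "z * x \<in> ?M"
  using x
proof (induction rule: vs.span_induct_alt)
  case base
  show ?case by (simp add: vs.span_zero)
next
  case (step c u x)
  have Q_M: "y \<in> ?M" if "y \<in> Q" for y
    using that by (intro vs.span_base) auto
  obtain a' where a': "length a' = length zs" "monomial zs a' = z"
    using z monomial_unit by (metis in_set_conv_nth)
  have "z * u \<in> ?M"
  proof (cases "u \<in> Q")
    case True
    then show ?thesis using Q_left Q_M by blast
  next
    case False
    with step.hyps obtain a b where u: "u = monomial zs a * b" "length a = length zs" "b \<in> B"
      by auto
    have "(z * monomial zs a - monomial zs (map2 (+) a a')) * b \<in> ?M"
      using monomial_add[OF zs u(2) a'(1)] a'(2) by (intro Q_M Q_right) simp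
    moreover have "monomial zs (map2 (+) a a') * b \<in> ?M"
      using u a'(1) by (intro vs.span_base UnI1 CollectI exI[of _ "map2 (+) a a'"] exI[of _ b]) simp
    ultimately have "(z * monomial zs a - monomial zs (map2 (+) a a')) * b + monomial zs (map2 (+) a a') * b \<in> ?M"
      by (rule vs.span_add)
    then show ?thesis
      using u by (simp add: left_diff_distrib mult.assoc)
  qed
  then show ?case
    using step by (simp add: distrib_left scal_assoc vs.span_add vs.span_scale)
qed

end

context almost_commuting_letters
begin

text \<open>
  The words of weight at most \<open>\<Sum>\<^sub>i m\<^sub>i d\<^sub>i\<close> generate the algebra as a module over the central elements,
  by \<open>filt_stabilizes\<close> for the module that they span.
\<close>

lemma finite_over_central_powers:
  assumes pow: "\<And>i. i \<in> I \<Longrightarrow> m i > 0 \<and> w i ^ m i - z i \<in> filt (m i * d i - 1)"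
    and central: "\<And>i. i \<in> I \<Longrightarrow> z i \<in> centre_mod"
    and gen: "\<And>x. \<exists>n. x \<in> filt n"
  obtains zs B where "set zs \<subseteq> centre_mod" "finite B"
    "vs.span ({monomial zs a * b | a b. length a = length zs \<and> b \<in> B} \<union> Q) = UNIV"
proof -
  obtain il where il: "set il = I"
    using finite_list[OF finite_letters] ..
  define zs where "zs = map z il"
  have zs: "set zs = z ` I"
    by (simp add: zs_def il)
  define n0 where "n0 = (\<Sum>i\<in>I. m i * d i)"
  define B where "B = word ` {l. set l \<subseteq> I \<and> weight l \<le> n0}"
  let ?M = "vs.span ({monomial zs a * b | a b. length a = length zs \<and> b \<in> B} \<union> Q)"
  have cz: "set zs \<subseteq> centre_mod"
    using zs central by auto
  have one: "monomial zs (replicate (length zs) 0) = 1" for zs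
    by (induction zs) auto
  have "b \<in> ?M" if "b \<in> B" for b
    using that one[of zs] by (intro vs.span_base UnI1 CollectI exI[of _ "replicate (length zs) 0"] exI[of _ b]) simp
  moreover have "Q \<subseteq> ?M"
    using vs.span_superset by blast
  ultimately have base: "filt n0 \<subseteq> ?M"
    by (intro filt_minimal) (auto simp: B_def)
  have "filt n \<subseteq> ?M" for n
  proof (rule filt_stabilizes[OF pow _ base[unfolded n0_def]])
    show "z i * x \<in> ?M" if "i \<in> I" "x \<in> ?M" for i x
      using that zs by (intro monomial_span_submodule[OF cz]) auto
  qed auto
  then have "?M = UNIV"
    using gen by blast
  moreover have "finite B"
    using finite_words by (simp add: B_def)
  ultimately show ?thesis
    using that cz by blast
qed

end

text \<open>
  A ring \<open>R\<close> with explicit carrier that is the quotient of the ring type by \<open>Q\<close>; finiteness statements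
  modulo \<open>Q\<close> become statements about \<open>R\<close>.
\<close>

locale quotient_presentation = algebra_quotient \<kappa> Q + R: ring R
  for \<kappa> :: "'k::field \<Rightarrow> 'a::ring_1" and Q and R :: "('u, 'n) ring_scheme" +
  fixes \<pi> :: "'a \<Rightarrow> 'u"
  assumes \<pi>_surj: "range \<pi> = carrier R"
    and \<pi>_add: "\<pi> (x + y) = \<pi> x \<oplus>\<^bsub>R\<^esub> \<pi> y"
    and \<pi>_mult: "\<pi> (x * y) = \<pi> x \<otimes>\<^bsub>R\<^esub> \<pi> y"
    and \<pi>_one: "\<pi> 1 = \<one>\<^bsub>R\<^esub>"
    and \<pi>_kernel: "x \<in> Q \<longleftrightarrow> \<pi> x = \<zero>\<^bsub>R\<^esub>"
begin

lemma \<pi>_closed [simp]: "\<pi> x \<in> carrier R"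
  using \<pi>_surj by blast

lemma \<pi>_zero [simp]: "\<pi> 0 = \<zero>\<^bsub>R\<^esub>"
  using \<pi>_kernel Q_zero by blast

lemma \<pi>_minus: "\<pi> (- x) = \<ominus>\<^bsub>R\<^esub> \<pi> x"
  using \<pi>_add[of "-x" x] by (simp add: R.minus_equality)

lemma \<pi>_eq_iff: "\<pi> x = \<pi> y \<longleftrightarrow> x - y \<in> Q"
proof -
  have "\<pi> (x - y) = \<pi> x \<ominus>\<^bsub>R\<^esub> \<pi> y"
    using \<pi>_add[of x "-y"] by (simp add: \<pi>_minus a_minus_def)
  then show ?thesis
    unfolding \<pi>_kernel by simp
qed

lemma ring_centre_eq: "ring_centre R = \<pi> ` centre_mod"
proof -
  have "ring_centre R = {\<pi> z | z. \<forall>x. \<pi> z \<otimes>\<^bsub>R\<^esub> \<pi> x = \<pi> x \<otimes>\<^bsub>R\<^esub> \<pi> z}"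
    unfolding ring_centre_def \<pi>_surj[symmetric] by blast
  then show ?thesis
    by (auto simp: centre_mod_def ad_def \<pi>_eq_iff[symmetric] \<pi>_mult)
qed

text \<open>
  This is applied with the centre of \<open>R\<close> as \<open>K\<close>, a subring and in general not a subfield.  Elements of
  the span are added by adding their coefficients.
\<close>

lemma Span_module:
  assumes K: "K \<subseteq> carrier R" "\<And>a b. a \<in> K \<Longrightarrow> b \<in> K \<Longrightarrow> a \<oplus>\<^bsub>R\<^esub> b \<in> K" "\<zero>\<^bsub>R\<^esub> \<in> K"
    and us: "set us \<subseteq> carrier R"
  shows "R.Span K us \<subseteq> carrier R" "\<zero>\<^bsub>R\<^esub> \<in> R.Span K us"
    "x \<in> R.Span K us \<Longrightarrow> y \<in> R.Span K us \<Longrightarrow> x \<oplus>\<^bsub>R\<^esub> y \<in> R.Span K us"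
    "k \<in> K \<Longrightarrow> u \<in> set us \<Longrightarrow> k \<otimes>\<^bsub>R\<^esub> u \<in> R.Span K us"
proof -
  have *: "R.Span K us \<subseteq> carrier R \<and> \<zero>\<^bsub>R\<^esub> \<in> R.Span K us \<and>
    (\<forall>x\<in>R.Span K us. \<forall>y\<in>R.Span K us. x \<oplus>\<^bsub>R\<^esub> y \<in> R.Span K us) \<and>
    (\<forall>k\<in>K. \<forall>u\<in>set us. k \<otimes>\<^bsub>R\<^esub> u \<in> R.Span K us)"
    using us
  proof (induction us)
    case Nil
    then show ?case by simp
  next
    case (Cons v us)
    have S: "R.Span K (v # us) = {k \<otimes>\<^bsub>R\<^esub> v \<oplus>\<^bsub>R\<^esub> x | k x. k \<in> K \<and> x \<in> R.Span K us}"
    proof -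
      have "R.Span K (v # us) = R.line_extension K v (R.Span K us)"
        by simp
      then show ?thesis
        by (simp only: set_eq_iff R.line_extension_mem_iff) blast
    qed
    have v: "v \<in> carrier R" using Cons.prems by simp
    note IH = Cons.IH[OF order_trans[OF set_subset_Cons Cons.prems]]
    show ?case
    proof (intro conjI ballI)
      show "R.Span K (v # us) \<subseteq> carrier R"
        unfolding S using K(1) v IH by auto
      show "\<zero>\<^bsub>R\<^esub> \<in> R.Span K (v # us)"
        unfolding S using K(3) v IH by (intro CollectI exI[of _ "\<zero>\<^bsub>R\<^esub>"]) simp
      fix x y assume "x \<in> R.Span K (v # us)" "y \<in> R.Span K (v # us)"
      then obtain k l x' y' where xy: "x = k \<otimes>\<^bsub>R\<^esub> v \<oplus>\<^bsub>R\<^esub> x'" "y = l \<otimes>\<^bsub>R\<^esub> v \<oplus>\<^bsub>R\<^esub> y'"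
        "k \<in> K" "l \<in> K" "x' \<in> R.Span K us" "y' \<in> R.Span K us"
        unfolding S by blast
      moreover have "k \<in> carrier R" "l \<in> carrier R" "x' \<in> carrier R" "y' \<in> carrier R"
        using xy K(1) IH by auto
      ultimately have "x \<oplus>\<^bsub>R\<^esub> y = (k \<oplus>\<^bsub>R\<^esub> l) \<otimes>\<^bsub>R\<^esub> v \<oplus>\<^bsub>R\<^esub> (x' \<oplus>\<^bsub>R\<^esub> y')"
        using v by (simp add: R.l_distr R.a_ac)
      then show "x \<oplus>\<^bsub>R\<^esub> y \<in> R.Span K (v # us)"
        unfolding S using K(2) xy IH by blast
    next
      fix k u assume ku: "k \<in> K" "u \<in> set (v # us)"
      then have kc: "k \<in> carrier R" "u \<in> carrier R" using K(1) Cons.prems by auto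
      show "k \<otimes>\<^bsub>R\<^esub> u \<in> R.Span K (v # us)"
      proof (cases "u = v")
        case True
        then show ?thesis
          unfolding S using ku kc IH by (intro CollectI exI[of _ k] exI[of _ "\<zero>\<^bsub>R\<^esub>"]) simp
      next
        case False
        then have "k \<otimes>\<^bsub>R\<^esub> u \<in> R.Span K us"
          using ku IH by auto
        then show ?thesis
          unfolding S using kc v K(3) by (intro CollectI exI[of _ "\<zero>\<^bsub>R\<^esub>"] exI[of _ "k \<otimes>\<^bsub>R\<^esub> u"]) simp
      qed
    qed
  qed
  from * show "R.Span K us \<subseteq> carrier R" "\<zero>\<^bsub>R\<^esub> \<in> R.Span K us" by blast+
  from * show "x \<in> R.Span K us \<Longrightarrow> y \<in> R.Span K us \<Longrightarrow> x \<oplus>\<^bsub>R\<^esub> y \<in> R.Span K us"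
    "k \<in> K \<Longrightarrow> u \<in> set us \<Longrightarrow> k \<otimes>\<^bsub>R\<^esub> u \<in> R.Span K us" by blast+
qed

text \<open>
  The module statement is immediate since the monomials in \<open>zs\<close> are central.  The centre is a submodule
  of a finite module over the polynomial algebra in \<open>zs\<close>, so it is generated by \<open>zs\<close> together with finitely
  many module generators, in the manner of Artin and Tate.
\<close>

lemma centre_finiteness:
  assumes zs: "set zs \<subseteq> centre_mod" and B: "finite B"
    and gen: "vs.span ({monomial zs a * b | a b. length a = length zs \<and> b \<in> B} \<union> Q) = UNIV"
  shows "fin_gen_algebra R (\<lambda>c. \<pi> (\<kappa> c)) (ring_centre R)"
    and "fin_gen_module_over R (ring_centre R)"
proof -
  have mon_centre: "monomial zs a \<in> centre_mod" for a
    using zs centre_mod_scal[of 1]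
    by (induction zs a rule: monomial.induct) (auto intro!: centre_mod_mult centre_mod_power)
  have Z_car: "ring_centre R \<subseteq> carrier R"
    by (auto simp: ring_centre_def)
  obtain bs where bs: "set bs = B"
    using finite_list[OF B] ..
  have Z_add: "a \<oplus>\<^bsub>R\<^esub> b \<in> ring_centre R" if "a \<in> ring_centre R" "b \<in> ring_centre R" for a b
    using that centre_mod_add unfolding ring_centre_eq by (auto simp: \<pi>_add[symmetric])
  have Z_zero: "\<zero>\<^bsub>R\<^esub> \<in> ring_centre R"
    using centre_mod_scal[of 0] unfolding ring_centre_eq by (intro image_eqI[of _ _ 0]) auto
  have bs_car: "set (map \<pi> bs) \<subseteq> carrier R"
    by auto
  note Span = Span_module[OF Z_car Z_add Z_zero bs_car]
  have Sp: "\<pi> x \<in> R.Span (ring_centre R) (map \<pi> bs)" for x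
  proof -
    have "x \<in> vs.span ({monomial zs a * b | a b. length a = length zs \<and> b \<in> B} \<union> Q)"
      using gen by simp
    then show ?thesis
    proof (induction rule: vs.span_induct_alt)
      case base
      show ?case using Span(2) by (simp only: \<pi>_zero)
    next
      case (step c u x)
      have "\<pi> (\<kappa> c * u) \<in> R.Span (ring_centre R) (map \<pi> bs)"
      proof (cases "u \<in> Q")
        case True
        then have "\<pi> (\<kappa> c * u) = \<zero>\<^bsub>R\<^esub>"
          using Q_left \<pi>_kernel by blast
        then show ?thesis using Span(2) by (simp only:)
      next
        case False
        with step.hyps obtain a b where u: "u = monomial zs a * b" "b \<in> B"
          by auto
        have "\<pi> (\<kappa> c * u) = \<pi> (\<kappa> c * monomial zs a) \<otimes>\<^bsub>R\<^esub> \<pi> b"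
          by (simp add: u \<pi>_mult[symmetric] mult.assoc)
        moreover have "\<pi> (\<kappa> c * monomial zs a) \<in> ring_centre R"
          unfolding ring_centre_eq by (intro imageI centre_mod_mult centre_mod_scal mon_centre)
        ultimately show ?thesis
          using Span(4)[of _ "\<pi> b"] u(2) bs by (simp del: R.Span.simps)
      qed
      then show ?case
        using Span(3) step.IH by (simp add: \<pi>_add del: R.Span.simps)
    qed
  qed
  have "carrier R \<subseteq> R.Span (ring_centre R) (map \<pi> bs)"
    unfolding \<pi>_surj[symmetric] by (rule image_subsetI) (rule Sp)
  then have "R.Span (ring_centre R) (map \<pi> bs) = carrier R"
    using Span(1) by (rule subset_antisym[rotated])
  then show "fin_gen_module_over R (ring_centre R)"
    unfolding fin_gen_module_over_def using bs_car by (intro exI[of _ "map \<pi> bs"] conjI)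
  obtain H where H: "finite H" "H \<subseteq> centre_mod"
    "centre_mod \<subseteq> vs.span ({monomial zs a * h | a h. length a = length zs \<and> h \<in> H} \<union> Q)"
  proof -
    have "\<exists>H. finite H \<and> H \<subseteq> centre_mod \<and>
      centre_mod \<subseteq> vs.span ({monomial zs a * h | a h. length a = length zs \<and> h \<in> H} \<union> Q)"
      by (rule submodule_finitely_generated[OF zs centre_mod_subspace Q_centre_mod _ B])
        (use zs gen in \<open>auto intro: centre_mod_mult\<close>)
    then show ?thesis using that by blast
  qed
  let ?S = "\<pi> ` (set zs \<union> H)"
  let ?E = "generate_ring R (range (\<lambda>c. \<pi> (\<kappa> c)) \<union> ?S)"
  have "?E \<subseteq> ring_centre R"
  proof
    fix x assume "x \<in> ?E"
    then show "x \<in> ring_centre R"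
    proof induction
      case one
      then show ?case
        using centre_mod_scal[of 1] unfolding ring_centre_eq \<pi>_one[symmetric] by simp
    next
      case (incl h)
      then show ?case
        using centre_mod_scal zs H(2) unfolding ring_centre_eq by auto
    next
      case (a_inv h)
      then show ?case
        using vs.subspace_neg[OF centre_mod_subspace] unfolding ring_centre_eq
        by (auto simp: \<pi>_minus[symmetric])
    next
      case (eng_add h1 h2)
      then show ?case by (rule_tac Z_add)
    next
      case (eng_mult h1 h2)
      then show ?case
        using centre_mod_mult unfolding ring_centre_eq by (auto simp: \<pi>_mult[symmetric])
    qed
  qed
  moreover have "\<pi> x \<in> ?E" if "x \<in> centre_mod" for x
  proof -
    have gen_pow: "\<pi> (z ^ n) \<in> ?E" if "z \<in> set zs" for z n
      using that by (induction n) (auto simp: \<pi>_one \<pi>_mult intro: generate_ring.intros)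
    have gen_mon: "\<pi> (monomial zs' a) \<in> ?E" if "set zs' \<subseteq> set zs" for zs' a
      using that
      by (induction zs' a rule: monomial.induct)
        (auto simp: \<pi>_one \<pi>_mult intro!: generate_ring.one generate_ring.eng_mult gen_pow)
    have "x \<in> vs.span ({monomial zs a * h | a h. length a = length zs \<and> h \<in> H} \<union> Q)"
      using H(3) that by blast
    then show ?thesis
    proof (induction rule: vs.span_induct_alt)
      case base
      show ?case by (simp add: R.zero_in_generate)
    next
      case (step c u x)
      have "\<pi> u \<in> ?E"
      proof (cases "u \<in> Q")
        case True
        then show ?thesis
          using R.zero_in_generate \<pi>_kernel by auto
      next
        case False
        with step.hyps obtain a h where "u = monomial zs a * h" "h \<in> H"
          by auto
        then show ?thesis
          using gen_mon[of zs a] by (auto simp: \<pi>_mult intro!: generate_ring.eng_mult intro: generate_ring.incl)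
      qed
      then show ?case
        using step.IH unfolding \<pi>_add \<pi>_mult
        by (auto intro!: generate_ring.eng_add generate_ring.eng_mult intro: generate_ring.incl)
    qed
  qed
  ultimately have "ring_centre R = ?E"
    unfolding ring_centre_eq by blast
  moreover have "?S \<subseteq> ring_centre R"
    using zs H(2) unfolding ring_centre_eq by blast
  ultimately show "fin_gen_algebra R (\<lambda>c. \<pi> (\<kappa> c)) (ring_centre R)"
    unfolding fin_gen_algebra_def using H(1) by (intro exI[of _ ?S]) auto
qed

end

section \<open>Functions on an affine group and powers of the augmentation ideal\<close>

text \<open>
  The pointwise rules for operations on functions are used on request only, since as rewrite rules they
  also apply to the bodies of abstractions and break up equations between functions.
\<close>

declare plus_fun_apply [simp del] times_fun_apply [simp del] zero_fun_apply [simp del] one_fun_apply [simp del]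
  minus_apply [simp del] uminus_apply [simp del]

text \<open>Constant functions are the scalars that make every function type an algebra.\<close>

definition cf :: "'k \<Rightarrow> 'x \<Rightarrow> 'k" where "cf c = (\<lambda>_. c)"

lemma cf_apply: "cf c x = c"
  by (simp add: cf_def)

lemmas fun_apply = plus_fun_apply times_fun_apply zero_fun_apply one_fun_apply
  minus_apply uminus_apply cf_apply

global_interpretation fa: central_scalars "cf :: 'k::field \<Rightarrow> 'x \<Rightarrow> 'k"
  by unfold_locales (auto simp: fun_eq_iff fun_apply algebra_simps)

lemma sum_fun_apply: "(\<Sum>i\<in>S. f i) x = (\<Sum>i\<in>S. f i x)"
  by (induction S rule: infinite_finite_induct) (auto simp: fun_apply)

lemma prod_fun_apply: "(\<Prod>i\<in>S. f i) x = (\<Prod>i\<in>S. f i x)"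
  by (induction S rule: infinite_finite_induct) (auto simp: fun_apply)

lemma power_fun_apply: "(f ^ n) x = f x ^ n"
  by (induction n) (auto simp: fun_apply)

text \<open>Extend a basis of \<open>S\<close> by \<open>x\<close> and take the coordinate of \<open>x\<close>.\<close>

lemma separating_functional:
  fixes S :: "('x \<Rightarrow> 'k::field) set"
  assumes S: "fa.vs.subspace S" and x: "x \<notin> S"
  shows "\<exists>\<phi>. (\<forall>f g. \<phi> (f + g) = \<phi> f + \<phi> g) \<and> (\<forall>c f. \<phi> (cf c * f) = c * \<phi> f) \<and>
    (\<forall>f\<in>S. \<phi> f = 0) \<and> \<phi> x = (1::'k)"
proof -
  interpret vp: vector_space_pair "\<lambda>(c::'k) (f::'x \<Rightarrow> 'k). cf c * f" "(*) :: 'k \<Rightarrow> 'k \<Rightarrow> 'k"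
    by unfold_locales (auto simp: algebra_simps)
  obtain B where B: "B \<subseteq> S" "fa.vs.independent B" "S \<subseteq> fa.vs.span B"
    using fa.vs.maximal_independent_subset[of S] by blast
  have "fa.vs.span B \<subseteq> S"
    using fa.vs.span_minimal[OF B(1) S] .
  then have xB: "x \<notin> fa.vs.span B"
    using x by blast
  then have ind: "fa.vs.independent (insert x B)"
    using B(2) by (rule fa.vs.independent_insertI)
  obtain \<phi> where \<phi>: "Vector_Spaces.linear (\<lambda>(c::'k) (f::'x \<Rightarrow> 'k). cf c * f) (*) \<phi>"
    "\<forall>y\<in>insert x B. \<phi> y = (if y = x then 1 else 0)"
    using vp.linear_independent_extend[OF ind, of "\<lambda>y. if y = x then 1 else 0"] by auto
  interpret \<phi>: Vector_Spaces.linear "\<lambda>(c::'k) (f::'x \<Rightarrow> 'k). cf c * f" "(*) :: 'k \<Rightarrow> 'k \<Rightarrow> 'k" \<phi>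
    by (rule \<phi>(1))
  have "x \<notin> B"
    using xB fa.vs.span_base by blast
  then have "\<phi> y = 0" if "y \<in> B" for y
    using \<phi>(2) that by auto
  then have "\<phi> y = 0" if "y \<in> S" for y
    using \<phi>.eq_0_on_span[of B y] B(3) that by blast
  then show ?thesis
    using \<phi>(2) \<phi>.add \<phi>.scale by (intro exI[of _ \<phi>]) auto
qed

text \<open>
  In an infinite independent family some member would agree on \<open>X\<close> with a combination of earlier ones.
\<close>

lemma finite_spanning_subset:
  fixes V :: "('x \<Rightarrow> 'k::field) set"
  assumes V: "fa.vs.subspace V" and X: "finite X"
    and det: "\<And>f. f \<in> V \<Longrightarrow> \<forall>x\<in>X. f x = 0 \<Longrightarrow> f = 0"
  shows "\<exists>B. finite B \<and> B \<subseteq> V \<and> V \<subseteq> fa.vs.span B"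
proof -
  obtain B where B: "B \<subseteq> V" "fa.vs.independent B" "V \<subseteq> fa.vs.span B"
    using fa.vs.maximal_independent_subset[of V] by blast
  have "finite B"
  proof (rule ccontr)
    assume "infinite B"
    then obtain b :: "nat \<Rightarrow> 'x \<Rightarrow> 'k" where b: "inj b" "range b \<subseteq> B"
      using infinite_countable_subset by blast
    obtain N a where Na: "\<forall>x\<in>X. b N x = (\<Sum>i<N. a i * b i x)"
      using eventually_recurrent[OF X] by blast
    let ?s = "\<Sum>i<N. cf (a i) * b i"
    have "b N - ?s \<in> V"
      using b(2) B(1) by (intro fa.vs.subspace_diff fa.vs.subspace_sum fa.vs.subspace_scale V) auto
    then have "b N - ?s = 0"
      using Na by (intro det) (auto simp: sum_fun_apply fun_apply)
    then have "b N = ?s"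
      by simp
    moreover have "?s \<in> fa.vs.span (B - {b N})"
      using b by (intro fa.vs.span_sum fa.vs.span_scale fa.vs.span_base) (auto dest: injD)
    ultimately have "b N \<in> fa.vs.span (B - {b N})"
      by metis
    then show False
      using B(2) b(2) unfolding fa.vs.dependent_def by blast
  qed
  then show ?thesis using B by blast
qed

context affine_algebraic_group
begin

abbreviation (input) spn :: "('x \<Rightarrow> 'k) set \<Rightarrow> ('x \<Rightarrow> 'k) set" where "spn \<equiv> fa.vs.span"

text \<open>
  The unit of \<open>A\<close>, which is \<open>0\<close> and not \<open>1\<close> outside the group, as for all elements of \<open>A\<close>.
\<close>

definition e :: "'g \<Rightarrow> 'k" where "e = const_fun (carrier G) 1"
definition I :: "('g \<Rightarrow> 'k) set" where "I = aug_ideal G A"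
definition P :: "nat \<Rightarrow> ('g \<Rightarrow> 'k) set"
  where "P n = ideal_power (coord_ring (carrier G) A) I n"

lemma e_apply: "e x = (if x \<in> carrier G then 1 else 0)"
  by (simp add: e_def const_fun_def ext0_def)

lemma e_A: "e \<in> A"
  unfolding e_def by (rule const_closed)

lemma e_mult [simp]: "f \<in> A \<Longrightarrow> e * f = f"
  using zero_outside by (auto simp: fun_eq_iff fun_apply e_apply)

lemma e_idem [simp]: "e * e = e"
  by (simp add: e_A)

lemma A_add: "f \<in> A \<Longrightarrow> g \<in> A \<Longrightarrow> f + g \<in> A"
  using add_closed by (simp add: plus_fun_def)

lemma A_mult: "f \<in> A \<Longrightarrow> g \<in> A \<Longrightarrow> f * g \<in> A"
  using mult_closed by (simp add: times_fun_def)

lemma A_sub: "fa.vs.subspace A"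
proof (rule fa.vs.subspaceI)
  show "0 \<in> A"
    unfolding zero_fun_def by (rule zero_in)
  show "cf c * f \<in> A" if "f \<in> A" for c f
    using scale_in[OF that, of c] by (simp add: times_fun_def cf_def)
qed (rule A_add)

lemma I_iff: "f \<in> I \<longleftrightarrow> f \<in> A \<and> f \<one> = 0"
  by (simp add: I_def aug_ideal_def)

lemma I_sub: "fa.vs.subspace I"
  using A_sub by (auto simp: fa.vs.subspace_def I_iff fun_apply)

lemma P_0 [simp]: "P 0 = A"
  by (simp add: P_def coord_ring_def)

lemma P_Suc_base: "f \<in> I \<Longrightarrow> g \<in> P n \<Longrightarrow> f * g \<in> P (Suc n)"
  using ideal_prod.prod[of f I g "P n" "coord_ring (carrier G) A"]
  by (simp add: P_def coord_ring_def times_fun_def)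

lemma P_Suc_induct:
  assumes "h \<in> P (Suc n)" "\<And>f g. f \<in> I \<Longrightarrow> g \<in> P n \<Longrightarrow> f * g \<in> M"
    "\<And>f g. f \<in> M \<Longrightarrow> g \<in> M \<Longrightarrow> f + g \<in> M"
  shows "h \<in> M"
proof -
  have "h \<in> ideal_prod (coord_ring (carrier G) A) I (P n)"
    using assms(1) by (simp add: P_def)
  then show ?thesis
  proof (induction rule: ideal_prod.induct)
    case (prod i j)
    then show ?case using assms(2) by (simp add: coord_ring_def times_fun_def)
  next
    case (sum s1 s2)
    then show ?case using assms(3) by (simp add: coord_ring_def plus_fun_def)
  qed
qed

lemma P_Suc_add: "f \<in> P (Suc n) \<Longrightarrow> g \<in> P (Suc n) \<Longrightarrow> f + g \<in> P (Suc n)"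
  using ideal_prod.sum[of f "coord_ring (carrier G) A" I "P n" g]
  by (simp add: P_def coord_ring_def plus_fun_def)

lemma P_sub: "fa.vs.subspace (P n)"
proof (induction n)
  case 0
  show ?case using A_sub by simp
next
  case (Suc n)
  show ?case
  proof (rule fa.vs.subspaceI)
    show "0 \<in> P (Suc n)"
      using P_Suc_base[of 0 0 n] fa.vs.subspace_0[OF I_sub] fa.vs.subspace_0[OF Suc] by simp
  next
    fix c f assume "f \<in> P (Suc n)"
    then show "cf c * f \<in> P (Suc n)"
    proof (rule P_Suc_induct[of _ _ "{f. cf c * f \<in> P (Suc n)}", simplified], goal_cases)
      case (1 f g)
      then show ?case
        using P_Suc_base[of "cf c * f" g n] fa.vs.subspace_scale[OF I_sub, of f c]
        by (simp add: mult.assoc)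
    next
      case (2 f g)
      then show ?case by (simp add: distrib_left P_Suc_add)
    qed
  qed (rule P_Suc_add)
qed

lemma P_Suc_minimal:
  "fa.vs.subspace M \<Longrightarrow> (\<And>f g. f \<in> I \<Longrightarrow> g \<in> P n \<Longrightarrow> f * g \<in> M) \<Longrightarrow> P (Suc n) \<subseteq> M"
  using P_Suc_induct[of _ n M] fa.vs.subspace_add by (intro subsetI) blast

lemma P_A: "P n \<subseteq> A"
proof (induction n)
  case (Suc n)
  show ?case
    using Suc by (intro P_Suc_minimal A_sub A_mult) (auto simp: I_iff)
qed simp

lemma P_mult: "f \<in> P m \<Longrightarrow> g \<in> P n \<Longrightarrow> f * g \<in> P (m + n)"
proof (induction m arbitrary: f)
  case 0
  then show ?case
  proof (induction n arbitrary: g)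
    case 0
    then show ?case by (simp add: A_mult)
  next
    case (Suc n)
    have "P (Suc n) \<subseteq> {g. f * g \<in> P (Suc n)}"
    proof (rule P_Suc_minimal)
      show "fa.vs.subspace {g. f * g \<in> P (Suc n)}"
        using P_sub[of "Suc n"] by (auto simp: fa.vs.subspace_def distrib_left fa.scal_assoc)
      fix h g assume "h \<in> I" "g \<in> P n"
      then show "h * g \<in> {g. f * g \<in> P (Suc n)}"
        using Suc.IH[of g] Suc.prems P_Suc_base[of h "f * g" n] by (simp add: mult.left_commute)
    qed
    then show ?case using Suc.prems by auto
  qed
next
  case (Suc m)
  have "P (Suc m) \<subseteq> {f. f * g \<in> P (Suc m + n)}"
  proof (rule P_Suc_minimal)
    show "fa.vs.subspace {f. f * g \<in> P (Suc m + n)}"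
      using P_sub[of "Suc m + n"] by (auto simp: fa.vs.subspace_def distrib_right mult.assoc)
    fix h f assume "h \<in> I" "f \<in> P m"
    then show "h * f \<in> {f. f * g \<in> P (Suc m + n)}"
      using Suc.IH[of f] Suc.prems P_Suc_base[of h "f * g" "m + n"] by (simp add: mult.assoc)
  qed
  then show ?case using Suc.prems by auto
qed

lemma P_Suc_subset: "P (Suc n) \<subseteq> P n"
  using P_mult[of _ 0 _ n] P_A by (intro P_Suc_minimal P_sub) (auto simp: I_iff)

lemma P_mono: "m \<le> n \<Longrightarrow> P n \<subseteq> P m"
  by (rule lift_Suc_antimono_le) (use P_Suc_subset in auto)

lemma P_1: "P 1 = I"
proof
  show "P 1 \<subseteq> I"
    unfolding One_nat_def using A_mult by (intro P_Suc_minimal I_sub) (auto simp: I_iff fun_apply)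
  show "I \<subseteq> P 1"
  proof
    fix f assume f: "f \<in> I"
    then have "f * e = f"
      using e_mult[of f] by (simp add: I_iff mult.commute)
    then show "f \<in> P 1"
      using P_Suc_base[OF f, of e 0] e_A by simp
  qed
qed

lemma P_I: "n > 0 \<Longrightarrow> P n \<subseteq> I"
  using P_mono[of 1 n] P_1 by simp

lemma P_power: "f \<in> P m \<Longrightarrow> n > 0 \<Longrightarrow> f ^ n \<in> P (n * m)"
proof (induction n)
  case (Suc n)
  then show ?case
    by (cases "n = 0") (auto intro: P_mult)
qed simp

lemma A_power: "f \<in> A \<Longrightarrow> n > 0 \<Longrightarrow> f ^ n \<in> A"
  using P_power[of f 0 n] by simp

lemma I_power: "f \<in> I \<Longrightarrow> n > 0 \<Longrightarrow> f ^ n \<in> P n"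
  using P_power[of f 1 n] P_1 by simp

lemma e_power [simp]: "n > 0 \<Longrightarrow> e ^ n = e"
  by (auto simp: fun_eq_iff fun_apply power_fun_apply e_apply)

lemma minus_value_I: "f \<in> A \<Longrightarrow> f - cf (f \<one>) * e \<in> I"
  unfolding I_iff by (intro conjI fa.vs.subspace_diff fa.vs.subspace_scale A_sub e_A) (auto simp: e_apply fun_apply)

text \<open>
  Generators of the coordinate ring, corrected to vanish at the unit element, span the
  cotangent space.  The elements satisfying the claim after this correction form a
  subring, because the correction \<open>f - f(1)\<close> is a derivation modulo \<open>P 2\<close>.
\<close>

lemma I_generators: "\<exists>X. finite X \<and> X \<subseteq> I \<and> I \<subseteq> spn (X \<union> P 2)"
proof -
  obtain S where S: "finite S" "S \<subseteq> A"
    "A = generate_ring (coord_ring (carrier G) A) (range (const_fun (carrier G)) \<union> S)"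
    using finitely_generated unfolding fin_gen_algebra_def by blast
  define X where "X = (\<lambda>f. f - cf (f \<one>) * e) ` S"
  let ?M = "spn (X \<union> P 2)"
  have XI: "X \<subseteq> I"
    using S(2) minus_value_I by (auto simp: X_def)
  have MI: "?M \<subseteq> I"
    using XI P_I[of 2] by (intro fa.vs.span_minimal I_sub) auto
  have P2: "P 2 \<subseteq> ?M"
    using fa.vs.span_superset by blast
  have AI: "f \<in> A" if "f - cf c * e \<in> ?M" for f c
    using fa.vs.subspace_add[OF A_sub, of "f - cf c * e" "cf c * e"]
      fa.vs.subspace_scale[OF A_sub e_A] that MI by (auto simp: I_iff)
  have neg: "\<ominus>\<^bsub>coord_ring (carrier G) A\<^esub> f = - f" if "f \<in> A" for f
  proof -
    have "- f \<in> A"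
      using fa.vs.subspace_neg[OF A_sub that] .
    then have "(THE y. y \<in> A \<and> (\<lambda>x. f x + y x) = (\<lambda>x. 0) \<and> (\<lambda>x. y x + f x) = (\<lambda>x. 0)) = - f"
    proof (intro the_equality)
      fix y assume "y \<in> A \<and> (\<lambda>x. f x + y x) = (\<lambda>x. 0) \<and> (\<lambda>x. y x + f x) = (\<lambda>x. 0)"
      then have "f x + y x = 0" for x
        by (auto dest: fun_cong)
      then show "y = - f"
        by (intro ext) (metis minus_unique uminus_apply)
    qed (simp add: fun_apply)
    then show ?thesis
      by (simp add: a_inv_def m_inv_def coord_ring_def)
  qed
  have "f - cf (f \<one>) * e \<in> ?M" if "f \<in> generate_ring (coord_ring (carrier G) A) (range (const_fun (carrier G)) \<union> S)" for f
    using that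
  proof (induction rule: generate_ring.induct)
    case one
    have "const_fun (carrier G) 1 - cf (const_fun (carrier G) 1 \<one>) * e = (0 :: 'g \<Rightarrow> 'k)"
      by (auto simp: fun_eq_iff fun_apply e_def const_fun_def ext0_def)
    then show ?case
      by (simp add: coord_ring_def fa.vs.span_zero)
  next
    case (incl h)
    show ?case
    proof (cases "h \<in> S")
      case True
      then show ?thesis
        by (intro fa.vs.span_base) (auto simp: X_def)
    next
      case False
      then obtain c where h: "h = const_fun (carrier G) c"
        using incl by blast
      have "h - cf (h \<one>) * e = 0"
        by (auto simp: fun_eq_iff fun_apply h e_def const_fun_def ext0_def)
      then show ?thesis
        by (simp add: fa.vs.span_zero)
    qed
  next
    case (a_inv h)
    have eq: "(- h) - cf ((- h) \<one>) * e = - (h - cf (h \<one>) * e)"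
      by (auto simp: fun_eq_iff fun_apply)
    show ?case
      unfolding neg[OF AI[OF a_inv.IH]] eq by (rule fa.vs.span_neg[OF a_inv.IH])
  next
    case (eng_add h1 h2)
    have "(h1 + h2) - cf ((h1 + h2) \<one>) * e = (h1 - cf (h1 \<one>) * e) + (h2 - cf (h2 \<one>) * e)"
      by (auto simp: fun_eq_iff fun_apply algebra_simps)
    then show ?case
      using fa.vs.span_add[OF eng_add.IH] by (simp add: coord_ring_def plus_fun_def)
  next
    case (eng_mult h1 h2)
    let ?d1 = "h1 - cf (h1 \<one>) * e" and ?d2 = "h2 - cf (h2 \<one>) * e"
    have hA: "h1 \<in> A" "h2 \<in> A"
      using eng_mult.IH AI by blast+
    have "(h1 * h2) - cf ((h1 * h2) \<one>) * e
        = cf (h1 \<one>) * ?d2 + cf (h2 \<one>) * ?d1 + ?d1 * ?d2"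
      using zero_outside[OF hA(1)] zero_outside[OF hA(2)] by (auto simp: fun_eq_iff fun_apply e_apply algebra_simps)
    moreover have "h1 \<otimes>\<^bsub>coord_ring (carrier G) A\<^esub> h2 = h1 * h2"
      by (simp add: coord_ring_def times_fun_def)
    moreover have "?d1 * ?d2 \<in> ?M"
      using P_mult[of ?d1 1 ?d2 1] eng_mult.IH MI P2 unfolding P_1 by (auto simp: numeral_2_eq_2)
    ultimately show ?case
      using fa.vs.span_add[OF fa.vs.span_add[OF fa.vs.span_scale[OF eng_mult.IH(2)] fa.vs.span_scale[OF eng_mult.IH(1)]]]
      by metis
  qed
  then have gen: "f - cf (f \<one>) * e \<in> ?M" if "f \<in> A" for f
    using that S(3) by blast
  have "f \<in> ?M" if "f \<in> I" for f
  proof -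
    have "f - cf (f \<one>) * e = f"
      using that by (auto simp: I_iff fun_eq_iff fun_apply)
    then show ?thesis
      using gen[of f] that by (simp add: I_iff)
  qed
  then show ?thesis
    using S(1) XI by (intro exI[of _ X]) (auto simp: X_def)
qed

lemma P_finite_mod: "\<exists>B. finite B \<and> B \<subseteq> P n \<and> P n \<subseteq> spn (B \<union> P (Suc n))"
proof (induction n)
  case 0
  have "f \<in> spn ({e} \<union> P 1)" if "f \<in> A" for f
  proof -
    have "(f - cf (f \<one>) * e) + cf (f \<one>) * e \<in> spn ({e} \<union> P 1)"
      using minus_value_I[OF that] P_1 by (intro fa.vs.span_add fa.vs.span_scale fa.vs.span_base) auto
    then show ?thesis
      by simp
  qed
  then show ?case
    using e_A by (intro exI[of _ "{e}"]) auto
next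
  case (Suc n)
  then obtain B where B: "finite B" "B \<subseteq> P n" "P n \<subseteq> spn (B \<union> P (Suc n))"
    by blast
  obtain X where X: "finite X" "X \<subseteq> I" "I \<subseteq> spn (X \<union> P 2)"
    using I_generators by blast
  let ?B = "(\<lambda>(x, b). x * b) ` (X \<times> B)"
  have "P (Suc n) \<subseteq> spn (?B \<union> P (Suc (Suc n)))"
  proof (rule P_Suc_minimal)
    fix f g assume "f \<in> I" "g \<in> P n"
    then have fg: "f \<in> spn (X \<union> P 2)" "g \<in> spn (B \<union> P (Suc n))"
      using X(3) B(3) by auto
    show "f * g \<in> spn (?B \<union> P (Suc (Suc n)))"
    proof (rule fa.span_mult[OF _ _ fg])
      fix a b assume ab: "a \<in> X \<union> P 2" "b \<in> B \<union> P (Suc n)"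
      have P: "a \<in> P 1" "b \<in> P n"
        using ab X(2) B(2) P_1 P_mono[of 1 2] P_Suc_subset[of n] by auto
      show "a * b \<in> spn (?B \<union> P (Suc (Suc n)))"
      proof (cases "a \<in> X \<and> b \<in> B")
        case True
        then show ?thesis by (intro fa.vs.span_base) auto
      next
        case False
        then show ?thesis
          using ab P P_mult[of a 2 b n] P_mult[of a 1 b "Suc n"]
          by (intro fa.vs.span_base) auto
      qed
    qed simp
  qed simp
  moreover have "?B \<subseteq> P (Suc n)"
    using X(2) B(2) by (auto intro!: P_Suc_base)
  ultimately show ?case
    using X(1) B(1) by (intro exI[of _ ?B]) auto
qed

lemma A_finite_mod: "\<exists>B. finite B \<and> B \<subseteq> A \<and> A \<subseteq> spn (B \<union> P n)"
proof (induction n)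
  case 0
  then show ?case using fa.vs.span_superset[of A] by (intro exI[of _ "{}"]) auto
next
  case (Suc n)
  then obtain B where B: "finite B" "B \<subseteq> A" "A \<subseteq> spn (B \<union> P n)"
    by blast
  obtain B' where B': "finite B'" "B' \<subseteq> P n" "P n \<subseteq> spn (B' \<union> P (Suc n))"
    using P_finite_mod by blast
  have "spn (B \<union> P n) \<subseteq> spn ((B \<union> B') \<union> P (Suc n))"
  proof (intro fa.vs.span_minimal Un_least)
    show "B \<subseteq> spn ((B \<union> B') \<union> P (Suc n))"
      by (auto intro: fa.vs.span_base)
    show "P n \<subseteq> spn ((B \<union> B') \<union> P (Suc n))"
      by (rule order_trans[OF B'(3)], rule fa.vs.span_mono) auto
  qed simp
  then show ?case
    using B B' P_A[of n] by (intro exI[of _ "B \<union> B'"]) auto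
qed

end

section \<open>Distributions and the coproduct\<close>

definition tens :: "('x \<Rightarrow> 'k::field) \<Rightarrow> ('x \<Rightarrow> 'k) \<Rightarrow> 'x \<times> 'x \<Rightarrow> 'k"
  where "tens u v = (\<lambda>(x, y). u x * v y)"

text \<open>
  Tensor products of function spaces are realized inside the functions on the product set.
\<close>

definition tens_span :: "('x \<Rightarrow> 'k::field) set \<Rightarrow> ('x \<Rightarrow> 'k) set \<Rightarrow> ('x \<times> 'x \<Rightarrow> 'k) set"
  where "tens_span U W = fa.vs.span {tens u v | u v. u \<in> U \<and> v \<in> W}"

definition swap :: "('x \<times> 'x \<Rightarrow> 'k) \<Rightarrow> 'x \<times> 'x \<Rightarrow> 'k"
  where "swap F = (\<lambda>(x, y). F (y, x))"

lemma tens_mult: "tens u v * tens u' v' = tens (u * u') (v * v')"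
  by (auto simp: tens_def fun_eq_iff fun_apply)

lemma tens_linear:
  "tens (u + u') v = tens u v + tens u' v" "tens u (v + v') = tens u v + tens u v'"
  "tens (u - u') v = tens u v - tens u' v" "tens u (v - v') = tens u v - tens u v'"
  "tens (cf c * u) v = cf c * tens u v" "tens u (cf c * v) = cf c * tens u v"
  by (auto simp: tens_def fun_eq_iff fun_apply algebra_simps)

lemma tens_power: "tens u v ^ n = tens (u ^ n) (v ^ n)"
  by (auto simp: tens_def fun_eq_iff power_fun_apply power_mult_distrib)

lemma tens_span_sub [simp]: "fa.vs.subspace (tens_span U W)"
  by (simp add: tens_span_def)

lemma tens_spanI: "u \<in> U \<Longrightarrow> v \<in> W \<Longrightarrow> tens u v \<in> tens_span U W"
  unfolding tens_span_def by (intro fa.vs.span_base) blast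

lemma tens_span_minimal:
  "fa.vs.subspace M \<Longrightarrow> (\<And>u v. u \<in> U \<Longrightarrow> v \<in> W \<Longrightarrow> tens u v \<in> M) \<Longrightarrow> tens_span U W \<subseteq> M"
  unfolding tens_span_def by (intro fa.vs.span_minimal) auto

lemma tens_span_mono: "U \<subseteq> U' \<Longrightarrow> W \<subseteq> W' \<Longrightarrow> tens_span U W \<subseteq> tens_span U' W'"
  by (intro tens_span_minimal tens_spanI) auto

lemma tens_span_mult:
  assumes "F \<in> tens_span U W" "F' \<in> tens_span U' W'"
    and "\<And>u u'. u \<in> U \<Longrightarrow> u' \<in> U' \<Longrightarrow> u * u' \<in> U''"
    and "\<And>v v'. v \<in> W \<Longrightarrow> v' \<in> W' \<Longrightarrow> v * v' \<in> W''"
  shows "F * F' \<in> tens_span U'' W''"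
  by (rule fa.span_mult[OF _ _ assms(1,2)[unfolded tens_span_def]])
    (auto simp: tens_mult intro!: tens_spanI assms(3,4))

lemma swap_simps:
  "swap (F + F') = swap F + swap F'" "swap (F - F') = swap F - swap F'" "swap (cf c * F) = cf c * swap F"
  "swap (tens u v) = tens v u" "swap 0 = 0"
  by (auto simp: swap_def tens_def fun_eq_iff fun_apply)

lemma swap_mult: "swap (F * F') = swap F * swap F'"
  by (auto simp: swap_def fun_eq_iff fun_apply)

lemma linear_preimage_sub:
  fixes T :: "('x \<Rightarrow> 'k::field) \<Rightarrow> ('y \<Rightarrow> 'k)"
  assumes S: "fa.vs.subspace S" and T: "\<And>F F'. T (F + F') = T F + T F'" "\<And>c F. T (cf c * F) = cf c * T F"
  shows "fa.vs.subspace {F. T F \<in> S}"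
proof -
  have "T 0 = 0"
    using T(2)[of 0 0] by simp
  then show ?thesis
    using S unfolding fa.vs.subspace_def by (auto simp: T)
qed

lemma swap_tens_span: "F \<in> tens_span U W \<Longrightarrow> swap F \<in> tens_span W U"
proof -
  have "tens_span U W \<subseteq> {F. swap F \<in> tens_span W U}"
    by (intro tens_span_minimal linear_preimage_sub tens_span_sub) (auto simp: swap_simps intro: tens_spanI)
  then show "F \<in> tens_span U W \<Longrightarrow> swap F \<in> tens_span W U" by blast
qed

context affine_algebraic_group
begin

text \<open>
  The linear functionals on \<open>A\<close>, normalized as in the definition of \<open>Dist\<close>: functions outside \<open>A\<close> are sent
  to \<open>0\<close>.
\<close>

definition lin :: "(('g \<Rightarrow> 'k) \<Rightarrow> 'k) \<Rightarrow> bool"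
  where "lin \<mu> \<longleftrightarrow> (\<forall>f. f \<notin> A \<longrightarrow> \<mu> f = 0) \<and> (\<forall>f\<in>A. \<forall>g\<in>A. \<mu> (f + g) = \<mu> f + \<mu> g) \<and>
    (\<forall>c. \<forall>f\<in>A. \<mu> (cf c * f) = c * \<mu> f)"

abbreviation V :: "nat \<Rightarrow> (('g \<Rightarrow> 'k) \<Rightarrow> 'k) set"
  where "V k \<equiv> Dist_plus G A k"

lemma lin_outside: "lin \<mu> \<Longrightarrow> f \<notin> A \<Longrightarrow> \<mu> f = 0"
  and lin_add: "lin \<mu> \<Longrightarrow> f \<in> A \<Longrightarrow> g \<in> A \<Longrightarrow> \<mu> (f + g) = \<mu> f + \<mu> g"
  and lin_scale: "lin \<mu> \<Longrightarrow> f \<in> A \<Longrightarrow> \<mu> (cf c * f) = c * \<mu> f"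
  by (simp_all add: lin_def)

lemma lin_zero: "lin \<mu> \<Longrightarrow> \<mu> 0 = 0"
  using lin_scale[of \<mu> 0 0] fa.vs.subspace_0[OF A_sub] by simp

lemma lin_kernel_sub: "lin \<mu> \<Longrightarrow> fa.vs.subspace {f \<in> A. \<mu> f = 0}"
  using A_sub by (auto simp: fa.vs.subspace_def lin_add lin_scale lin_zero)

lemma lin_vanish_span:
  assumes "lin \<mu>" "S \<subseteq> A" "\<And>f. f \<in> S \<Longrightarrow> \<mu> f = 0" "f \<in> fa.vs.span S"
  shows "\<mu> f = 0"
  using fa.vs.span_minimal[OF _ lin_kernel_sub[OF assms(1)], of S] assms(2-) by blast

lemma Dist_iff: "\<mu> \<in> Dist G A k \<longleftrightarrow> lin \<mu> \<and> (\<forall>f\<in>P (Suc k). \<mu> f = 0)"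
  by (simp add: Dist_def lin_def P_def I_def plus_fun_def times_fun_def cf_def)

lemma V_iff: "\<mu> \<in> V k \<longleftrightarrow> lin \<mu> \<and> (\<forall>f\<in>P (Suc k). \<mu> f = 0) \<and> \<mu> e = 0"
  by (simp add: Dist_plus_def Dist_iff e_def)

lemma V_lin: "\<mu> \<in> V k \<Longrightarrow> lin \<mu>"
  and V_kill: "\<mu> \<in> V k \<Longrightarrow> k < n \<Longrightarrow> f \<in> P n \<Longrightarrow> \<mu> f = 0"
  and V_e: "\<mu> \<in> V k \<Longrightarrow> \<mu> e = 0"
  using P_mono[of "Suc k" n] by (auto simp: V_iff Suc_le_eq)

lemma lin_sub: "fa.vs.subspace {\<mu>. lin \<mu>}"
  unfolding fa.vs.subspace_def lin_def by (auto simp: fun_apply algebra_simps)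

lemma V_sub: "fa.vs.subspace (V k)"
  using lin_sub by (auto simp: fa.vs.subspace_def V_iff fun_apply)

lemma V_mono: "m \<le> n \<Longrightarrow> V m \<subseteq> V n"
proof
  fix \<mu> assume "m \<le> n" "\<mu> \<in> V m"
  then show "\<mu> \<in> V n"
    using V_kill[of \<mu> m "Suc n"] V_lin V_e unfolding V_iff[of \<mu> n] by simp
qed

lemma V_0: "\<mu> \<in> V 0 \<Longrightarrow> \<mu> = 0"
proof
  fix f assume \<mu>: "\<mu> \<in> V 0"
  show "\<mu> f = 0 f"
  proof (cases "f \<in> A")
    case True
    have "\<mu> ((f - cf (f \<one>) * e) + cf (f \<one>) * e) = \<mu> (f - cf (f \<one>) * e) + \<mu> (cf (f \<one>) * e)"
      using minus_value_I[OF True] fa.vs.subspace_scale[OF A_sub e_A]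
      by (intro lin_add V_lin[OF \<mu>]) (auto simp: I_iff)
    also have "\<mu> (f - cf (f \<one>) * e) = 0"
      using \<mu> minus_value_I[OF True] P_1 by (auto simp: V_iff)
    also have "\<mu> (cf (f \<one>) * e) = 0"
      using lin_scale[OF V_lin[OF \<mu>] e_A] V_e[OF \<mu>] by simp
    finally show ?thesis by (simp add: fun_apply)
  next
    case False
    then show ?thesis
      using lin_outside[OF V_lin[OF \<mu>]] by (simp add: fun_apply)
  qed
qed

text \<open>A functional killing \<open>P (Suc k)\<close> is determined by its values on a finite set spanning \<open>A\<close> modulo \<open>P (Suc k)\<close>.\<close>

lemma V_finite: "\<exists>B. finite B \<and> B \<subseteq> V k \<and> V k \<subseteq> fa.vs.span B"
proof -
  obtain X where X: "finite X" "X \<subseteq> A" "A \<subseteq> spn (X \<union> P (Suc k))"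
    using A_finite_mod by blast
  show ?thesis
  proof (rule finite_spanning_subset[OF V_sub X(1)])
    fix \<mu> assume \<mu>: "\<mu> \<in> V k" "\<forall>x\<in>X. \<mu> x = 0"
    show "\<mu> = 0"
    proof
      fix f
      show "\<mu> f = 0 f"
      proof (cases "f \<in> A")
        case True
        have "\<mu> f = 0"
        proof (rule lin_vanish_span[OF V_lin[OF \<mu>(1)]])
          show "X \<union> P (Suc k) \<subseteq> A" using X(2) P_A by blast
          show "f \<in> spn (X \<union> P (Suc k))" using True X(3) by blast
        qed (use \<mu> in \<open>auto simp: V_iff\<close>)
        then show ?thesis by (simp add: fun_apply)
      next
        case False
        then show ?thesis
          using lin_outside[OF V_lin[OF \<mu>(1)]] by (simp add: fun_apply)
      qed
    qed
  qed
qed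

definition cm :: "('g \<Rightarrow> 'k) \<Rightarrow> 'g \<times> 'g \<Rightarrow> 'k"
  where "cm f = (\<lambda>(x, y). comult G f x y)"

lemma cm_simps:
  "cm (f + g) = cm f + cm g" "cm (cf c * f) = cf c * cm f" "cm e = tens e e"
  by (auto simp: cm_def comult_def fun_eq_iff fun_apply tens_def e_apply)

lemma cm_mult: "cm (f * g) = cm f * cm g"
  by (auto simp: cm_def comult_def fun_eq_iff fun_apply)

lemma cm_power: "n > 0 \<Longrightarrow> cm (f ^ n) = cm f ^ n"
  by (auto simp: cm_def comult_def fun_eq_iff power_fun_apply)

text \<open>
  Besides a decomposition of the coproduct, the counit identities, obtained by setting one variable equal
  to the unit element.
\<close>

lemma cm_sweedler:
  assumes f: "f \<in> A"
  obtains n u v where "\<And>i. i < n \<Longrightarrow> u i \<in> A \<and> v i \<in> A" "cm f = (\<Sum>i<(n::nat). tens (u i) (v i))"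
    "f = (\<Sum>i<n. cf (u i \<one>) * v i)" "f = (\<Sum>i<n. cf (v i \<one>) * u i)"
proof -
  obtain n u v where uv: "\<forall>i<n. u i \<in> A \<and> v i \<in> A"
    "\<forall>x\<in>carrier G. \<forall>y\<in>carrier G. f (x \<otimes> y) = (\<Sum>i<(n::nat). u i x * v i y)"
    using mult_morphism[OF f] by blast
  have out: "u i x = 0" "v i x = 0" if "i < n" "x \<notin> carrier G" for i x
    using uv(1) zero_outside that by auto
  have "cm f (x, y) = (\<Sum>i<n. tens (u i) (v i)) (x, y)" for x y
    using uv(2) out by (cases "x \<in> carrier G"; cases "y \<in> carrier G")
      (auto simp: cm_def comult_def tens_def sum_fun_apply intro!: sum.neutral[symmetric])
  moreover have "f x = (\<Sum>i<n. cf (u i \<one>) * v i) x" for x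
    using uv(2)[rule_format, of \<one> x] out zero_outside[OF f, of x]
    by (cases "x \<in> carrier G") (auto simp: sum_fun_apply fun_apply)
  moreover have "f x = (\<Sum>i<n. cf (v i \<one>) * u i) x" for x
    using uv(2)[rule_format, of x \<one>] out zero_outside[OF f, of x]
    by (cases "x \<in> carrier G") (auto simp: sum_fun_apply fun_apply mult.commute)
  ultimately show ?thesis
    using uv(1) by (intro that[of n u v]) (auto simp: fun_eq_iff)
qed

lemma tens_sum: "tens (\<Sum>i\<in>S. u i) v = (\<Sum>i\<in>S. tens (u i) v)" "tens v (\<Sum>i\<in>S. u i) = (\<Sum>i\<in>S. tens v (u i))"
  by (auto simp: tens_def fun_eq_iff sum_fun_apply sum_distrib_left sum_distrib_right)

lemma cm_closed: "f \<in> A \<Longrightarrow> cm f \<in> tens_span A A"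
  by (rule cm_sweedler) (auto intro!: fa.vs.subspace_sum tens_spanI)

lemma cm_left: "f \<in> A \<Longrightarrow> cm f - tens e f \<in> tens_span I A"
proof (erule cm_sweedler)
  fix n :: nat and u v
  assume uv: "\<And>i. i < n \<Longrightarrow> u i \<in> A \<and> v i \<in> A" "cm f = (\<Sum>i<n. tens (u i) (v i))"
    "f = (\<Sum>i<n. cf (u i \<one>) * v i)"
  have "tens e f = (\<Sum>i<n. tens (cf (u i \<one>) * e) (v i))"
    by (subst uv(3)) (simp add: tens_sum tens_linear)
  then have "cm f - tens e f = (\<Sum>i<n. tens (u i - cf (u i \<one>) * e) (v i))"
    by (simp add: uv(2) tens_linear sum_subtractf)
  also have "\<dots> \<in> tens_span I A"
    using uv(1) by (intro fa.vs.subspace_sum tens_spanI minus_value_I) auto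
  finally show ?thesis .
qed

lemma cm_right: "f \<in> A \<Longrightarrow> cm f - tens f e \<in> tens_span A I"
proof (erule cm_sweedler)
  fix n :: nat and u v
  assume uv: "\<And>i. i < n \<Longrightarrow> u i \<in> A \<and> v i \<in> A" "cm f = (\<Sum>i<n. tens (u i) (v i))"
    "f = (\<Sum>i<n. cf (v i \<one>) * u i)"
  have "tens f e = (\<Sum>i<n. tens (u i) (cf (v i \<one>) * e))"
    by (subst uv(3)) (simp add: tens_sum tens_linear)
  then have "cm f - tens f e = (\<Sum>i<n. tens (u i) (v i - cf (v i \<one>) * e))"
    by (simp add: uv(2) tens_linear sum_subtractf)
  also have "\<dots> \<in> tens_span A I"
    using uv(1) by (intro fa.vs.subspace_sum tens_spanI minus_value_I) auto
  finally show ?thesis .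
qed

text \<open>
  Subtract from both factors of each tensor in the coproduct their values at the unit element.  By the
  counit identities the correction terms add up to \<open>f \<otimes> 1 + 1 \<otimes> f\<close>.
\<close>

lemma cm_primitive: "f \<in> I \<Longrightarrow> cm f - tens f e - tens e f \<in> tens_span I I"
proof -
  assume f: "f \<in> I"
  then obtain n u v where uv: "\<And>i. i < n \<Longrightarrow> u i \<in> A \<and> v i \<in> A" "cm f = (\<Sum>i<(n::nat). tens (u i) (v i))"
    "f = (\<Sum>i<n. cf (u i \<one>) * v i)" "f = (\<Sum>i<n. cf (v i \<one>) * u i)"
    using cm_sweedler[of f] by (auto simp: I_iff)
  have 1: "tens e f = (\<Sum>i<n. tens (cf (u i \<one>) * e) (v i))"
    by (subst uv(3)) (simp add: tens_sum tens_linear)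
  have 2: "tens f e = (\<Sum>i<n. tens (u i) (cf (v i \<one>) * e))"
    by (subst uv(4)) (simp add: tens_sum tens_linear)
  have "f \<one> = (\<Sum>i<n. u i \<one> * v i \<one>)"
    by (subst uv(3)) (simp add: sum_fun_apply fun_apply)
  then have "(\<Sum>i<n. u i \<one> * v i \<one>) = 0"
    using f by (simp add: I_iff)
  then have "(\<Sum>i<n. tens (cf (u i \<one>) * e) (cf (v i \<one>) * e)) = 0"
    by (simp add: tens_linear fun_eq_iff sum_fun_apply fun_apply sum_distrib_right[symmetric] mult.assoc[symmetric])
      (simp add: mult.commute)
  then have "cm f - tens f e - tens e f
      = (\<Sum>i<n. tens (u i) (v i) - tens (u i) (cf (v i \<one>) * e) - tens (cf (u i \<one>) * e) (v i) + tens (cf (u i \<one>) * e) (cf (v i \<one>) * e))"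
    by (simp add: 1 2 uv(2) sum_subtractf sum.distrib)
  also have "\<dots> = (\<Sum>i<n. tens (u i - cf (u i \<one>) * e) (v i - cf (v i \<one>) * e))"
    by (intro sum.cong refl) (simp only: tens_linear(3,4), simp)
  also have "\<dots> \<in> tens_span I I"
    using uv(1) by (intro fa.vs.subspace_sum tens_spanI minus_value_I) auto
  finally show ?thesis .
qed

text \<open>
  The powers of the augmentation ideal of the group \<open>G \<times> G\<close>.
\<close>

definition TT :: "nat \<Rightarrow> ('g \<times> 'g \<Rightarrow> 'k) set"
  where "TT n = fa.vs.span {tens u v | u v a b. u \<in> P a \<and> v \<in> P b \<and> n \<le> a + b}"

lemma TT_sub [simp]: "fa.vs.subspace (TT n)"
  by (simp add: TT_def)

lemma TT_base: "u \<in> P a \<Longrightarrow> v \<in> P b \<Longrightarrow> n \<le> a + b \<Longrightarrow> tens u v \<in> TT n"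
  unfolding TT_def by (intro fa.vs.span_base) blast

lemma TT_mono: "m \<le> n \<Longrightarrow> TT n \<subseteq> TT m"
  unfolding TT_def by (intro fa.vs.span_mono) (blast intro: le_trans)

lemma TT_mult: "F \<in> TT m \<Longrightarrow> F' \<in> TT n \<Longrightarrow> F * F' \<in> TT (m + n)"
proof (rule fa.span_mult[of "TT (m + n)"])
  fix F F' assume "F \<in> {tens u v | u v a b. u \<in> P a \<and> v \<in> P b \<and> m \<le> a + b}"
    "F' \<in> {tens u v | u v a b. u \<in> P a \<and> v \<in> P b \<and> n \<le> a + b}"
  then obtain u v a b u' v' a' b' where "F = tens u v" "F' = tens u' v'" "u \<in> P a" "v \<in> P b"
    "u' \<in> P a'" "v' \<in> P b'" "m \<le> a + b" "n \<le> a' + b'"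
    by blast
  then show "F * F' \<in> TT (m + n)"
    by (auto simp: tens_mult intro!: TT_base P_mult)
qed (auto simp: TT_def)

lemma tens_span_TT: "tens_span (P a) (P b) \<subseteq> TT (a + b)"
  by (intro tens_span_minimal TT_base) auto

lemma TT_AA: "TT n \<subseteq> tens_span A A"
  unfolding TT_def using P_A by (intro fa.vs.span_minimal) (auto intro!: tens_spanI)

lemma swap_TT: "F \<in> TT n \<Longrightarrow> swap F \<in> TT n"
proof -
  have "TT n \<subseteq> {F. swap F \<in> TT n}"
    unfolding TT_def[of n]
  proof (rule fa.vs.span_minimal)
    show "{tens u v | u v a b. u \<in> P a \<and> v \<in> P b \<and> n \<le> a + b} \<subseteq> {F. swap F \<in> fa.vs.span {tens u v | u v a b. u \<in> P a \<and> v \<in> P b \<and> n \<le> a + b}}"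
      unfolding TT_def[symmetric] by (auto simp: swap_simps add.commute intro!: TT_base)
  qed (intro linear_preimage_sub fa.vs.subspace_span swap_simps)
  then show "F \<in> TT n \<Longrightarrow> swap F \<in> TT n" by blast
qed

lemma cm_TT: "f \<in> P n \<Longrightarrow> cm f \<in> TT n"
proof (induction n arbitrary: f)
  case 0
  then show ?case
    using cm_closed tens_span_TT[of 0 0] by auto
next
  case (Suc n)
  have "P (Suc n) \<subseteq> {f. cm f \<in> TT (Suc n)}"
  proof (rule P_Suc_minimal)
    fix f g assume fg: "f \<in> I" "g \<in> P n"
    have fA: "f \<in> P 0" "f \<in> P 1"
      using fg(1) P_1 by (auto simp: I_iff)
    have "(cm f - tens f e - tens e f) + (tens f e + tens e f) \<in> TT 1"
    proof (intro fa.vs.subspace_add TT_sub)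
      show "cm f - tens f e - tens e f \<in> TT 1"
        using cm_primitive[OF fg(1)] tens_span_TT[of 1 1] TT_mono[of 1 2] P_1 by (auto simp: numeral_2_eq_2)
      show "tens f e \<in> TT 1"
        using fA e_A by (intro TT_base[of f 1 e 0]) auto
      show "tens e f \<in> TT 1"
        using fA e_A by (intro TT_base[of e 0 f 1]) auto
    qed
    then show "f * g \<in> {f. cm f \<in> TT (Suc n)}"
      using TT_mult[of "cm f" 1 "cm g" n] Suc.IH[OF fg(2)] by (simp add: cm_mult)
  next
    show "fa.vs.subspace {f. cm f \<in> TT (Suc n)}"
      by (intro linear_preimage_sub TT_sub cm_simps)
  qed
  then show ?case using Suc.prems by blast
qed

text \<open>
  The group law is commutative to first order: for \<open>f\<close> in the augmentation ideal the primitive part of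
  the coproduct is symmetric and the rest has degree \<open>2\<close>.  The general case follows since the coproduct
  is multiplicative.
\<close>

lemma cm_symmetric: "f \<in> P n \<Longrightarrow> cm f - swap (cm f) \<in> TT (Suc n)"
proof (induction n arbitrary: f)
  case 0
  then have f: "f \<in> A" by simp
  have f1: "cm f - tens (cf (f \<one>) * e) e \<in> TT 1"
  proof -
    have "(cm f - tens e f) + tens e (f - cf (f \<one>) * e) \<in> TT 1"
    proof (intro fa.vs.subspace_add TT_sub)
      show "cm f - tens e f \<in> TT 1"
        using cm_left[OF f] tens_span_TT[of 1 0] P_1 by auto
      show "tens e (f - cf (f \<one>) * e) \<in> TT 1"
        using minus_value_I[OF f] P_1 e_A by (intro TT_base[of e 0 _ 1]) auto
    qed
    then show ?thesis by (simp add: tens_linear)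
  qed
  have "(cm f - tens (cf (f \<one>) * e) e) - swap (cm f - tens (cf (f \<one>) * e) e) \<in> TT 1"
    by (intro fa.vs.subspace_diff TT_sub f1 swap_TT[OF f1])
  then show ?case
    by (simp add: swap_simps tens_linear)
next
  case (Suc n)
  have "P (Suc n) \<subseteq> {f. cm f - swap (cm f) \<in> TT (Suc (Suc n))}"
  proof (rule P_Suc_minimal)
    fix f g assume fg: "f \<in> I" "g \<in> P n"
    have f1: "f \<in> P 1" using fg(1) P_1 by simp
    have R: "cm f - tens f e - tens e f \<in> TT 2" (is "?R \<in> _")
      using cm_primitive[OF fg(1)] tens_span_TT[of 1 1] P_1 by (auto simp: numeral_2_eq_2)
    have "?R - swap ?R \<in> TT 2"
      by (intro fa.vs.subspace_diff TT_sub R swap_TT[OF R])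
    then have f2: "cm f - swap (cm f) \<in> TT 2"
      by (simp add: swap_simps algebra_simps)
    have "(cm f - swap (cm f)) * cm g + swap (cm f) * (cm g - swap (cm g)) \<in> TT (Suc (Suc n))"
      using TT_mult[OF f2 cm_TT[OF fg(2)]] TT_mult[OF swap_TT[OF cm_TT[OF f1]] Suc.IH[OF fg(2)]]
      by (intro fa.vs.subspace_add TT_sub) auto
    moreover have "(cm f - swap (cm f)) * cm g + swap (cm f) * (cm g - swap (cm g)) = cm (f * g) - swap (cm (f * g))"
      by (simp add: cm_mult swap_mult algebra_simps)
    ultimately show "f * g \<in> {f. cm f - swap (cm f) \<in> TT (Suc (Suc n))}"
      by simp
  next
    have "cm (f + g) - swap (cm (f + g)) = (cm f - swap (cm f)) + (cm g - swap (cm g))" for f g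
      by (simp add: cm_simps swap_simps)
    moreover have "cm (cf c * f) - swap (cm (cf c * f)) = cf c * (cm f - swap (cm f))" for c f
      by (simp add: cm_simps swap_simps right_diff_distrib)
    ultimately show "fa.vs.subspace {f. cm f - swap (cm f) \<in> TT (Suc (Suc n))}"
      by (intro linear_preimage_sub TT_sub)
  qed
  then show ?case using Suc.prems by blast
qed

text \<open>
  The functional \<open>\<mu> \<otimes> \<rho>\<close> on functions of two variables.
\<close>

definition tv :: "(('g \<Rightarrow> 'k) \<Rightarrow> 'k) \<Rightarrow> (('g \<Rightarrow> 'k) \<Rightarrow> 'k) \<Rightarrow> ('g \<times> 'g \<Rightarrow> 'k) \<Rightarrow> 'k"
  where "tv \<mu> \<rho> F = \<mu> (\<lambda>x. \<rho> (\<lambda>y. F (x, y)))"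

lemma slice_closed:
  assumes "F \<in> tens_span A A" and \<rho>: "lin \<rho>"
  shows "(\<lambda>y. F (x, y)) \<in> A" "(\<lambda>x. \<rho> (\<lambda>y. F (x, y))) \<in> A"
proof -
  have tens1: "(\<lambda>y. tens u v (x, y)) = cf (u x) * v" for u v :: "'g \<Rightarrow> 'k" and x
    by (auto simp: tens_def fun_eq_iff fun_apply)
  have s1: "(\<lambda>y. F (x, y)) \<in> A" if "F \<in> tens_span A A" for F x
  proof -
    have "tens_span A A \<subseteq> {F. (\<lambda>y. F (x, y)) \<in> A}"
    proof (rule tens_span_minimal)
      have "(\<lambda>y. (F + F') (x, y)) = (\<lambda>y. F (x, y)) + (\<lambda>y. F' (x, y))"
        "(\<lambda>y. (cf c * F) (x, y)) = cf c * (\<lambda>y. F (x, y))"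
        for F F' :: "'g \<times> 'g \<Rightarrow> 'k" and c
        by (auto simp: fun_eq_iff fun_apply)
      then show "fa.vs.subspace {F. (\<lambda>y. F (x, y)) \<in> A}"
        by (intro linear_preimage_sub A_sub)
      show "tens u v \<in> {F. (\<lambda>y. F (x, y)) \<in> A}" if "u \<in> A" "v \<in> A" for u v
        using that fa.vs.subspace_scale[OF A_sub] by (simp add: tens1)
    qed
    then show ?thesis using that by blast
  qed
  show "(\<lambda>y. F (x, y)) \<in> A"
    using s1[OF assms(1)] .
  have "tens_span A A \<subseteq> {F \<in> tens_span A A. (\<lambda>x. \<rho> (\<lambda>y. F (x, y))) \<in> A}"
  proof (rule tens_span_minimal)
    have "(\<lambda>x. \<rho> (\<lambda>y. (F + F') (x, y))) = (\<lambda>x. \<rho> (\<lambda>y. F (x, y))) + (\<lambda>x. \<rho> (\<lambda>y. F' (x, y)))"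
      if "F \<in> tens_span A A" "F' \<in> tens_span A A" for F F'
      using lin_add[OF \<rho> s1[OF that(1)] s1[OF that(2)]] by (simp add: plus_fun_def)
    moreover have "(\<lambda>x. \<rho> (\<lambda>y. (cf c * F) (x, y))) = cf c * (\<lambda>x. \<rho> (\<lambda>y. F (x, y)))"
      if "F \<in> tens_span A A" for c F
      using lin_scale[OF \<rho> s1[OF that], of c] by (simp add: times_fun_def cf_def)
    moreover have "(\<lambda>x. \<rho> (\<lambda>y. 0 (x, y))) = (0 :: 'g \<Rightarrow> 'k)"
      using lin_zero[OF \<rho>] by (simp add: zero_fun_def)
    ultimately show "fa.vs.subspace {F \<in> tens_span A A. (\<lambda>x. \<rho> (\<lambda>y. F (x, y))) \<in> A}"
      using A_sub tens_span_sub[of A A] by (simp add: fa.vs.subspace_def)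
    fix u v assume uv: "u \<in> A" "v \<in> A"
    have "(\<lambda>x. \<rho> (\<lambda>y. tens u v (x, y))) = cf (\<rho> v) * u"
      using lin_scale[OF \<rho> uv(2)] by (intro ext) (simp add: tens1 fun_apply(2,7))
    then show "tens u v \<in> {F \<in> tens_span A A. (\<lambda>x. \<rho> (\<lambda>y. F (x, y))) \<in> A}"
      using uv fa.vs.subspace_scale[OF A_sub] by (auto intro: tens_spanI)
  qed
  then show "(\<lambda>x. \<rho> (\<lambda>y. F (x, y))) \<in> A" using assms(1) by blast
qed

lemma tv_linear:
  assumes "lin \<mu>" "lin \<rho>" "F \<in> tens_span A A"
  shows "F' \<in> tens_span A A \<Longrightarrow> tv \<mu> \<rho> (F + F') = tv \<mu> \<rho> F + tv \<mu> \<rho> F'"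
    and "tv \<mu> \<rho> (cf c * F) = c * tv \<mu> \<rho> F"
proof -
  have "(\<lambda>x. \<rho> (\<lambda>y. (F + F') (x, y))) = (\<lambda>x. \<rho> (\<lambda>y. F (x, y))) + (\<lambda>x. \<rho> (\<lambda>y. F' (x, y)))"
    if "F' \<in> tens_span A A" for F'
    using lin_add[OF assms(2) slice_closed(1)[OF assms(3,2)] slice_closed(1)[OF that assms(2)]]
    by (simp add: plus_fun_def)
  then show "F' \<in> tens_span A A \<Longrightarrow> tv \<mu> \<rho> (F + F') = tv \<mu> \<rho> F + tv \<mu> \<rho> F'"
    using assms slice_closed(2) by (simp add: tv_def lin_add)
  have "(\<lambda>x. \<rho> (\<lambda>y. (cf c * F) (x, y))) = cf c * (\<lambda>x. \<rho> (\<lambda>y. F (x, y)))"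
    using lin_scale[OF assms(2) slice_closed(1)[OF assms(3,2)], of c] by (simp add: times_fun_def cf_def)
  then show "tv \<mu> \<rho> (cf c * F) = c * tv \<mu> \<rho> F"
    using assms slice_closed(2) by (simp add: tv_def lin_scale)
qed

lemma tv_tens: "lin \<mu> \<Longrightarrow> lin \<rho> \<Longrightarrow> u \<in> A \<Longrightarrow> v \<in> A \<Longrightarrow> tv \<mu> \<rho> (tens u v) = \<mu> u * \<rho> v"
proof -
  assume a: "lin \<mu>" "lin \<rho>" "u \<in> A" "v \<in> A"
  have "(\<lambda>y. tens u v (x, y)) = cf (u x) * v" for x
    by (auto simp: tens_def fun_eq_iff fun_apply)
  then have "(\<lambda>x. \<rho> (\<lambda>y. tens u v (x, y))) = cf (\<rho> v) * u"
    using lin_scale[OF a(2,4)] by (intro ext) (simp add: fun_apply(2,7))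
  then show ?thesis
    using lin_scale[OF a(1,3)] by (simp add: tv_def)
qed

lemma tv_zero: "lin \<mu> \<Longrightarrow> lin \<rho> \<Longrightarrow> tv \<mu> \<rho> 0 = 0"
  using tv_linear(2)[of \<mu> \<rho> 0 0] fa.vs.subspace_0[OF tens_span_sub, of A A] by simp

lemma tv_diff: "lin \<mu> \<Longrightarrow> lin \<rho> \<Longrightarrow> F \<in> tens_span A A \<Longrightarrow> F' \<in> tens_span A A \<Longrightarrow>
    tv \<mu> \<rho> (F - F') = tv \<mu> \<rho> F - tv \<mu> \<rho> F'"
  using tv_linear(1)[of \<mu> \<rho> "F - F'" F'] fa.vs.subspace_diff[OF tens_span_sub, of F A A F'] by simp

lemma tv_sum: "lin \<mu> \<Longrightarrow> lin \<rho> \<Longrightarrow> (\<And>i. i \<in> S \<Longrightarrow> F i \<in> tens_span A A) \<Longrightarrow>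
    tv \<mu> \<rho> (\<Sum>i\<in>S. F i) = (\<Sum>i\<in>S. tv \<mu> \<rho> (F i))"
  by (induction S rule: infinite_finite_induct)
    (auto simp: tv_zero tv_linear fa.vs.subspace_sum[OF tens_span_sub])

lemma tv_vanish_span:
  assumes "lin \<mu>" "lin \<rho>" "S \<subseteq> tens_span A A" "\<And>F. F \<in> S \<Longrightarrow> tv \<mu> \<rho> F = 0" "F \<in> fa.vs.span S"
  shows "tv \<mu> \<rho> F = 0"
proof -
  have "fa.vs.span S \<subseteq> {F \<in> tens_span A A. tv \<mu> \<rho> F = 0}"
    using assms tens_span_sub[of A A]
    by (intro fa.vs.span_minimal) (auto simp: fa.vs.subspace_def tv_linear tv_zero)
  then show ?thesis using assms(5) by blast
qed

lemma tv_swap: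
  assumes "lin \<mu>" "lin \<rho>" "F \<in> tens_span A A"
  shows "tv \<rho> \<mu> F = tv \<mu> \<rho> (swap F)"
proof -
  have "tens_span A A \<subseteq> {F \<in> tens_span A A. tv \<rho> \<mu> F = tv \<mu> \<rho> (swap F)}"
    using assms tens_span_sub[of A A]
    by (intro tens_span_minimal)
      (auto simp: fa.vs.subspace_def tv_linear tv_zero swap_simps swap_tens_span tv_tens intro: tens_spanI)
  then show ?thesis using assms(3) by blast
qed

lemma tv_kill:
  assumes "\<mu> \<in> V a" "\<rho> \<in> V b" "F \<in> TT (Suc (a + b))"
  shows "tv \<mu> \<rho> F = 0"
proof (rule tv_vanish_span[OF V_lin[OF assms(1)] V_lin[OF assms(2)] _ _ assms(3)[unfolded TT_def]])
  fix F assume "F \<in> {tens u v | u v c d. u \<in> P c \<and> v \<in> P d \<and> Suc (a + b) \<le> c + d}"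
  then obtain u v c d where F: "F = tens u v" "u \<in> P c" "v \<in> P d" "Suc (a + b) \<le> c + d"
    by blast
  have "u \<in> A" "v \<in> A" using F P_A by auto
  moreover have "c > a \<or> d > b" using F(4) by auto
  ultimately show "tv \<mu> \<rho> F = 0"
    using F V_kill[OF assms(1), of c u] V_kill[OF assms(2), of d v]
    by (auto simp: tv_tens[OF V_lin[OF assms(1)] V_lin[OF assms(2)]])
qed (use P_A in \<open>auto intro!: tens_spanI\<close>)

abbreviation dmult :: "(('g \<Rightarrow> 'k) \<Rightarrow> 'k) \<Rightarrow> (('g \<Rightarrow> 'k) \<Rightarrow> 'k) \<Rightarrow> ('g \<Rightarrow> 'k) \<Rightarrow> 'k"
  where "dmult \<equiv> dist_mult G A"

lemma dmult_apply: "f \<in> A \<Longrightarrow> dmult \<mu> \<rho> f = tv \<mu> \<rho> (cm f)"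
  by (simp add: dist_mult_def ext0_def tensor_dist_def tv_def cm_def)

lemma dmult_lin: "lin \<mu> \<Longrightarrow> lin \<rho> \<Longrightarrow> lin (dmult \<mu> \<rho>)"
  unfolding lin_def[of "dmult \<mu> \<rho>"]
  using fa.vs.subspace_scale[OF A_sub]
  by (auto simp: dmult_apply A_add cm_simps tv_linear cm_closed) (simp add: dist_mult_def ext0_def)

lemma dmult_V: "\<mu> \<in> V a \<Longrightarrow> \<rho> \<in> V b \<Longrightarrow> dmult \<mu> \<rho> \<in> V (a + b)"
  unfolding V_iff[of "dmult \<mu> \<rho>"]
  using P_A tv_kill[OF _ _ cm_TT]
  by (auto simp: dmult_lin V_lin dmult_apply e_A cm_simps tv_tens V_e subset_iff)

lemma dist_commutator_eq: "dist_commutator G A \<mu> \<rho> = dmult \<mu> \<rho> - dmult \<rho> \<mu>"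
  by (simp add: dist_commutator_def fun_diff_def)

text \<open>
  The commutator evaluates \<open>\<mu> \<otimes> \<rho>\<close> on the antisymmetric part of the coproduct, which has a degree one
  higher than expected.
\<close>

lemma commutator_V:
  assumes "\<mu> \<in> V a" "\<rho> \<in> V b" "a > 0"
  shows "dist_commutator G A \<mu> \<rho> \<in> V (a + b - 1)"
proof -
  note l = V_lin[OF assms(1)] V_lin[OF assms(2)]
  have "(dmult \<mu> \<rho> - dmult \<rho> \<mu>) f = 0" if f: "f \<in> P (a + b)" for f
  proof -
    have fA: "f \<in> A" using f P_A by blast
    have sw: "swap (cm f) \<in> tens_span A A"
      using swap_tens_span cm_closed[OF fA] by blast
    have "tv \<mu> \<rho> (cm f - swap (cm f)) = 0"
      using tv_kill[OF assms(1,2) cm_symmetric[OF f]] .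
    then show ?thesis
      using fA sw by (simp add: fun_apply dmult_apply tv_swap[OF l cm_closed[OF fA]] tv_diff[OF l cm_closed])
  qed
  moreover have "dmult \<mu> \<rho> - dmult \<rho> \<mu> \<in> V (a + b)"
    using dmult_V[OF assms(1,2)] dmult_V[OF assms(2,1)]
    by (intro fa.vs.subspace_diff V_sub) (simp_all add: add.commute)
  ultimately show ?thesis
    using assms(3) unfolding dist_commutator_eq V_iff by auto
qed

end

section \<open>Frobenius powers of the augmentation ideal\<close>

text \<open>
  The coefficients are indexed by \<open>B\<close> and not by the image of \<open>B\<close>, since \<open>f\<close> need not be injective.
\<close>

lemma span_family_modD:
  assumes "finite B" "fa.vs.subspace S" "x \<in> fa.vs.span (f ` B \<union> S)"
  shows "\<exists>c. x - (\<Sum>b\<in>B. cf (c b) * f b) \<in> S"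
  using assms(3)
proof (induction rule: fa.vs.span_induct_alt)
  case base
  show ?case
    using fa.vs.subspace_0[OF assms(2)] by (intro exI[of _ "\<lambda>_. 0"]) simp
next
  case (step k u x)
  then obtain c where c: "x - (\<Sum>b\<in>B. cf (c b) * f b) \<in> S" by blast
  show ?case
  proof (cases "u \<in> S")
    case True
    have "cf k * u + (x - (\<Sum>b\<in>B. cf (c b) * f b)) \<in> S"
      using True c assms(2) by (intro fa.vs.subspace_add fa.vs.subspace_scale)
    then show ?thesis
      by (intro exI[of _ c]) (simp add: algebra_simps)
  next
    case False
    then obtain b0 where b0: "b0 \<in> B" "u = f b0"
      using step.hyps by auto
    have "(\<Sum>b\<in>B. cf (if b = b0 then c b + k else c b) * f b)
        = (\<Sum>b\<in>B. (if b = b0 then cf k * f b else 0) + cf (c b) * f b)"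
      by (intro sum.cong) (auto simp: fa.scal_add algebra_simps)
    also have "\<dots> = cf k * u + (\<Sum>b\<in>B. cf (c b) * f b)"
      using b0 assms(1) by (simp add: sum.distrib)
    finally show ?thesis
      using c by (intro exI[of _ "\<lambda>b. if b = b0 then c b + k else c b"]) (simp add: algebra_simps)
  qed
qed

lemma frobenius_add:
  fixes f g :: "'x \<Rightarrow> 'k::field"
  assumes "prime CHAR('k)"
  shows "(f + g) ^ (CHAR('k) ^ n) = f ^ (CHAR('k) ^ n) + g ^ (CHAR('k) ^ n)"
  using freshmans_dream'[OF assms refl] by (auto simp: fun_eq_iff power_fun_apply fun_apply)

lemma cf_power: "cf c ^ n = cf (c ^ n)"
  by (auto simp: fun_eq_iff power_fun_apply fun_apply)

locale affine_algebraic_group_char_p =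
  affine_algebraic_group G A for G :: "('g, 'm) monoid_scheme" (structure) and A :: "('g \<Rightarrow> 'k::alg_closed_field) set" +
  fixes p :: nat
  assumes prime_p: "prime p" and char_p: "CHAR('k) = p"
begin

lemma p_gt_1: "p > 1"
  using prime_p by (rule prime_gt_1_nat)

lemma p_pos [simp]: "p > 0" "p \<noteq> 0"
  using p_gt_1 by simp_all

lemma pow_pos: "p ^ k > 0"
  by simp

lemma frob_add: "(f + g) ^ (p ^ n) = f ^ (p ^ n) + (g :: 'x \<Rightarrow> 'k) ^ (p ^ n)"
  using frobenius_add[of f g n] prime_p char_p by simp

lemma less_pow: "k < p ^ k"
  using p_gt_1 by (simp add: less_exp power_gt_expt)

text \<open>The ideal of the \<open>R\<close>-th Frobenius kernel of the group.\<close>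

definition J :: "nat \<Rightarrow> ('g \<Rightarrow> 'k) set"
  where "J R = fa.vs.span {a * f ^ (p ^ R) | a f. a \<in> A \<and> f \<in> I}"

text \<open>
  Distributions of order at most \<open>m\<close>, supported on the \<open>R\<close>-th Frobenius kernel and vanishing on constants.
  For \<open>m < p ^ R\<close> the support condition is void (\<open>D_eq_V\<close>), so that results about \<open>D R\<close> with large \<open>R\<close>
  apply to \<open>V\<close>.
\<close>

definition D :: "nat \<Rightarrow> nat \<Rightarrow> (('g \<Rightarrow> 'k) \<Rightarrow> 'k) set"
  where "D R m = {\<mu> \<in> V m. \<forall>h\<in>J R. \<mu> h = 0}"

text \<open>Together with the constants, \<open>N R n\<close> is the space of functions annihilated by \<open>D R n\<close>.\<close>

definition N :: "nat \<Rightarrow> nat \<Rightarrow> ('g \<Rightarrow> 'k) set"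
  where "N R n = fa.vs.span (P (Suc n) \<union> J R)"

lemma J_sub [simp]: "fa.vs.subspace (J R)"
  by (simp add: J_def)

lemma J_base: "a \<in> A \<Longrightarrow> f \<in> I \<Longrightarrow> a * f ^ (p ^ R) \<in> J R"
  unfolding J_def by (intro fa.vs.span_base) blast

lemma J_minimal: "fa.vs.subspace M \<Longrightarrow> (\<And>a f. a \<in> A \<Longrightarrow> f \<in> I \<Longrightarrow> a * f ^ (p ^ R) \<in> M) \<Longrightarrow> J R \<subseteq> M"
  unfolding J_def by (intro fa.vs.span_minimal) auto

lemma J_P: "J R \<subseteq> P (p ^ R)"
proof (rule J_minimal[OF P_sub])
  fix a f assume "a \<in> A" "f \<in> I"
  then show "a * f ^ (p ^ R) \<in> P (p ^ R)"
    using P_mult[of a 0 "f ^ (p ^ R)" "p ^ R"] I_power[of f "p ^ R"] by simp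
qed

lemma J_A: "J R \<subseteq> A"
  using J_P P_A by blast

lemma J_mult: "a \<in> A \<Longrightarrow> h \<in> J R \<Longrightarrow> a * h \<in> J R"
proof -
  assume a: "a \<in> A"
  have "J R \<subseteq> {h. a * h \<in> J R}"
  proof (rule J_minimal)
    show "fa.vs.subspace {h. a * h \<in> J R}"
      by (intro linear_preimage_sub J_sub) (auto simp: distrib_left fa.scal_assoc)
    show "b * f ^ (p ^ R) \<in> {h. a * h \<in> J R}" if "b \<in> A" "f \<in> I" for b f
      using J_base[OF A_mult[OF a that(1)] that(2)] by (simp add: mult.assoc)
  qed
  then show "h \<in> J R \<Longrightarrow> a * h \<in> J R" by blast
qed

lemma J_frob: "f \<in> I \<Longrightarrow> R \<le> k \<Longrightarrow> f ^ (p ^ k) \<in> J R"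
proof -
  assume f: "f \<in> I" and k: "R \<le> k"
  have fR: "f ^ (p ^ R) \<in> A" and fA: "f \<in> A"
    using f A_power by (auto simp: I_iff)
  have "e * f ^ (p ^ R) \<in> J R"
    by (intro J_base e_A f)
  then have 1: "f ^ (p ^ R) \<in> J R"
    using fR by simp
  show ?thesis
  proof (cases "k = R")
    case False
    then have "p ^ R < p ^ k"
      using k p_gt_1 by (intro power_strict_increasing) auto
    then have "f ^ (p ^ k) = f ^ (p ^ k - p ^ R) * f ^ (p ^ R)"
      by (simp flip: power_add)
    then show ?thesis
      using J_mult[OF A_power[OF fA] 1, of "p ^ k - p ^ R"] \<open>p ^ R < p ^ k\<close> by simp
  qed (use 1 in simp)
qed

lemma D_sub: "fa.vs.subspace (D R m)"
  using V_sub[of m] unfolding fa.vs.subspace_def D_def by (auto simp: fun_apply)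

lemma D_V: "D R m \<subseteq> V m"
  by (auto simp: D_def)

lemma D_eq_V: "m < p ^ R \<Longrightarrow> D R m = V m"
  using J_P[of R] V_kill[of _ m "p ^ R"] unfolding D_def by blast

text \<open>The \<open>p ^ k\<close>-th powers of functions in the augmentation ideal; no ideal is generated here.\<close>

definition FI :: "nat \<Rightarrow> ('g \<Rightarrow> 'k) set" where "FI k = (\<lambda>f. f ^ (p ^ k)) ` I"

lemma FI_J: "FI R \<subseteq> J R"
  using J_frob by (auto simp: FI_def)

lemma FI_P: "FI k \<subseteq> P (p ^ k)"
  using I_power by (auto simp: FI_def)

lemma tens_span_frob: "F \<in> tens_span I I \<Longrightarrow> F ^ (p ^ k) \<in> tens_span (FI k) (FI k)"
proof -
  have "tens_span I I \<subseteq> {F. F ^ (p ^ k) \<in> tens_span (FI k) (FI k)}"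
  proof (rule tens_span_minimal)
    show "fa.vs.subspace {F. F ^ (p ^ k) \<in> tens_span (FI k) (FI k)}"
      using tens_span_sub[of "FI k" "FI k"] unfolding fa.vs.subspace_def
      by (auto simp: frob_add power_mult_distrib cf_power power_0_left)
    show "tens u v \<in> {F. F ^ (p ^ k) \<in> tens_span (FI k) (FI k)}" if "u \<in> I" "v \<in> I" for u v
      using that by (auto simp: tens_power FI_def intro: tens_spanI)
  qed
  then show "F \<in> tens_span I I \<Longrightarrow> F ^ (p ^ k) \<in> tens_span (FI k) (FI k)" by blast
qed

text \<open>
  The Frobenius map is additive, so raising the coproduct formula to the power \<open>p ^ k\<close> leaves no mixed
  terms apart from those in the remainder.
\<close>

lemma cm_frob:
  assumes "f \<in> I"
  shows "cm (f ^ (p ^ k)) - tens (f ^ (p ^ k)) e - tens e (f ^ (p ^ k)) \<in> tens_span (FI k) (FI k)"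
proof -
  let ?R = "cm f - tens f e - tens e f"
  have "cm f = ?R + tens f e + tens e f"
    by simp
  then have "cm (f ^ (p ^ k)) = (?R + tens f e + tens e f) ^ (p ^ k)"
    by (simp add: cm_power)
  also have "\<dots> = ?R ^ (p ^ k) + tens (f ^ (p ^ k)) e + tens e (f ^ (p ^ k))"
    by (simp only: frob_add tens_power e_power[OF pow_pos])
  finally show ?thesis
    using tens_span_frob[OF cm_primitive[OF assms], of k] by simp
qed

lemma tv_vanish_tens:
  assumes "lin \<mu>" "lin \<rho>" "U \<subseteq> A" "W \<subseteq> A" "\<And>u v. u \<in> U \<Longrightarrow> v \<in> W \<Longrightarrow> \<mu> u = 0 \<or> \<rho> v = 0"
    and F: "F \<in> tens_span U W"
  shows "tv \<mu> \<rho> F = 0"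
proof (rule tv_vanish_span[OF assms(1,2) _ _ F[unfolded tens_span_def]])
  show "{tens u v | u v. u \<in> U \<and> v \<in> W} \<subseteq> tens_span A A"
    using assms(3,4) by (auto intro!: tens_spanI)
  fix F assume "F \<in> {tens u v | u v. u \<in> U \<and> v \<in> W}"
  then obtain u v where F: "F = tens u v" "u \<in> U" "v \<in> W" by blast
  then have "u \<in> A" "v \<in> A" using assms(3,4) by auto
  then show "tv \<mu> \<rho> F = 0"
    using F assms(5)[OF F(2,3)] tv_tens[OF assms(1,2)] by auto
qed

text \<open>
  The Frobenius kernel is a subgroup: the coproduct of its ideal \<open>J\<close> lies in \<open>J \<otimes> A + A \<otimes> J\<close>.
\<close>

lemma dmult_D:
  assumes \<alpha>: "\<alpha> \<in> D R a" and \<beta>: "\<beta> \<in> D R b"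
  shows "dmult \<alpha> \<beta> \<in> D R (a + b)"
proof -
  have V: "\<alpha> \<in> V a" "\<beta> \<in> V b" and kill: "\<And>h. h \<in> J R \<Longrightarrow> \<alpha> h = 0" "\<And>h. h \<in> J R \<Longrightarrow> \<beta> h = 0"
    using \<alpha> \<beta> by (auto simp: D_def)
  note l = V_lin[OF V(1)] V_lin[OF V(2)]
  have "J R \<subseteq> {h \<in> A. dmult \<alpha> \<beta> h = 0}"
  proof (rule J_minimal[OF lin_kernel_sub[OF dmult_lin[OF l]]])
    fix c f assume c: "c \<in> A" and f: "f \<in> I"
    let ?g = "f ^ (p ^ R)"
    let ?S = "cm ?g - tens ?g e - tens e ?g"
    have g: "?g \<in> A" "?g \<in> J R"
      using J_frob[OF f order_refl] J_A by auto
    have c': "cm c \<in> tens_span A A" by (rule cm_closed[OF c])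
    have AJ: "u * v \<in> J R" if "u \<in> A" "v \<in> FI R" for u v
      using that J_mult FI_J by blast
    have FIA: "FI R \<subseteq> A" using FI_J J_A by blast
    have 1: "cm c * ?S \<in> tens_span (J R) A"
      by (rule tens_span_mult[OF c' cm_frob[OF f]]) (use AJ J_A FIA A_mult in blast)+
    have 2: "cm c * tens ?g e \<in> tens_span (J R) A"
      by (rule tens_span_mult[OF c' tens_spanI[of ?g "{?g}" e "{e}"]]) (use J_mult g A_mult e_A in auto)
    have 3: "cm c * tens e ?g \<in> tens_span A (J R)"
      by (rule tens_span_mult[OF c' tens_spanI[of e "{e}" ?g "{?g}"]]) (use J_mult g A_mult e_A in auto)
    have z: "tv \<alpha> \<beta> F = 0" if "F \<in> tens_span (J R) A \<or> F \<in> tens_span A (J R)" for F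
      using that tv_vanish_tens[OF l J_A order_refl] tv_vanish_tens[OF l order_refl J_A] kill by blast
    have in_AA: "F \<in> tens_span A A" if "F \<in> tens_span (J R) A \<or> F \<in> tens_span A (J R)" for F
      using that tens_span_mono[OF J_A[of R] order_refl[of A]] tens_span_mono[OF order_refl[of A] J_A[of R]] by blast
    have "cm (c * ?g) = cm c * ?S + (cm c * tens ?g e + cm c * tens e ?g)"
      by (simp add: cm_mult algebra_simps)
    then have "tv \<alpha> \<beta> (cm (c * ?g)) = 0"
      using 1 2 3 by (simp add: tv_linear[OF l] in_AA fa.vs.subspace_add[OF tens_span_sub] z)
    then show "c * ?g \<in> {h \<in> A. dmult \<alpha> \<beta> h = 0}"
      using A_mult[OF c g(1)] by (simp add: dmult_apply)
  qed
  then show ?thesis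
    using dmult_V[OF V] by (auto simp: D_def)
qed

text \<open>
  Let \<open>x\<close> have order at most \<open>p ^ R\<close>, and evaluate \<open>x d\<close> and \<open>d x\<close> on a generator \<open>a * g\<close> of \<open>J R\<close> with
  \<open>g = f ^ (p ^ R)\<close>.  As \<open>d\<close> kills \<open>J R\<close> and \<open>x\<close> kills functions vanishing to order above \<open>p ^ R\<close>, only
  \<open>g \<otimes> 1\<close> in the coproduct of \<open>g\<close> and \<open>1 \<otimes> a\<close> in that of \<open>a\<close> contribute to the value of \<open>x d\<close>, which is
  \<open>x g * d a\<close>.  The same computation with the factors swapped gives the same value for \<open>d x\<close>.
  This is the infinitesimal form of the normality of the Frobenius kernel.
\<close>

lemma commutator_D:
  assumes x: "x \<in> V (p ^ R)" and d: "d \<in> D R i"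
  shows "dist_commutator G A x d \<in> D R (p ^ R + i - 1)"
proof -
  have dV: "d \<in> V i" and kill: "\<And>h. h \<in> J R \<Longrightarrow> d h = 0"
    using d by (auto simp: D_def)
  note l = V_lin[OF x] V_lin[OF dV]
  \<comment> \<open>used for \<open>F1\<close>, \<open>F2\<close> the coproducts of \<open>a\<close>, \<open>g\<close> and again for the swapped coproducts\<close>
  have key: "tv x d (F1 * F2) = x g * d a" if a: "a \<in> A" and g: "g \<in> FI R" and F1: "F1 \<in> tens_span A A" "F1 - tens e a \<in> tens_span I A"
    and F2: "F2 - tens g e - tens e g \<in> tens_span (FI R) (FI R)" for F1 F2 a g
  proof -
    let ?S = "F2 - tens g e - tens e g"
    have gA: "g \<in> A" "g \<in> J R" "g \<in> P (p ^ R)"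
      using g FI_J[of R] J_A[of R] FI_P[of R] by auto
    have AJ: "u * v \<in> J R" if "u \<in> A" "v \<in> FI R" for u v
      using that J_mult FI_J by blast
    have FIA: "FI R \<subseteq> A" using FI_J J_A by blast
    have 1: "F1 * ?S \<in> tens_span A (J R)"
      by (rule tens_span_mult[OF F1(1) F2]) (use AJ J_A FIA A_mult in blast)+
    have 2: "F1 * tens e g \<in> tens_span A (J R)"
      by (rule tens_span_mult[OF F1(1) tens_spanI[of e "{e}" g "{g}"]]) (use J_mult gA A_mult e_A in auto)
    have 3: "(F1 - tens e a) * tens g e \<in> tens_span (P (Suc (p ^ R))) A"
      by (rule tens_span_mult[OF F1(2) tens_spanI[of g "{g}" e "{e}"]]) (use gA A_mult e_A P_Suc_base in auto)
    have zJ: "tv x d F = 0" if "F \<in> tens_span A (J R)" for F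
      using that tv_vanish_tens[OF l order_refl J_A] kill by blast
    have zP: "tv x d F = 0" if "F \<in> tens_span (P (Suc (p ^ R))) A" for F
      by (rule tv_vanish_tens[OF l P_A order_refl _ that]) (use V_kill[OF x, of "Suc (p ^ R)"] in blast)
    have in_AA: "F \<in> tens_span A A" if "F \<in> tens_span (P (Suc (p ^ R))) A \<or> F \<in> tens_span A (J R)" for F
      using that tens_span_mono[OF P_A[of "Suc (p ^ R)"] order_refl[of A]] tens_span_mono[OF order_refl[of A] J_A[of R]] by blast
    have "tens e a * tens g e = tens g a"
      using gA a by (simp add: tens_mult mult.commute[of a])
    then have "F1 * F2 = F1 * ?S + (F1 * tens e g + ((F1 - tens e a) * tens g e + tens g a))"
      by (simp add: algebra_simps)
    moreover have "tens g a \<in> tens_span A A"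
      using gA a by (intro tens_spanI)
    ultimately show ?thesis
      using 1 2 3 by (simp add: tv_linear[OF l] in_AA fa.vs.subspace_add[OF tens_span_sub] zJ zP tv_tens[OF l] gA a)
  qed
  have "J R \<subseteq> {h \<in> A. dist_commutator G A x d h = 0}"
  proof (rule J_minimal)
    have "lin (dist_commutator G A x d)"
      using fa.vs.subspace_diff[OF lin_sub, of "dmult x d" "dmult d x"] dmult_lin l
      by (simp add: dist_commutator_eq)
    then show "fa.vs.subspace {h \<in> A. dist_commutator G A x d h = 0}"
      by (rule lin_kernel_sub)
    fix a f assume a: "a \<in> A" and f: "f \<in> I"
    let ?g = "f ^ (p ^ R)"
    have g: "?g \<in> FI R" "?g \<in> A"
      using f J_frob[OF f order_refl] J_A by (auto simp: FI_def)
    have "tv x d (cm a * cm ?g) = x ?g * d a"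
      by (rule key[OF a g(1) cm_closed[OF a] cm_left[OF a] cm_frob[OF f]])
    moreover have "tv x d (swap (cm a) * swap (cm ?g)) = x ?g * d a"
    proof (rule key[OF a g(1) swap_tens_span[OF cm_closed[OF a]]])
      show "swap (cm a) - tens e a \<in> tens_span I A"
        using swap_tens_span[OF cm_right[OF a]] by (simp add: swap_simps)
      show "swap (cm ?g) - tens ?g e - tens e ?g \<in> tens_span (FI R) (FI R)"
        using swap_tens_span[OF cm_frob[OF f, of R]] by (simp add: swap_simps algebra_simps)
    qed
    moreover have "a * ?g \<in> A" by (intro A_mult a g)
    ultimately show "a * ?g \<in> {h \<in> A. dist_commutator G A x d h = 0}"
      using tv_swap[OF l cm_closed[of "a * ?g"]]
      by (simp add: dist_commutator_eq fun_apply dmult_apply cm_mult swap_mult)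
  qed
  then show ?thesis
    using commutator_V[OF x dV] by (auto simp: D_def)
qed

lemma N_sub [simp]: "fa.vs.subspace (N R n)"
  by (simp add: N_def)

lemma P_N: "P (Suc n) \<subseteq> N R n" and J_N: "J R \<subseteq> N R n"
  unfolding N_def using fa.vs.span_superset by blast+

lemma N_I: "N R n \<subseteq> I"
  unfolding N_def using P_I[of "Suc n"] J_P[of R] P_I[of "p ^ R"]
  by (intro fa.vs.span_minimal I_sub) auto

lemma N_A: "N R n \<subseteq> A"
  using N_I[of R n] by (auto simp: I_iff)

lemma N_mult: "u \<in> P a \<Longrightarrow> f \<in> N R b \<Longrightarrow> u * f \<in> N R (a + b)"
proof -
  assume u: "u \<in> P a"
  have "N R b \<subseteq> {f. u * f \<in> N R (a + b)}"
    unfolding N_def[of R b]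
  proof (rule fa.vs.span_minimal)
    show "fa.vs.subspace {f. u * f \<in> N R (a + b)}"
      by (intro linear_preimage_sub N_sub) (auto simp: distrib_left fa.scal_assoc)
    have "u * f \<in> N R (a + b)" if "f \<in> P (Suc b)" for f
      using P_mult[OF u that] P_N[of "a + b" R] by auto
    moreover have "u * f \<in> N R (a + b)" if "f \<in> J R" for f
      using J_mult[OF subsetD[OF P_A u] that] J_N[of R "a + b"] by blast
    ultimately show "P (Suc b) \<union> J R \<subseteq> {f. u * f \<in> N R (a + b)}"
      by blast
  qed
  then show "f \<in> N R b \<Longrightarrow> u * f \<in> N R (a + b)" by blast
qed

lemma D_iff: "\<mu> \<in> D R n \<longleftrightarrow> lin \<mu> \<and> (\<forall>f\<in>N R n. \<mu> f = 0) \<and> \<mu> e = 0"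
proof
  assume \<mu>: "\<mu> \<in> D R n"
  then have l: "lin \<mu>" using V_lin by (auto simp: D_def)
  have "\<mu> f = 0" if "f \<in> N R n" for f
    by (rule lin_vanish_span[OF l _ _ that[unfolded N_def]])
      (use \<mu> P_A J_A in \<open>auto simp: D_def V_iff\<close>)
  then show "lin \<mu> \<and> (\<forall>f\<in>N R n. \<mu> f = 0) \<and> \<mu> e = 0"
    using \<mu> l by (auto simp: D_def V_iff)
next
  assume "lin \<mu> \<and> (\<forall>f\<in>N R n. \<mu> f = 0) \<and> \<mu> e = 0"
  then show "\<mu> \<in> D R n"
    using P_N[of n R] J_N[of R n] by (auto simp: D_def V_iff dest: subsetD)
qed

text \<open>
  A minimal finite set of generators of the \<open>p ^ k\<close>-th powers modulo \<open>N\<close> is linearly independent modulo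
  \<open>N\<close>.  For \<open>k \<ge> R\<close> all these powers lie in \<open>J R\<close>, and the minimal set is empty.
\<close>

lemma frob_generators:
  "\<exists>Y. finite Y \<and> Y \<subseteq> I \<and> (\<forall>v\<in>I. v ^ (p ^ k) \<in> spn ((\<lambda>y. y ^ (p ^ k)) ` Y \<union> N R (p ^ k))) \<and>
    (\<forall>c. (\<Sum>y\<in>Y. cf (c y) * y ^ (p ^ k)) \<in> N R (p ^ k) \<longrightarrow> (\<forall>y\<in>Y. c y = 0))"
proof -
  let ?q = "p ^ k"
  let ?N = "N R ?q"
  define gen where "gen Y \<longleftrightarrow> finite Y \<and> Y \<subseteq> I \<and> (\<forall>v\<in>I. v ^ ?q \<in> spn ((\<lambda>y. y ^ ?q) ` Y \<union> ?N))" for Y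
  obtain X where X: "finite X" "X \<subseteq> I" "I \<subseteq> spn (X \<union> P 2)"
    using I_generators by blast
  have "spn (X \<union> P 2) \<subseteq> {v. v ^ ?q \<in> spn ((\<lambda>y. y ^ ?q) ` X \<union> ?N)}"
  proof (rule fa.vs.span_minimal)
    show "X \<union> P 2 \<subseteq> {v. v ^ ?q \<in> spn ((\<lambda>y. y ^ ?q) ` X \<union> ?N)}"
    proof
      fix v assume v: "v \<in> X \<union> P 2"
      show "v \<in> {v. v ^ ?q \<in> spn ((\<lambda>y. y ^ ?q) ` X \<union> ?N)}"
      proof (cases "v \<in> X")
        case True
        then show ?thesis by (auto intro!: fa.vs.span_base)
      next
        case False
        then have "v ^ ?q \<in> P (?q * 2)"
          using v by (intro P_power) auto
        moreover have "Suc ?q \<le> ?q * 2"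
          using pow_pos[of k] by linarith
        ultimately have "v ^ ?q \<in> ?N"
          using P_mono P_N by blast
        then show ?thesis by (auto intro!: fa.vs.span_base)
      qed
    qed
    show "fa.vs.subspace {v. v ^ ?q \<in> spn ((\<lambda>y. y ^ ?q) ` X \<union> ?N)}"
      unfolding fa.vs.subspace_def
      by (auto simp: frob_add power_mult_distrib cf_power power_0_left fa.vs.span_zero fa.vs.span_add fa.vs.span_scale)
  qed
  then have "gen X"
    using X by (auto simp: gen_def)
  then obtain Y where Y: "gen Y" "\<And>Y'. gen Y' \<Longrightarrow> card Y \<le> card Y'"
    using ex_has_least_nat[of gen X card] by blast
  have "c y0 = 0" if c: "(\<Sum>y\<in>Y. cf (c y) * y ^ ?q) \<in> ?N" and y0: "y0 \<in> Y" for c y0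
  proof (rule ccontr)
    assume nz: "c y0 \<noteq> 0"
    let ?S = "(\<lambda>y. y ^ ?q) ` (Y - {y0}) \<union> ?N"
    have fin: "finite Y" using Y(1) by (simp add: gen_def)
    have "(\<Sum>y\<in>Y. cf (c y) * y ^ ?q) - (\<Sum>y\<in>Y - {y0}. cf (c y) * y ^ ?q) \<in> spn ?S"
      using c by (intro fa.vs.span_diff[OF _ fa.vs.span_sum] fa.vs.span_scale) (auto intro: fa.vs.span_base)
    then have "cf (c y0) * y0 ^ ?q \<in> spn ?S"
      using sum.remove[OF fin y0, of "\<lambda>y. cf (c y) * y ^ ?q"] by simp
    then have "cf (inverse (c y0)) * (cf (c y0) * y0 ^ ?q) \<in> spn ?S"
      by (rule fa.vs.span_scale)
    then have y0S: "y0 ^ ?q \<in> spn ?S"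
      using nz by simp
    have "spn ((\<lambda>y. y ^ ?q) ` Y \<union> ?N) \<subseteq> spn ?S"
    proof (rule fa.vs.span_minimal)
      show "(\<lambda>y. y ^ ?q) ` Y \<union> ?N \<subseteq> spn ?S"
      proof
        fix f assume "f \<in> (\<lambda>y. y ^ ?q) ` Y \<union> ?N"
        then have "f = y0 ^ ?q \<or> f \<in> ?S" by auto
        then show "f \<in> spn ?S"
        proof
          assume "f = y0 ^ ?q"
          then show ?thesis using y0S by (simp only:)
        qed (rule fa.vs.span_base)
      qed
    qed simp
    then have "gen (Y - {y0})"
      using Y(1) by (auto simp: gen_def)
    then have "card Y \<le> card (Y - {y0})"
      by (rule Y(2))
    then show False
      using card_Diff1_less[OF fin y0] by simp
  qed
  then show ?thesis
    using Y(1) unfolding gen_def by (intro exI[of _ Y]) blast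
qed

end

section \<open>Monomials in Frobenius powers and decomposition of distributions\<close>

text \<open>
  Write an exponent in base \<open>p\<close>.  A monomial in coordinates then becomes a product of factors
  \<open>(y ^ (p ^ k)) ^ a\<close> with digits \<open>a < p\<close>, and the binomial coefficients that occur in its coproduct
  become products of those of the digits, which are invertible in characteristic \<open>p\<close>.  The monomials
  with such digits as exponents are the basis dual to the basis of \<open>Dist\<close> by divided powers.  Factors
  with \<open>k > m\<close> have degree above \<open>m\<close> and are left out.
\<close>

locale frobenius_basis = affine_algebraic_group_char_p G A p
  for G :: "('g, 'm) monoid_scheme" (structure) and A :: "('g \<Rightarrow> 'k::alg_closed_field) set" and p +
  fixes R m :: nat and Y :: "nat \<Rightarrow> ('g \<Rightarrow> 'k) set"
  assumes Y_finite: "finite (Y k)" and Y_I: "Y k \<subseteq> I"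
    and Y_span: "v \<in> I \<Longrightarrow> v ^ (p ^ k) \<in> fa.vs.span ((\<lambda>y. y ^ (p ^ k)) ` Y k \<union> N R (p ^ k))"
    and Y_indep: "(\<Sum>y\<in>Y k. cf (c y) * y ^ (p ^ k)) \<in> N R (p ^ k) \<Longrightarrow> y \<in> Y k \<Longrightarrow> c y = 0"
begin

text \<open>
  An index \<open>(k, y)\<close> stands for the function \<open>val (k, y) = y ^ (p ^ k)\<close> of degree \<open>dg (k, y) = p ^ k\<close>.
  Exponents \<open>\<alpha>\<close> on \<open>Ix\<close> have the degree \<open>wt \<alpha>\<close> of their monomial and the number \<open>num \<alpha>\<close> of its factors; \<open>\<Omega>\<close>
  consists of those whose entries are digits in base \<open>p\<close>.
\<close>

definition Ix :: "(nat \<times> ('g \<Rightarrow> 'k)) set" where "Ix = (SIGMA k:{..m}. Y k)"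
definition val :: "nat \<times> ('g \<Rightarrow> 'k) \<Rightarrow> 'g \<Rightarrow> 'k" where "val j = snd j ^ (p ^ fst j)"
definition dg :: "nat \<times> ('g \<Rightarrow> 'k) \<Rightarrow> nat" where "dg j = p ^ fst j"
definition mon where "mon \<alpha> = e * (\<Prod>j\<in>Ix. val j ^ \<alpha> j)"
definition wt :: "(nat \<times> ('g \<Rightarrow> 'k) \<Rightarrow> nat) \<Rightarrow> nat" where "wt \<alpha> = (\<Sum>j\<in>Ix. \<alpha> j * dg j)"
definition num :: "(nat \<times> ('g \<Rightarrow> 'k) \<Rightarrow> nat) \<Rightarrow> nat" where "num \<alpha> = (\<Sum>j\<in>Ix. \<alpha> j)"
definition \<Omega> where "\<Omega> = PiE Ix (\<lambda>_. {..<p})"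
definition unit :: "nat \<times> ('g \<Rightarrow> 'k) \<Rightarrow> nat \<times> ('g \<Rightarrow> 'k) \<Rightarrow> nat"
  where "unit j = (\<lambda>i\<in>Ix. if i = j then 1 else 0)"

lemma Ix_finite [simp]: "finite Ix"
  by (auto simp: Ix_def Y_finite)

lemma val_P: "j \<in> Ix \<Longrightarrow> val j \<in> P (dg j)"
  using Y_I I_power by (force simp: Ix_def val_def dg_def)

lemma dg_pos [simp]: "dg j > 0"
  by (simp add: dg_def)

lemma val_A: "j \<in> Ix \<Longrightarrow> val j \<in> A"
  using val_P P_A by blast

lemma \<Omega>_finite: "finite \<Omega>"
  unfolding \<Omega>_def by (intro finite_PiE) auto

lemma mon_cong: "(\<And>j. j \<in> Ix \<Longrightarrow> \<alpha> j = \<beta> j) \<Longrightarrow> mon \<alpha> = mon \<beta>"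
  and wt_cong: "(\<And>j. j \<in> Ix \<Longrightarrow> \<alpha> j = \<beta> j) \<Longrightarrow> wt \<alpha> = wt \<beta>"
  and num_cong: "(\<And>j. j \<in> Ix \<Longrightarrow> \<alpha> j = \<beta> j) \<Longrightarrow> num \<alpha> = num \<beta>"
  by (simp_all add: mon_def wt_def num_def cong: prod.cong sum.cong)

lemma restrict_simps [simp]:
  "mon (restrict \<alpha> Ix) = mon \<alpha>" "wt (restrict \<alpha> Ix) = wt \<alpha>" "num (restrict \<alpha> Ix) = num \<alpha>"
  by (intro mon_cong wt_cong num_cong; simp)+

lemma mon_add: "mon (\<lambda>j. \<alpha> j + \<beta> j) = mon \<alpha> * mon \<beta>"
proof -
  have "mon \<alpha> * mon \<beta> = (e * e) * (\<Prod>j\<in>Ix. val j ^ \<alpha> j * val j ^ \<beta> j)"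
    by (simp only: mon_def prod.distrib mult_ac)
  then show ?thesis
    by (simp add: mon_def power_add)
qed

lemma wt_add: "wt (\<lambda>j. \<alpha> j + \<beta> j) = wt \<alpha> + wt \<beta>"
  and num_add: "num (\<lambda>j. \<alpha> j + \<beta> j) = num \<alpha> + num \<beta>"
  by (simp_all add: wt_def num_def sum.distrib algebra_simps)

lemma unit_simps:
  assumes "j \<in> Ix"
  shows "mon (\<lambda>i. c * unit j i) = e * val j ^ c" "wt (\<lambda>i. c * unit j i) = c * dg j" "num (\<lambda>i. c * unit j i) = c"
proof -
  have "(\<Prod>i\<in>Ix. val i ^ (c * unit j i)) = (\<Prod>i\<in>Ix. if i = j then val i ^ c else 1)"
    by (intro prod.cong) (auto simp: unit_def)
  then show "mon (\<lambda>i. c * unit j i) = e * val j ^ c"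
    using assms by (simp add: mon_def)
  have "(\<Sum>i\<in>Ix. c * unit j i * dg i) = (\<Sum>i\<in>Ix. if i = j then c * dg i else 0)"
    by (intro sum.cong) (auto simp: unit_def)
  then show "wt (\<lambda>i. c * unit j i) = c * dg j"
    using assms by (simp add: wt_def)
  have "(\<Sum>i\<in>Ix. c * unit j i) = (\<Sum>i\<in>Ix. if i = j then c else 0)"
    by (intro sum.cong) (auto simp: unit_def)
  then show "num (\<lambda>i. c * unit j i) = c"
    using assms by (simp add: num_def)
qed

lemma mon_unit: "j \<in> Ix \<Longrightarrow> mon (unit j) = val j"
  and wt_unit: "j \<in> Ix \<Longrightarrow> wt (unit j) = dg j"
  and num_unit: "j \<in> Ix \<Longrightarrow> num (unit j) = 1"
  using unit_simps[of j 1] val_A by simp_all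

lemma mon_P: "mon \<alpha> \<in> P (wt \<alpha>)"
proof -
  have "e * (\<Prod>j\<in>S. val j ^ \<alpha> j) \<in> P (\<Sum>j\<in>S. \<alpha> j * dg j)" if "finite S" "S \<subseteq> Ix" for S
    using that
  proof (induction S rule: finite_induct)
    case empty
    then show ?case by (simp add: e_A)
  next
    case (insert j S)
    show ?case
    proof (cases "\<alpha> j = 0")
      case True
      then show ?thesis using insert by simp
    next
      case False
      then have "val j ^ \<alpha> j * (e * (\<Prod>j\<in>S. val j ^ \<alpha> j)) \<in> P (\<alpha> j * dg j + (\<Sum>j\<in>S. \<alpha> j * dg j))"
        using insert by (intro P_mult P_power val_P) auto
      then show ?thesis
        using insert by (simp add: mult_ac)
    qed
  qed
  then show ?thesis
    by (simp add: mon_def wt_def)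
qed

lemma mon_A: "mon \<alpha> \<in> A"
  using mon_P P_A by blast

lemma num_le_wt: "num \<alpha> \<le> wt \<alpha>"
  unfolding num_def wt_def
proof (rule sum_mono)
  fix j
  have "1 \<le> dg j" using dg_pos[of j] by linarith
  then show "\<alpha> j \<le> \<alpha> j * dg j" by simp
qed

lemma wt_zero: "num \<alpha> = 0 \<Longrightarrow> wt \<alpha> = 0"
  by (simp add: wt_def num_def)

text \<open>What digit monomials of degree \<open>n\<close> span modulo \<open>N R n\<close>; by \<open>P_W\<close> this contains \<open>P n\<close>.\<close>

definition W where "W n = fa.vs.span (mon ` {\<beta> \<in> \<Omega>. wt \<beta> = n} \<union> N R n)"

lemma W_sub [simp]: "fa.vs.subspace (W n)"
  by (simp add: W_def)

lemma N_W: "N R n \<subseteq> W n"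
  unfolding W_def using fa.vs.span_superset by blast

text \<open>
  As long as an exponent is at least \<open>p\<close>, replace \<open>(v ^ (p ^ k)) ^ p\<close> by a combination of elements
  \<open>y ^ (p ^ Suc k)\<close> with \<open>y\<close> in \<open>Y (Suc k)\<close>.  The degree stays the same while the number of factors drops
  by \<open>p - 1\<close>.
\<close>

lemma mon_W: "wt \<alpha> \<le> m \<Longrightarrow> mon \<alpha> \<in> W (wt \<alpha>)"
proof (induction "num \<alpha>" arbitrary: \<alpha> rule: less_induct)
  case less
  show ?case
  proof (cases "\<forall>j\<in>Ix. \<alpha> j < p")
    case True
    then have "restrict \<alpha> Ix \<in> \<Omega>"
      by (auto simp: \<Omega>_def)
    then have "mon (restrict \<alpha> Ix) \<in> W (wt (restrict \<alpha> Ix))"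
      unfolding W_def by (intro fa.vs.span_base UnI1 imageI CollectI conjI refl)
    then show ?thesis by (simp only: restrict_simps)
  next
    case False
    then obtain j where j: "j \<in> Ix" "\<alpha> j \<ge> p" by auto
    obtain k v where kv: "j = (k, v)" "v \<in> I"
      using j Y_I by (auto simp: Ix_def)
    define \<alpha>' where "\<alpha>' i = \<alpha> i - p * unit j i" for i
    have \<alpha>: "\<alpha> i = \<alpha>' i + p * unit j i" if "i \<in> Ix" for i
      using that j by (auto simp: \<alpha>'_def unit_def)
    have mon: "mon \<alpha> = mon \<alpha>' * (e * val j ^ p)" and wt: "wt \<alpha> = wt \<alpha>' + p * dg j" and num: "num \<alpha> = num \<alpha>' + p"
      using mon_cong[OF \<alpha>] wt_cong[OF \<alpha>] num_cong[OF \<alpha>] unit_simps[OF j(1), of p]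
      by (simp_all add: mon_add wt_add num_add)
    let ?q = "p ^ Suc k"
    have q: "p * dg j = ?q" by (simp add: dg_def kv)
    have "val j ^ p = v ^ ?q"
      by (simp add: val_def kv power_mult[symmetric] mult.commute)
    then have mon': "mon \<alpha> = mon \<alpha>' * v ^ ?q"
      using A_power[of v ?q] kv(2) mon by (simp add: I_iff)
    have km: "Suc k \<le> m"
      using less_pow[of "Suc k"] less.prems wt q by linarith
    have "fa.vs.span ((\<lambda>y. y ^ ?q) ` Y (Suc k) \<union> N R ?q) \<subseteq> {f. mon \<alpha>' * f \<in> W (wt \<alpha>)}"
    proof (rule fa.vs.span_minimal)
      show "fa.vs.subspace {f. mon \<alpha>' * f \<in> W (wt \<alpha>)}"
        by (intro linear_preimage_sub W_sub) (auto simp: distrib_left fa.scal_assoc)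
      have "mon \<alpha>' * y ^ ?q \<in> W (wt \<alpha>)" if y: "y \<in> Y (Suc k)" for y
      proof -
        let ?i = "(Suc k, y)"
        have i: "?i \<in> Ix" using km y by (simp add: Ix_def)
        have "num (\<lambda>j. \<alpha>' j + unit ?i j) < num \<alpha>"
          using num p_gt_1 by (simp add: num_add num_unit[OF i])
        moreover have wt': "wt (\<lambda>j. \<alpha>' j + unit ?i j) = wt \<alpha>"
          using wt q by (simp add: wt_add wt_unit[OF i]) (simp add: dg_def)
        ultimately have "mon (\<lambda>j. \<alpha>' j + unit ?i j) \<in> W (wt \<alpha>)"
          using less.hyps[of "\<lambda>j. \<alpha>' j + unit ?i j"] less.prems by simp
        then show ?thesis
          by (simp only: mon_add mon_unit[OF i]) (simp add: val_def)
      qed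
      moreover have "mon \<alpha>' * f \<in> W (wt \<alpha>)" if "f \<in> N R ?q" for f
        using N_mult[OF mon_P that, of \<alpha>'] N_W wt q by auto
      ultimately show "(\<lambda>y. y ^ ?q) ` Y (Suc k) \<union> N R ?q \<subseteq> {f. mon \<alpha>' * f \<in> W (wt \<alpha>)}"
        by blast
    qed
    then show ?thesis
      unfolding mon' using Y_span[OF kv(2), of "Suc k"] by blast
  qed
qed

lemma P_W: "n \<le> m \<Longrightarrow> P n \<subseteq> W n"
proof (induction n)
  case 0
  have "mon (\<lambda>_. 0) \<in> W (wt (\<lambda>_. 0))"
    by (rule mon_W) (simp add: wt_def)
  then have e: "e \<in> W 0"
    by (simp add: mon_def wt_def)
  have I: "I \<subseteq> W 0"
    using N_W[of 0] P_N[of 0 R] P_1 by auto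
  show ?case
  proof
    fix f assume "f \<in> P 0"
    then have "(f - cf (f \<one>) * e) + cf (f \<one>) * e \<in> W 0"
      using I e minus_value_I[of f] by (intro fa.vs.subspace_add fa.vs.subspace_scale W_sub) auto
    then show "f \<in> W 0" by simp
  qed
next
  case (Suc n)
  show ?case
  proof (rule P_Suc_minimal[OF W_sub])
    fix f g assume f: "f \<in> I" and g: "g \<in> P n"
    have f': "f \<in> fa.vs.span ((\<lambda>y. y ^ 1) ` Y 0 \<union> N R 1)"
      using Y_span[OF f, of 0] by simp
    have g': "g \<in> fa.vs.span (mon ` {\<beta> \<in> \<Omega>. wt \<beta> = n} \<union> N R n)"
      using Suc g by (auto simp: W_def)
    show "f * g \<in> W (Suc n)"
    proof (rule fa.span_mult[OF W_sub _ f' g'])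
      fix a b assume ab: "a \<in> (\<lambda>y. y ^ 1) ` Y 0 \<union> N R 1" "b \<in> mon ` {\<beta> \<in> \<Omega>. wt \<beta> = n} \<union> N R n"
      have aI: "a \<in> P 1" using ab(1) Y_I[of 0] N_I[of R 1] P_1 by auto
      have bP: "b \<in> P n \<or> b \<in> N R n" using ab(2) mon_P by auto
      consider "b \<in> N R n" | "a \<in> N R 1" "b \<in> P n" | \<beta> where "a \<in> Y 0" "\<beta> \<in> \<Omega>" "wt \<beta> = n" "b = mon \<beta>"
        using ab bP by auto
      then show "a * b \<in> W (Suc n)"
      proof cases
        case 1
        then show ?thesis using N_mult[OF aI 1] N_W by auto
      next
        case 2
        then show ?thesis using N_mult[OF 2(2,1)] N_W by (auto simp: mult.commute)
      next
        case 3
        have i: "(0, a) \<in> Ix" using 3 by (simp add: Ix_def)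
        have "mon (\<lambda>j. \<beta> j + unit (0, a) j) \<in> W (wt (\<lambda>j. \<beta> j + unit (0, a) j))"
          by (rule mon_W) (use 3 Suc.prems in \<open>simp add: wt_add wt_unit[OF i], simp add: dg_def\<close>)
        then have "mon \<beta> * val (0, a) \<in> W (n + dg (0, a))"
          by (simp only: mon_add mon_unit[OF i] wt_add wt_unit[OF i] 3(3))
        then show ?thesis
          using 3 by (simp add: val_def dg_def mult.commute)
      qed
    qed
  qed
qed

text \<open>
  Equality of leading forms of degree \<open>n\<close>, which is what a product of two distributions of complementary
  orders can see.
\<close>

definition tcong :: "nat \<Rightarrow> ('g \<times> 'g \<Rightarrow> 'k) \<Rightarrow> ('g \<times> 'g \<Rightarrow> 'k) \<Rightarrow> bool"
  where "tcong n F F' \<longleftrightarrow> F \<in> TT n \<and> F' \<in> TT n \<and> F - F' \<in> TT (Suc n)"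

lemma tcong_mult: "tcong k F F' \<Longrightarrow> tcong n H H' \<Longrightarrow> tcong (k + n) (F * H) (F' * H')"
proof -
  assume a: "tcong k F F'" "tcong n H H'"
  have "(F - F') * H + F' * (H - H') \<in> TT (Suc (k + n))"
    using a TT_mult[of "F - F'" "Suc k" H n] TT_mult[of F' k "H - H'" "Suc n"]
    by (intro fa.vs.subspace_add TT_sub) (auto simp: tcong_def)
  then show ?thesis
    using a by (simp add: tcong_def TT_mult algebra_simps)
qed

lemma tcong_mult_power: "tcong k F F' \<Longrightarrow> tcong n H H' \<Longrightarrow> tcong (k + l * n) (F * H ^ l) (F' * H' ^ l)"
proof (induction l)
  case (Suc l)
  have "tcong ((k + l * n) + n) ((F * H ^ l) * H) ((F' * H' ^ l) * H')"
    by (rule tcong_mult[OF Suc.IH[OF Suc.prems] Suc.prems(2)])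
  then show ?case by (simp add: algebra_simps)
qed simp

lemma tcong_val:
  assumes "j \<in> Ix"
  shows "tcong (dg j) (cm (val j)) (tens (val j) e + tens e (val j))"
proof -
  obtain k v where kv: "j = (k, v)" "v \<in> I"
    using assms Y_I by (auto simp: Ix_def)
  have P: "val j \<in> P (dg j)" by (rule val_P[OF assms])
  have "tens (val j) e + tens e (val j) \<in> TT (dg j)"
    using TT_base[OF P, of e 0] TT_base[of e 0 "val j" "dg j"] P e_A by (intro fa.vs.subspace_add TT_sub) auto
  moreover have "cm (val j) - (tens (val j) e + tens e (val j)) \<in> TT (Suc (dg j))"
  proof -
    have "cm (val j) - tens (val j) e - tens e (val j) \<in> tens_span (FI k) (FI k)"
      using cm_frob[OF kv(2), of k] by (simp add: val_def kv)
    also have "\<dots> \<subseteq> tens_span (P (p ^ k)) (P (p ^ k))"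
      by (intro tens_span_mono FI_P)
    also have "\<dots> \<subseteq> TT (p ^ k + p ^ k)"
      by (rule tens_span_TT)
    also have "\<dots> \<subseteq> TT (Suc (dg j))"
      by (intro TT_mono) (simp add: dg_def kv Suc_le_eq)
    finally show ?thesis by (simp add: algebra_simps)
  qed
  ultimately show ?thesis
    using cm_TT[OF P] by (simp add: tcong_def)
qed

lemma tcong_mon:
  "tcong (wt \<alpha>) (cm (mon \<alpha>)) (tens e e * (\<Prod>j\<in>Ix. (tens (val j) e + tens e (val j)) ^ \<alpha> j))"
proof -
  have ee: "tcong 0 (tens e e) (tens e e)"
    using TT_base[of e 0 e 0] e_A fa.vs.subspace_0[OF TT_sub] by (simp add: tcong_def)
  have pw: "cm (f * g ^ l) = cm f * cm g ^ l" for f g l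
  proof (induction l)
    case (Suc l)
    have "cm (f * g ^ Suc l) = cm ((f * g ^ l) * g)" by (simp add: mult_ac)
    also have "\<dots> = cm (f * g ^ l) * cm g" by (rule cm_mult)
    finally show ?case unfolding Suc.IH by (simp add: mult_ac)
  qed simp
  have "tcong (\<Sum>j\<in>S. \<alpha> j * dg j) (cm (e * (\<Prod>j\<in>S. val j ^ \<alpha> j)))
      (tens e e * (\<Prod>j\<in>S. (tens (val j) e + tens e (val j)) ^ \<alpha> j))" if "finite S" "S \<subseteq> Ix" for S
    using that
  proof (induction S rule: finite_induct)
    case empty
    then show ?case using ee by (simp add: cm_simps)
  next
    case (insert j S)
    have "tcong ((\<Sum>j\<in>S. \<alpha> j * dg j) + \<alpha> j * dg j) (cm (e * (\<Prod>j\<in>S. val j ^ \<alpha> j)) * cm (val j) ^ \<alpha> j)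
      ((tens e e * (\<Prod>j\<in>S. (tens (val j) e + tens e (val j)) ^ \<alpha> j)) * (tens (val j) e + tens e (val j)) ^ \<alpha> j)"
      using insert by (intro tcong_mult_power tcong_val) auto
    moreover have "cm (e * (\<Prod>j\<in>insert j S. val j ^ \<alpha> j)) = cm (e * (\<Prod>j\<in>S. val j ^ \<alpha> j)) * cm (val j) ^ \<alpha> j"
      unfolding prod.insert[OF insert.hyps(1,2)] pw[symmetric] by (simp add: mult_ac)
    moreover have "tens e e * (\<Prod>j\<in>insert j S. (tens (val j) e + tens e (val j)) ^ \<alpha> j)
        = (tens e e * (\<Prod>j\<in>S. (tens (val j) e + tens e (val j)) ^ \<alpha> j)) * (tens (val j) e + tens e (val j)) ^ \<alpha> j"
      by (simp add: insert.hyps mult_ac)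
    moreover have "(\<Sum>j\<in>insert j S. \<alpha> j * dg j) = (\<Sum>j\<in>S. \<alpha> j * dg j) + \<alpha> j * dg j"
      by (simp add: insert.hyps)
    ultimately show ?case
      by metis
  qed
  then show ?thesis
    by (simp add: mon_def wt_def)
qed

text \<open>
  The factor \<open>tens e e\<close> and the factor \<open>e\<close> in \<open>mon\<close> take care of empty products, which would otherwise be
  nonzero outside the group.
\<close>

lemma binomial_expansion:
  "tens e e * (\<Prod>j\<in>Ix. (tens (val j) e + tens e (val j)) ^ \<alpha> j)
    = (\<Sum>\<beta>\<in>PiE Ix (\<lambda>j. {..\<alpha> j}). cf (of_nat (\<Prod>j\<in>Ix. \<alpha> j choose \<beta> j)) * tens (mon \<beta>) (mon (\<lambda>j. \<alpha> j - \<beta> j)))"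
  (is "?L = ?R")
proof
  fix z :: "'g \<times> 'g"
  obtain x y where z: "z = (x, y)" by (cases z)
  show "?L z = ?R z"
  proof (cases "x \<in> carrier G \<and> y \<in> carrier G")
    case True
    then have e: "e x = 1" "e y = 1" by (simp_all add: e_apply)
    have "?L z = (\<Prod>j\<in>Ix. (val j x + val j y) ^ \<alpha> j)"
      by (simp add: z e tens_def fun_apply prod_fun_apply power_fun_apply)
    also have "\<dots> = (\<Prod>j\<in>Ix. \<Sum>b\<le>\<alpha> j. of_nat (\<alpha> j choose b) * val j x ^ b * val j y ^ (\<alpha> j - b))"
      by (simp add: binomial_ring)
    also have "\<dots> = (\<Sum>\<beta>\<in>PiE Ix (\<lambda>j. {..\<alpha> j}). \<Prod>j\<in>Ix. of_nat (\<alpha> j choose \<beta> j) * val j x ^ \<beta> j * val j y ^ (\<alpha> j - \<beta> j))"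
      by (rule prod_sum_PiE) auto
    also have "\<dots> = ?R z"
      by (simp add: z e tens_def fun_apply sum_fun_apply prod_fun_apply power_fun_apply mon_def prod.distrib mult.assoc)
    finally show ?thesis .
  next
    case False
    then have "e x = 0 \<or> e y = 0" by (auto simp: e_apply)
    then show ?thesis
      by (auto simp: z tens_def fun_apply sum_fun_apply mon_def)
  qed
qed

text \<open>
  In top order a product of distributions acts on monomials by the Leibniz rule: the generators
  \<open>y ^ (p ^ k)\<close> behave as if they were primitive.
\<close>

lemma dmult_mon:
  assumes "\<epsilon> \<in> V a" "\<epsilon>' \<in> V b" "wt \<alpha> = a + b"
  shows "dmult \<epsilon> \<epsilon>' (mon \<alpha>)
    = (\<Sum>\<beta>\<in>PiE Ix (\<lambda>j. {..\<alpha> j}). of_nat (\<Prod>j\<in>Ix. \<alpha> j choose \<beta> j) * (\<epsilon> (mon \<beta>) * \<epsilon>' (mon (\<lambda>j. \<alpha> j - \<beta> j))))"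
proof -
  note l = V_lin[OF assms(1)] V_lin[OF assms(2)]
  let ?E = "tens e e * (\<Prod>j\<in>Ix. (tens (val j) e + tens e (val j)) ^ \<alpha> j)"
  have c: "cm (mon \<alpha>) \<in> TT (a + b)" "?E \<in> TT (a + b)" "cm (mon \<alpha>) - ?E \<in> TT (Suc (a + b))"
    using tcong_mon[of \<alpha>] assms(3) by (auto simp: tcong_def)
  have "tv \<epsilon> \<epsilon>' (cm (mon \<alpha>)) - tv \<epsilon> \<epsilon>' ?E = 0"
    using tv_kill[OF assms(1,2) c(3)] tv_diff[OF l, of "cm (mon \<alpha>)" ?E] c(1,2) TT_AA by auto
  then have "dmult \<epsilon> \<epsilon>' (mon \<alpha>) = tv \<epsilon> \<epsilon>' ?E"
    by (simp add: dmult_apply mon_A)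
  also have "\<dots> = (\<Sum>\<beta>\<in>PiE Ix (\<lambda>j. {..\<alpha> j}). tv \<epsilon> \<epsilon>' (cf (of_nat (\<Prod>j\<in>Ix. \<alpha> j choose \<beta> j)) * tens (mon \<beta>) (mon (\<lambda>j. \<alpha> j - \<beta> j))))"
    unfolding binomial_expansion
    by (intro tv_sum l fa.vs.subspace_scale tens_span_sub tens_spanI mon_A)
  also have "\<dots> = (\<Sum>\<beta>\<in>PiE Ix (\<lambda>j. {..\<alpha> j}). of_nat (\<Prod>j\<in>Ix. \<alpha> j choose \<beta> j) * (\<epsilon> (mon \<beta>) * \<epsilon>' (mon (\<lambda>j. \<alpha> j - \<beta> j))))"
    by (intro sum.cong refl) (simp add: tv_linear(2)[OF l tens_spanI] tv_tens[OF l] mon_A)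
  finally show ?thesis .
qed

definition \<Omega>n where "\<Omega>n n l = {\<beta> \<in> \<Omega>. wt \<beta> = n \<and> num \<beta> \<le> l}"

text \<open>
  An element of the basis dual to the digit monomials of degree \<open>n\<close> with at most \<open>l\<close> factors.  It exists
  once these are known to be independent modulo \<open>N R n\<close>, and in turn products of such functionals prove
  independence for larger \<open>l\<close> (\<open>indep_Suc\<close>).
\<close>

definition dual where
  "dual \<epsilon> \<alpha> n l \<longleftrightarrow> \<epsilon> \<in> D R n \<and> (\<forall>\<beta>\<in>\<Omega>n n l. \<epsilon> (mon \<beta>) = (if \<beta> = \<alpha> then 1 else 0))"

definition indep where
  "indep l \<longleftrightarrow> (\<forall>n c. 1 \<le> n \<longrightarrow> n \<le> m \<longrightarrow> (\<Sum>\<beta>\<in>\<Omega>n n l. cf (c \<beta>) * mon \<beta>) \<in> N R n \<longrightarrow> (\<forall>\<beta>\<in>\<Omega>n n l. c \<beta> = 0))"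

lemma \<Omega>n_finite: "finite (\<Omega>n n l)"
  using \<Omega>_finite by (simp add: \<Omega>n_def)

lemma dual_exists:
  assumes ind: "indep l" and n: "1 \<le> n" "n \<le> m" and \<alpha>: "\<alpha> \<in> \<Omega>n n l"
  shows "\<exists>\<epsilon>. dual \<epsilon> \<alpha> n l"
proof -
  let ?B = "\<Omega>n n l - {\<alpha>}"
  let ?S = "fa.vs.span (mon ` ?B \<union> fa.vs.span (insert e (N R n)))"
  have mon1: "mon \<beta> \<one> = 0" if "\<beta> \<in> \<Omega>n n l" for \<beta>
  proof -
    have "mon \<beta> \<in> P n" using mon_P[of \<beta>] that by (simp add: \<Omega>n_def)
    then show ?thesis using P_I[of n] n by (auto simp: I_iff)
  qed
  have "mon \<alpha> \<notin> ?S"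
  proof
    assume "mon \<alpha> \<in> ?S"
    then obtain c where c: "mon \<alpha> - (\<Sum>\<beta>\<in>?B. cf (c \<beta>) * mon \<beta>) \<in> fa.vs.span (insert e (N R n))"
      using span_family_modD[of ?B "fa.vs.span (insert e (N R n))" "mon \<alpha>" mon] \<Omega>n_finite by auto
    then obtain k where k: "mon \<alpha> - (\<Sum>\<beta>\<in>?B. cf (c \<beta>) * mon \<beta>) - cf k * e \<in> fa.vs.span (N R n)"
      by (auto simp: fa.vs.span_breakdown_eq)
    then have kN: "mon \<alpha> - (\<Sum>\<beta>\<in>?B. cf (c \<beta>) * mon \<beta>) - cf k * e \<in> N R n"
      using fa.vs.span_minimal[OF order_refl N_sub] by blast
    then have "(mon \<alpha> - (\<Sum>\<beta>\<in>?B. cf (c \<beta>) * mon \<beta>) - cf k * e) \<one> = 0"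
      using N_I[of R n] by (auto simp: I_iff)
    then have "k = 0"
      using mon1 \<alpha> by (simp add: fun_apply sum_fun_apply e_apply)
    then have rel: "mon \<alpha> - (\<Sum>\<beta>\<in>?B. cf (c \<beta>) * mon \<beta>) \<in> N R n"
      using kN by simp
    let ?c = "\<lambda>\<beta>. if \<beta> = \<alpha> then 1 else - c \<beta>"
    have "(\<Sum>\<beta>\<in>\<Omega>n n l. cf (?c \<beta>) * mon \<beta>) = mon \<alpha> + (\<Sum>\<beta>\<in>?B. cf (?c \<beta>) * mon \<beta>)"
      using \<Omega>n_finite \<alpha> by (simp add: sum.remove[of _ \<alpha>])
    also have "(\<Sum>\<beta>\<in>?B. cf (?c \<beta>) * mon \<beta>) = (\<Sum>\<beta>\<in>?B. - (cf (c \<beta>) * mon \<beta>))"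
      by (intro sum.cong refl) (auto simp: fun_eq_iff fun_apply)
    finally have "(\<Sum>\<beta>\<in>\<Omega>n n l. cf (?c \<beta>) * mon \<beta>) \<in> N R n"
      using rel by (simp add: sum_negf)
    then have "?c \<alpha> = 0"
      using ind[unfolded indep_def, rule_format, of n ?c \<alpha>] n \<alpha> by blast
    then show False by simp
  qed
  then obtain \<phi> where \<phi>: "\<And>f g. \<phi> (f + g) = \<phi> f + \<phi> g" "\<And>c f. \<phi> (cf c * f) = c * \<phi> f"
    "\<And>f. f \<in> ?S \<Longrightarrow> \<phi> f = 0" "\<phi> (mon \<alpha>) = 1"
    using separating_functional[OF fa.vs.subspace_span] by blast
  define \<epsilon> where "\<epsilon> f = (if f \<in> A then \<phi> f else 0)" for f
  have "lin \<epsilon>"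
    using A_add fa.vs.subspace_scale[OF A_sub] by (auto simp: lin_def \<epsilon>_def \<phi>)
  moreover have zero: "\<epsilon> f = 0" if "f \<in> ?S" for f
    using \<phi>(3)[OF that] by (simp add: \<epsilon>_def)
  moreover have "f \<in> ?S" if "f \<in> N R n \<or> f = e" for f
    using that by (intro fa.vs.span_base UnI2) (auto intro: fa.vs.span_base)
  moreover have "\<epsilon> (mon \<beta>) = (if \<beta> = \<alpha> then 1 else 0)" if "\<beta> \<in> \<Omega>n n l" for \<beta>
  proof (cases "\<beta> = \<alpha>")
    case True
    then show ?thesis using \<phi>(4) mon_A by (simp add: \<epsilon>_def)
  next
    case False
    then have "mon \<beta> \<in> ?S"
      using that by (intro fa.vs.span_base) auto
    then show ?thesis using zero False by simp
  qed
  ultimately have "dual \<epsilon> \<alpha> n l"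
    unfolding dual_def D_iff by blast
  then show ?thesis by blast
qed

lemma unit_\<Omega>n: "j \<in> Ix \<Longrightarrow> 1 \<le> l \<Longrightarrow> unit j \<in> \<Omega>n (dg j) l"
  using p_gt_1 by (auto simp: \<Omega>n_def \<Omega>_def wt_unit num_unit) (auto simp: unit_def)

text \<open>
  Of the terms in \<open>dmult_mon\<close> at most the one with \<open>\<beta> = unit j\<close> survives, and its coefficient
  \<open>\<alpha> j choose 1\<close> is the digit \<open>\<alpha> j\<close>.  That both factors have at least one letter bounds the number of
  letters of each by \<open>l\<close>, where the values of the dual functionals are known.
\<close>

lemma product_of_duals:
  assumes \<alpha>: "\<alpha> \<in> \<Omega>" "wt \<alpha> = n" and j: "j \<in> Ix" "\<alpha> j > 0" and n: "dg j < n"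
    and \<epsilon>: "dual \<epsilon> (unit j) (dg j) l" and \<epsilon>': "dual \<epsilon>' (\<lambda>i\<in>Ix. \<alpha> i - unit j i) (n - dg j) l"
    and \<alpha>': "\<alpha>' \<in> \<Omega>n n (Suc l)"
  shows "dmult \<epsilon> \<epsilon>' (mon \<alpha>') = (if \<alpha>' = \<alpha> then of_nat (\<alpha> j) else 0)"
proof -
  have V: "\<epsilon> \<in> V (dg j)" "\<epsilon>' \<in> V (n - dg j)"
    using \<epsilon> \<epsilon>' D_V by (auto simp: dual_def)
  have \<alpha>'\<Omega>: "\<alpha>' \<in> \<Omega>" "wt \<alpha>' = n" "num \<alpha>' \<le> Suc l"
    using \<alpha>' by (auto simp: \<Omega>n_def)
  let ?t = "\<lambda>\<beta>. of_nat (\<Prod>i\<in>Ix. \<alpha>' i choose \<beta> i) * (\<epsilon> (mon \<beta>) * \<epsilon>' (mon (\<lambda>i. \<alpha>' i - \<beta> i)))"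
  have eq: "dmult \<epsilon> \<epsilon>' (mon \<alpha>') = (\<Sum>\<beta>\<in>PiE Ix (\<lambda>i. {..\<alpha>' i}). ?t \<beta>)"
    using n \<alpha>'\<Omega> by (intro dmult_mon[OF V]) simp
  have split: "\<beta> = unit j \<and> \<alpha>' = \<alpha>"
    if \<beta>: "\<beta> \<in> PiE Ix (\<lambda>i. {..\<alpha>' i})" and nz: "\<epsilon> (mon \<beta>) * \<epsilon>' (mon (\<lambda>i. \<alpha>' i - \<beta> i)) \<noteq> 0" for \<beta>
  proof -
    let ?\<delta> = "\<lambda>i. \<alpha>' i - \<beta> i"
    have le: "\<beta> i \<le> \<alpha>' i" if "i \<in> Ix" for i
      using \<beta> that by auto
    have wt: "wt \<beta> + wt ?\<delta> = n" and num: "num \<beta> + num ?\<delta> \<le> Suc l"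
      using wt_add[of \<beta> ?\<delta>] num_add[of \<beta> ?\<delta>] le \<alpha>'\<Omega>
        wt_cong[of "\<lambda>i. \<beta> i + ?\<delta> i" \<alpha>'] num_cong[of "\<lambda>i. \<beta> i + ?\<delta> i" \<alpha>'] by auto
    have "wt \<beta> \<le> dg j" "wt ?\<delta> \<le> n - dg j"
      using nz V_kill[OF V(1) _ mon_P, of \<beta>] V_kill[OF V(2) _ mon_P, of ?\<delta>] by force+
    then have w: "wt \<beta> = dg j" "wt ?\<delta> = n - dg j"
      using wt n by auto
    then have "num \<beta> > 0" "num ?\<delta> > 0"
      using wt_zero[of \<beta>] wt_zero[of ?\<delta>] n dg_pos[of j] by (auto intro!: Nat.gr0I)
    then have nm: "num \<beta> \<le> l" "num ?\<delta> \<le> l"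
      using num by auto
    have lt: "\<alpha>' i < p" if "i \<in> Ix" for i
      using \<alpha>'\<Omega>(1) that by (auto simp: \<Omega>_def)
    have "\<beta> \<in> \<Omega>"
      unfolding \<Omega>_def
    proof (rule PiE_I)
      show "\<beta> i \<in> {..<p}" if "i \<in> Ix" for i using le[OF that] lt[OF that] by simp
      show "\<beta> i = undefined" if "i \<notin> Ix" for i using \<beta> that by (rule PiE_arb)
    qed
    then have b1: "\<beta> \<in> \<Omega>n (dg j) l"
      using w nm by (simp add: \<Omega>n_def)
    have "restrict ?\<delta> Ix \<in> \<Omega>"
      unfolding \<Omega>_def using lt by (auto intro: le_less_trans[OF diff_le_self])
    then have b2: "restrict ?\<delta> Ix \<in> \<Omega>n (n - dg j) l"
      using w nm by (simp add: \<Omega>n_def del: restrict_apply)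
    have "\<epsilon> (mon \<beta>) = (if \<beta> = unit j then 1 else 0)"
      using \<epsilon> b1 by (auto simp: dual_def)
    moreover have "\<epsilon>' (mon (restrict ?\<delta> Ix)) = (if restrict ?\<delta> Ix = (\<lambda>i\<in>Ix. \<alpha> i - unit j i) then 1 else 0)"
      using bspec[OF conjunct2[OF \<epsilon>'[unfolded dual_def]] b2] .
    ultimately have bu: "\<beta> = unit j" and d: "restrict ?\<delta> Ix = (\<lambda>i\<in>Ix. \<alpha> i - unit j i)"
      using nz unfolding restrict_simps by (auto split: if_splits simp del: restrict_apply)
    have "\<alpha>' i = \<alpha> i" if "i \<in> Ix" for i
    proof -
      have "\<alpha>' i - unit j i = \<alpha> i - unit j i"
        using fun_cong[OF d, of i] that bu by simp
      moreover have "unit j i \<le> \<alpha>' i" using le[OF that] bu by simp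
      moreover have "unit j i \<le> \<alpha> i" using j that by (auto simp: unit_def)
      ultimately show ?thesis by linarith
    qed
    then have "\<alpha>' = \<alpha>"
      using \<alpha>'\<Omega>(1) \<alpha>(1) unfolding \<Omega>_def by (auto intro: PiE_ext)
    then show ?thesis using bu by simp
  qed
  show ?thesis
  proof (cases "\<alpha>' = \<alpha>")
    case False
    then have "?t \<beta> = 0" if "\<beta> \<in> PiE Ix (\<lambda>i. {..\<alpha>' i})" for \<beta>
      using split[OF that] by auto
    then show ?thesis using False unfolding eq by (simp add: sum.neutral)
  next
    case True
    have u: "unit j \<in> PiE Ix (\<lambda>i. {..\<alpha>' i})"
      using True j by (auto simp: unit_def)
    have "(\<Sum>\<beta>\<in>PiE Ix (\<lambda>i. {..\<alpha>' i}). ?t \<beta>) = (\<Sum>\<beta>\<in>{unit j}. ?t \<beta>)"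
    proof (rule sum.mono_neutral_right)
      show "\<forall>\<beta>\<in>PiE Ix (\<lambda>i. {..\<alpha>' i}) - {unit j}. ?t \<beta> = 0"
        using split by auto
    qed (use u in \<open>auto intro: finite_PiE\<close>)
    moreover have "\<epsilon> (mon (unit j)) = 1"
    proof -
      have "unit j \<in> \<Omega>n (dg j) l \<or> l = 0"
        using unit_\<Omega>n[OF j(1), of l] by (cases l) auto
      moreover have "l \<noteq> 0"
      proof
        assume "l = 0"
        then have "num \<alpha> \<le> 1" using \<alpha>'\<Omega> True by simp
        then have "num (\<lambda>i. \<alpha> i - unit j i) = 0"
          using num_add[of "unit j" "\<lambda>i. \<alpha> i - unit j i"] num_cong[of "\<lambda>i. unit j i + (\<alpha> i - unit j i)" \<alpha>] j num_unit[OF j(1)]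
          by (auto simp: unit_def split: if_splits)
        then have "wt (\<lambda>i. \<alpha> i - unit j i) = 0"
          by (rule wt_zero)
        then show False
          using wt_add[of "unit j" "\<lambda>i. \<alpha> i - unit j i"] wt_cong[of "\<lambda>i. unit j i + (\<alpha> i - unit j i)" \<alpha>] j wt_unit[OF j(1)] n \<alpha>(2)
          by (auto simp: unit_def split: if_splits)
      qed
      ultimately show ?thesis using \<epsilon> by (auto simp: dual_def)
    qed
    moreover have "\<epsilon>' (mon (\<lambda>i. \<alpha>' i - unit j i)) = 1"
    proof -
      let ?\<gamma> = "\<lambda>i\<in>Ix. \<alpha> i - unit j i"
      have le: "unit j i \<le> \<alpha> i" if "i \<in> Ix" for i
        using j that by (auto simp: unit_def)
      have "wt ?\<gamma> + dg j = n" "num ?\<gamma> + 1 \<le> Suc l"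
        using wt_add[of "unit j" "\<lambda>i. \<alpha> i - unit j i"] wt_cong[of "\<lambda>i. unit j i + (\<alpha> i - unit j i)" \<alpha>] le wt_unit[OF j(1)] \<alpha>(2)
          num_add[of "unit j" "\<lambda>i. \<alpha> i - unit j i"] num_cong[of "\<lambda>i. unit j i + (\<alpha> i - unit j i)" \<alpha>] num_unit[OF j(1)] \<alpha>'\<Omega>(3) True
        by (auto simp del: restrict_apply)
      moreover have "?\<gamma> \<in> \<Omega>"
        using \<alpha>(1) unfolding \<Omega>_def by (auto intro: le_less_trans[OF diff_le_self])
      ultimately have "?\<gamma> \<in> \<Omega>n (n - dg j) l"
        by (auto simp: \<Omega>n_def simp del: restrict_apply restrict_simps)
      from bspec[OF conjunct2[OF \<epsilon>'[unfolded dual_def]] this]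
      show ?thesis
        unfolding True by (simp only: restrict_simps if_True simp_thms)
    qed
    moreover have "(\<Prod>i\<in>Ix. \<alpha>' i choose unit j i) = (\<Prod>i\<in>Ix. if i = j then \<alpha> i else 1)"
      by (intro prod.cong) (auto simp: unit_def True)
    ultimately show ?thesis
      using j True unfolding eq by (simp del: of_nat_prod)
  qed
qed

lemma of_nat_exponent_nonzero: "0 < k \<Longrightarrow> k < p \<Longrightarrow> (of_nat k :: 'k) \<noteq> 0"
  using char_p by (auto simp: of_nat_eq_0_iff_char_dvd dest: dvd_imp_le)

lemma split_off_letter:
  assumes \<alpha>: "\<alpha> \<in> \<Omega>n n (Suc l)" and n: "n \<le> m" and two: "num \<alpha> \<ge> 2" and ind: "indep l" and l: "1 \<le> l"
  obtains j \<epsilon> \<epsilon>' where "j \<in> Ix" "\<alpha> j > 0" "\<alpha> j < p" "dg j < n" "\<epsilon> \<in> D R (dg j)" "\<epsilon>' \<in> D R (n - dg j)"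
    "\<And>\<alpha>'. \<alpha>' \<in> \<Omega>n n (Suc l) \<Longrightarrow> dmult \<epsilon> \<epsilon>' (mon \<alpha>') = (if \<alpha>' = \<alpha> then of_nat (\<alpha> j) else 0)"
proof -
  have \<alpha>': "\<alpha> \<in> \<Omega>" "wt \<alpha> = n" "num \<alpha> \<le> Suc l"
    using \<alpha> by (auto simp: \<Omega>n_def)
  obtain j where j: "j \<in> Ix" "\<alpha> j > 0"
    using two unfolding num_def by (metis (no_types, lifting) gr_zeroI not_numeral_le_zero sum.neutral)
  let ?\<gamma> = "\<lambda>i\<in>Ix. \<alpha> i - unit j i"
  have le: "unit j i \<le> \<alpha> i" if "i \<in> Ix" for i
    using j that by (auto simp: unit_def)
  have w: "wt ?\<gamma> + dg j = n" "num ?\<gamma> + 1 = num \<alpha>"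
    using wt_add[of "unit j" "\<lambda>i. \<alpha> i - unit j i"] wt_cong[of "\<lambda>i. unit j i + (\<alpha> i - unit j i)" \<alpha>] le wt_unit[OF j(1)] \<alpha>'(2)
      num_add[of "unit j" "\<lambda>i. \<alpha> i - unit j i"] num_cong[of "\<lambda>i. unit j i + (\<alpha> i - unit j i)" \<alpha>] num_unit[OF j(1)]
    by (auto simp del: restrict_apply)
  have "wt ?\<gamma> > 0"
    using num_le_wt[of ?\<gamma>] w(2) two by linarith
  then have dn: "dg j < n" using w by linarith
  have "?\<gamma> \<in> \<Omega>"
    using \<alpha>'(1) unfolding \<Omega>_def by (auto intro: le_less_trans[OF diff_le_self])
  then have g: "?\<gamma> \<in> \<Omega>n (n - dg j) l"
    using w \<alpha>'(3) by (auto simp: \<Omega>n_def simp del: restrict_apply restrict_simps)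
  obtain \<epsilon> where \<epsilon>: "dual \<epsilon> (unit j) (dg j) l"
    using dual_exists[OF ind _ _ unit_\<Omega>n[OF j(1) l]] dg_pos[of j] dn n by (metis Suc_leI One_nat_def less_imp_le order_trans)
  obtain \<epsilon>' where \<epsilon>': "dual \<epsilon>' ?\<gamma> (n - dg j) l"
    using dual_exists[OF ind _ _ g] dn n by fastforce
  have "\<alpha> j < p" using \<alpha>'(1) j(1) by (auto simp: \<Omega>_def)
  then show ?thesis
    using \<epsilon> \<epsilon>' by (intro that[OF j _ dn, of \<epsilon> \<epsilon>'] product_of_duals[OF \<alpha>'(1,2) j dn]) (auto simp: dual_def)
qed

text \<open>
  Monomials with one factor have degree \<open>p ^ k\<close> and are the chosen \<open>y ^ (p ^ k)\<close>, independent by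
  construction.
\<close>

lemma indep_1: "indep 1"
  unfolding indep_def
proof (intro allI impI)
  fix n c
  assume n: "1 \<le> n" "n \<le> m" and rel: "(\<Sum>\<beta>\<in>\<Omega>n n 1. cf (c \<beta>) * mon \<beta>) \<in> N R n"
  have single: "\<exists>j\<in>Ix. \<beta> = unit j \<and> dg j = n" if "\<beta> \<in> \<Omega>n n 1" for \<beta>
  proof -
    have b: "\<beta> \<in> \<Omega>" "wt \<beta> = n" "num \<beta> \<le> 1" using that by (auto simp: \<Omega>n_def)
    then have "num \<beta> = 1" using wt_zero[of \<beta>] n by (cases "num \<beta>") auto
    then obtain j where j: "j \<in> Ix" "\<beta> j = 1" "\<And>i. i \<in> Ix \<Longrightarrow> i \<noteq> j \<Longrightarrow> \<beta> i = 0"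
      using sum_eq_1_iff[OF Ix_finite, of \<beta>] unfolding num_def by metis
    have "\<beta> = unit j"
      using b(1) j by (intro extensionalityI[of _ Ix]) (auto simp: \<Omega>_def unit_def PiE_def)
    then show ?thesis using j(1) b(2) wt_unit by auto
  qed
  show "\<forall>\<beta>\<in>\<Omega>n n 1. c \<beta> = 0"
  proof (cases "\<Omega>n n 1 = {}")
    case False
    then obtain k v where kv: "(k, v) \<in> Ix" "n = p ^ k"
      using single by (force simp: dg_def)
    have km: "k \<le> m" using kv by (auto simp: Ix_def)
    have "\<Omega>n n 1 = (\<lambda>y. unit (k, y)) ` Y k"
    proof (intro equalityI subsetI)
      fix \<beta> assume "\<beta> \<in> \<Omega>n n 1"
      then obtain k' y where "(k', y) \<in> Ix" "\<beta> = unit (k', y)" "p ^ k' = n"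
        using single by (force simp: dg_def)
      moreover then have "k' = k" using kv p_gt_1 by simp
      ultimately show "\<beta> \<in> (\<lambda>y. unit (k, y)) ` Y k" by (auto simp: Ix_def)
    next
      fix \<beta> assume "\<beta> \<in> (\<lambda>y. unit (k, y)) ` Y k"
      then show "\<beta> \<in> \<Omega>n n 1"
        using unit_\<Omega>n[of "(k, _)" 1] km kv(2) by (auto simp: Ix_def dg_def)
    qed
    moreover have "inj_on (\<lambda>y. unit (k, y)) (Y k)"
    proof (rule inj_onI)
      fix x y assume xy: "x \<in> Y k" "y \<in> Y k" "unit (k, x) = unit (k, y)"
      have kx: "(k, x) \<in> Ix" using xy(1) km by (simp add: Ix_def)
      then have "unit (k, x) (k, x) = 1" by (simp add: unit_def)
      then have "unit (k, y) (k, x) = 1" by (simp only: xy(3))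
      then show "x = y" using kx by (simp add: unit_def split: if_splits)
    qed
    moreover have "mon (unit (k, y)) = y ^ (p ^ k)" if "y \<in> Y k" for y
      using that km by (subst mon_unit) (auto simp: Ix_def val_def)
    ultimately have "(\<Sum>y\<in>Y k. cf (c (unit (k, y))) * y ^ (p ^ k)) \<in> N R (p ^ k)"
      using rel kv(2) by (simp add: sum.reindex)
    from Y_indep[OF this] show ?thesis
      using \<open>\<Omega>n n 1 = (\<lambda>y. unit (k, y)) ` Y k\<close> by auto
  qed simp
qed

text \<open>
  Apply to a relation the product of dual functionals attached to a monomial \<open>\<alpha>\<close> with \<open>Suc l\<close> factors.
  It kills \<open>N R n\<close> and every other monomial, and its value at \<open>\<alpha>\<close> is a digit and so invertible; hence the
  coefficient of \<open>\<alpha>\<close> vanishes.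
\<close>

lemma indep_Suc: "1 \<le> l \<Longrightarrow> indep l \<Longrightarrow> indep (Suc l)"
proof -
  assume l: "1 \<le> l" and ind: "indep l"
  show "indep (Suc l)"
    unfolding indep_def
  proof (intro allI impI)
    fix n c
    assume n: "1 \<le> n" "n \<le> m" and rel: "(\<Sum>\<beta>\<in>\<Omega>n n (Suc l). cf (c \<beta>) * mon \<beta>) \<in> N R n"
    have top: "c \<alpha> = 0" if \<alpha>: "\<alpha> \<in> \<Omega>n n (Suc l)" "\<alpha> \<notin> \<Omega>n n l" for \<alpha>
    proof -
      have "num \<alpha> \<ge> 2" using \<alpha> l by (auto simp: \<Omega>n_def)
      then obtain j \<epsilon> \<epsilon>' where j: "j \<in> Ix" "\<alpha> j > 0" "\<alpha> j < p" "dg j < n" "\<epsilon> \<in> D R (dg j)" "\<epsilon>' \<in> D R (n - dg j)"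
        "\<And>\<alpha>'. \<alpha>' \<in> \<Omega>n n (Suc l) \<Longrightarrow> dmult \<epsilon> \<epsilon>' (mon \<alpha>') = (if \<alpha>' = \<alpha> then of_nat (\<alpha> j) else 0)"
        using split_off_letter[OF \<alpha>(1) n(2) _ ind l] by blast
      have D: "dmult \<epsilon> \<epsilon>' \<in> D R n"
        using dmult_D[OF j(5,6)] j(4) by simp
      then have lin: "lin (dmult \<epsilon> \<epsilon>')" by (simp add: D_iff)
      have lin_sum: "dmult \<epsilon> \<epsilon>' (\<Sum>\<beta>\<in>S. cf (c \<beta>) * mon \<beta>) = (\<Sum>\<beta>\<in>S. c \<beta> * dmult \<epsilon> \<epsilon>' (mon \<beta>))" for S
        using fa.vs.subspace_scale[OF A_sub mon_A]
        by (induction S rule: infinite_finite_induct)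
          (auto simp: lin_zero[OF lin] lin_add[OF lin] lin_scale[OF lin] mon_A fa.vs.subspace_sum[OF A_sub])
      have "0 = (\<Sum>\<beta>\<in>\<Omega>n n (Suc l). c \<beta> * dmult \<epsilon> \<epsilon>' (mon \<beta>))"
        using D rel by (simp add: D_iff lin_sum[symmetric])
      also have "\<dots> = (\<Sum>\<beta>\<in>\<Omega>n n (Suc l). if \<beta> = \<alpha> then c \<beta> * of_nat (\<alpha> j) else 0)"
        by (intro sum.cong refl) (simp add: j(7))
      also have "\<dots> = c \<alpha> * of_nat (\<alpha> j)"
        using \<alpha>(1) \<Omega>n_finite by simp
      finally show ?thesis
        using of_nat_exponent_nonzero[OF j(2,3)] by simp
    qed
    have "(\<Sum>\<beta>\<in>\<Omega>n n (Suc l). cf (c \<beta>) * mon \<beta>) = (\<Sum>\<beta>\<in>\<Omega>n n l. cf (c \<beta>) * mon \<beta>)"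
      by (intro sum.mono_neutral_right \<Omega>n_finite) (auto simp: top, auto simp: \<Omega>n_def)
    then have "\<forall>\<beta>\<in>\<Omega>n n l. c \<beta> = 0"
      using ind rel n by (simp add: indep_def)
    then show "\<forall>\<beta>\<in>\<Omega>n n (Suc l). c \<beta> = 0"
      using top by blast
  qed
qed

lemma indep_all: "1 \<le> l \<Longrightarrow> indep l"
  by (induction l rule: dec_induct) (use indep_1 indep_Suc in auto)

text \<open>
  Subtract from \<open>\<mu>\<close> a combination \<open>\<nu>\<close> of products with the same values on all digit monomials of degree
  \<open>m\<close> that have at least two factors.  Digit monomials with one factor have degree \<open>p ^ k\<close>, so that they
  occur only for \<open>k \<ge> R\<close>, where they lie in \<open>J R\<close> and are killed anyway.  Thus \<open>\<mu> - \<nu>\<close> kills \<open>P m\<close>.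
\<close>

lemma decomposition:
  assumes \<mu>: "\<mu> \<in> D R m" and m: "1 \<le> m" and not_small: "\<And>k. m = p ^ k \<Longrightarrow> R \<le> k"
  shows "\<mu> \<in> fa.vs.span ({dmult \<alpha> \<beta> | \<alpha> \<beta> a b. \<alpha> \<in> D R a \<and> \<beta> \<in> D R b \<and> 1 \<le> a \<and> 1 \<le> b \<and> a + b = m} \<union> D R (m - 1))"
    (is "_ \<in> fa.vs.span (?X \<union> _)")
proof -
  let ?T = "{\<alpha> \<in> \<Omega>n m (Suc m). num \<alpha> \<ge> 2}"
  have "\<exists>\<theta>. \<theta> \<in> fa.vs.span ?X \<and> \<theta> \<in> D R m \<and> (\<forall>\<alpha>'\<in>\<Omega>n m (Suc m). \<theta> (mon \<alpha>') = (if \<alpha>' = \<alpha> then 1 else 0))"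
    if \<alpha>T: "\<alpha> \<in> ?T" for \<alpha>
  proof -
    obtain j \<epsilon> \<epsilon>' where j: "j \<in> Ix" "\<alpha> j > 0" "\<alpha> j < p" "dg j < m" "\<epsilon> \<in> D R (dg j)" "\<epsilon>' \<in> D R (m - dg j)"
      "\<And>\<alpha>'. \<alpha>' \<in> \<Omega>n m (Suc m) \<Longrightarrow> dmult \<epsilon> \<epsilon>' (mon \<alpha>') = (if \<alpha>' = \<alpha> then of_nat (\<alpha> j) else 0)"
    proof -
      have "\<alpha> \<in> \<Omega>n m (Suc m)" "num \<alpha> \<ge> 2" using \<alpha>T by auto
      from split_off_letter[OF this(1) order_refl this(2) indep_all[OF m] m] show ?thesis
        using that by blast
    qed
    have "dmult \<epsilon> \<epsilon>' \<in> ?X"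
      using j(4-6) dg_pos[of j] by (rule_tac CollectI, rule_tac exI[of _ \<epsilon>], rule_tac exI[of _ \<epsilon>'], rule_tac exI[of _ "dg j"], rule_tac exI[of _ "m - dg j"])
        (simp add: Suc_le_eq)
    note X = this
    have DD: "dmult \<epsilon> \<epsilon>' \<in> D R m"
      using dmult_D[OF j(5,6)] j(4) by simp
    have "cf (inverse (of_nat (\<alpha> j))) * dmult \<epsilon> \<epsilon>' \<in> fa.vs.span ?X"
      "cf (inverse (of_nat (\<alpha> j))) * dmult \<epsilon> \<epsilon>' \<in> D R m"
      by (rule fa.vs.span_scale[OF fa.vs.span_base[OF X]], rule fa.vs.subspace_scale[OF D_sub DD])
    moreover have "\<forall>\<alpha>'\<in>\<Omega>n m (Suc m). (cf (inverse (of_nat (\<alpha> j))) * dmult \<epsilon> \<epsilon>') (mon \<alpha>') = (if \<alpha>' = \<alpha> then 1 else 0)"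
      using of_nat_exponent_nonzero[OF j(2,3)] by (simp add: fun_apply j(7))
    ultimately show ?thesis
      by blast
  qed
  then have "\<forall>\<alpha>\<in>?T. \<exists>\<theta>. \<theta> \<in> fa.vs.span ?X \<and> \<theta> \<in> D R m \<and> (\<forall>\<alpha>'\<in>\<Omega>n m (Suc m). \<theta> (mon \<alpha>') = (if \<alpha>' = \<alpha> then 1 else 0))"
    by (intro ballI)
  from bchoice[OF this] obtain \<theta> where all: "\<forall>\<alpha>\<in>?T. \<theta> \<alpha> \<in> fa.vs.span ?X \<and> \<theta> \<alpha> \<in> D R m \<and> (\<forall>\<alpha>'\<in>\<Omega>n m (Suc m). \<theta> \<alpha> (mon \<alpha>') = (if \<alpha>' = \<alpha> then 1 else 0))"
    by (elim exE)
  have \<theta>: "\<theta> \<alpha> \<in> fa.vs.span ?X" "\<theta> \<alpha> \<in> D R m"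
    "\<alpha>' \<in> \<Omega>n m (Suc m) \<Longrightarrow> \<theta> \<alpha> (mon \<alpha>') = (if \<alpha>' = \<alpha> then 1 else 0)" if "\<alpha> \<in> ?T" for \<alpha> \<alpha>'
    by (rule conjunct1[OF bspec[OF all that]], rule conjunct1[OF conjunct2[OF bspec[OF all that]]],
        erule bspec[OF conjunct2[OF conjunct2[OF bspec[OF all that]]]])
  define \<nu> where "\<nu> = (\<Sum>\<alpha>\<in>?T. cf (\<mu> (mon \<alpha>)) * \<theta> \<alpha>)"
  have T_fin: "finite ?T" using \<Omega>n_finite by simp
  have \<nu>X: "\<nu> \<in> fa.vs.span ?X"
    unfolding \<nu>_def by (intro fa.vs.span_sum fa.vs.span_scale \<theta>(1))
  have D: "\<mu> - \<nu> \<in> D R m"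
    unfolding \<nu>_def by (intro fa.vs.subspace_diff[OF D_sub \<mu> fa.vs.subspace_sum[OF D_sub]] fa.vs.subspace_scale[OF D_sub] \<theta>(2))
  then have lin: "lin (\<mu> - \<nu>)" and killN: "\<And>f. f \<in> N R m \<Longrightarrow> (\<mu> - \<nu>) f = 0"
    by (auto simp: D_iff)
  have "(\<mu> - \<nu>) (mon \<alpha>) = 0" if \<alpha>: "\<alpha> \<in> \<Omega>" "wt \<alpha> = m" for \<alpha>
  proof (cases "num \<alpha> \<ge> 2")
    case True
    then have "\<alpha> \<in> ?T" and \<alpha>n: "\<alpha> \<in> \<Omega>n m (Suc m)" using \<alpha> num_le_wt[of \<alpha>] by (auto simp: \<Omega>n_def)
    have "\<nu> (mon \<alpha>) = (\<Sum>\<beta>\<in>?T. \<mu> (mon \<beta>) * \<theta> \<beta> (mon \<alpha>))"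
      by (simp add: \<nu>_def sum_fun_apply fun_apply)
    also have "\<dots> = (\<Sum>\<beta>\<in>?T. if \<beta> = \<alpha> then \<mu> (mon \<beta>) else 0)"
      by (intro sum.cong refl) (simp add: \<theta>(3)[OF _ \<alpha>n])
    also have "\<dots> = \<mu> (mon \<alpha>)"
      using T_fin \<open>\<alpha> \<in> ?T\<close> by simp
    finally show ?thesis by (simp add: fun_apply)
  next
    case False
    then have "num \<alpha> = 1" using wt_zero[of \<alpha>] \<alpha>(2) m by (cases "num \<alpha>") auto
    then obtain j where j: "j \<in> Ix" "\<alpha> j = 1" "\<And>i. i \<in> Ix \<Longrightarrow> i \<noteq> j \<Longrightarrow> \<alpha> i = 0"
      using sum_eq_1_iff[OF Ix_finite, of \<alpha>] unfolding num_def by metis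
    have "\<alpha> i = unit j i" if "i \<in> Ix" for i
      using j that by (auto simp: unit_def)
    then have "mon \<alpha> = val j" "dg j = m"
      using mon_cong[of \<alpha> "unit j"] wt_cong[of \<alpha> "unit j"] mon_unit[OF j(1)] wt_unit[OF j(1)] \<alpha>(2) by auto
    moreover obtain k v where "j = (k, v)" "v \<in> I"
      using j(1) Y_I by (auto simp: Ix_def)
    ultimately have "mon \<alpha> \<in> J R"
      using J_frob[of v R k] not_small[of k] by (simp add: val_def dg_def)
    then show ?thesis
      using D by (simp add: D_def)
  qed
  then have "(\<mu> - \<nu>) f = 0" if "f \<in> W m" for f
    by (intro lin_vanish_span[OF lin _ _ that[unfolded W_def]]) (use mon_A N_A killN in auto)
  then have "\<mu> - \<nu> \<in> D R (m - 1)"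
    using D P_W[of m] m by (auto simp: D_def V_iff)
  then have "\<nu> + (\<mu> - \<nu>) \<in> fa.vs.span (?X \<union> D R (m - 1))"
    using \<nu>X fa.vs.span_mono[of ?X "?X \<union> D R (m - 1)"] by (intro fa.vs.span_add) (auto intro: fa.vs.span_base)
  then show ?thesis by simp
qed

end

lemma (in affine_algebraic_group_char_p) D_decomposition:
  assumes "\<mu> \<in> D R m" "1 \<le> m" "\<And>k. m = p ^ k \<Longrightarrow> R \<le> k"
  shows "\<mu> \<in> fa.vs.span ({dmult \<alpha> \<beta> | \<alpha> \<beta> a b. \<alpha> \<in> D R a \<and> \<beta> \<in> D R b \<and> 1 \<le> a \<and> 1 \<le> b \<and> a + b = m} \<union> D R (m - 1))"
proof -
  have "\<forall>k. \<exists>Y. finite Y \<and> Y \<subseteq> I \<and> (\<forall>v\<in>I. v ^ (p ^ k) \<in> fa.vs.span ((\<lambda>y. y ^ (p ^ k)) ` Y \<union> N R (p ^ k))) \<and>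
    (\<forall>c. (\<Sum>y\<in>Y. cf (c y) * y ^ (p ^ k)) \<in> N R (p ^ k) \<longrightarrow> (\<forall>y\<in>Y. c y = 0))"
    using frob_generators by blast
  then obtain Y where Y: "\<forall>k. finite (Y k) \<and> Y k \<subseteq> I \<and> (\<forall>v\<in>I. v ^ (p ^ k) \<in> fa.vs.span ((\<lambda>y. y ^ (p ^ k)) ` Y k \<union> N R (p ^ k))) \<and>
    (\<forall>c. (\<Sum>y\<in>Y k. cf (c y) * y ^ (p ^ k)) \<in> N R (p ^ k) \<longrightarrow> (\<forall>y\<in>Y k. c y = 0))"
    by (rule choice[THEN exE]) blast
  interpret frobenius_basis G A p R m Y
    by unfold_locales (use Y in blast)+
  show ?thesis
    using decomposition assms by blast
qed

section \<open>The p-th power of a distribution\<close>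

text \<open>
  The \<open>k\<close>-fold convolution power is a sum over ordered partitions of \<open>S\<close> into \<open>k\<close> blocks of size \<open>n\<close>.
  Group these by the block containing \<open>a\<close>: it can stand in any of \<open>k\<close> positions, all of them with the same
  contribution.
\<close>

lemma convolution_power_marked:
  fixes x :: "nat set \<Rightarrow> 'k::field" and X :: "nat \<Rightarrow> nat set \<Rightarrow> 'k"
  assumes rec: "\<And>k S. finite S \<Longrightarrow> card S = Suc k * n \<Longrightarrow>
      X (Suc k) S = (\<Sum>T | T \<subseteq> S \<and> card T = n. x T * X k (S - T))"
    and S: "finite S" "card S = k * n" "a \<in> S"
  shows "X k S = of_nat k * (\<Sum>T | T \<subseteq> S \<and> card T = n \<and> a \<in> T. x T * X (k - 1) (S - T))"
  using S
proof (induction k arbitrary: S)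
  case 0
  then show ?case by auto
next
  case (Suc k)
  let ?sub = "\<lambda>S. {T. T \<subseteq> S \<and> card T = n}"
  let ?in = "\<lambda>S. {T. T \<subseteq> S \<and> card T = n \<and> a \<in> T}"
  let ?out = "{T. T \<subseteq> S \<and> card T = n \<and> a \<notin> T}"
  have fin: "finite (?sub U)" "finite (?in U)" if "finite U" for U
    using that by (auto intro: finite_subset[of _ "Pow U"])
  have fin_out: "finite ?out"
    using Suc.prems by (auto intro: finite_subset[of _ "Pow S"])
  have card_diff: "card (S - T) = k * n" if "T \<subseteq> S" "card T = n" for T
    using that Suc.prems(1,2) by (simp add: card_Diff_subset finite_subset)
  have "X (Suc k) S = (\<Sum>T\<in>?sub S. x T * X k (S - T))"
    by (rule rec) (use Suc.prems in auto)
  also have "?sub S = ?in S \<union> ?out"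
    by auto
  also have "(\<Sum>T\<in>?in S \<union> ?out. x T * X k (S - T)) = (\<Sum>T\<in>?in S. x T * X k (S - T)) + (\<Sum>T\<in>?out. x T * X k (S - T))"
    by (rule sum.union_disjoint) (use fin fin_out Suc.prems in auto)
  also have "(\<Sum>T\<in>?out. x T * X k (S - T)) = (\<Sum>T\<in>?out. \<Sum>U\<in>?in (S - T). of_nat k * (x T * x U * X (k - 1) (S - T - U)))"
  proof (intro sum.cong refl)
    fix T assume "T \<in> ?out"
    then have "X k (S - T) = of_nat k * (\<Sum>U\<in>?in (S - T). x U * X (k - 1) (S - T - U))"
      using Suc.prems card_diff by (intro Suc.IH) auto
    then show "x T * X k (S - T) = (\<Sum>U\<in>?in (S - T). of_nat k * (x T * x U * X (k - 1) (S - T - U)))"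
      by (simp add: sum_distrib_left mult_ac)
  qed
  also have "\<dots> = (\<Sum>(T, U)\<in>Sigma ?out (\<lambda>T. ?in (S - T)). of_nat k * (x T * x U * X (k - 1) (S - T - U)))"
    by (rule sum.Sigma) (use fin fin_out Suc.prems in auto)
  also have "\<dots> = (\<Sum>(U, T)\<in>Sigma (?in S) (\<lambda>U. ?sub (S - U)). of_nat k * (x U * (x T * X (k - 1) (S - U - T))))"
    by (rule sum.reindex_bij_witness[of _ "\<lambda>(U, T). (T, U)" "\<lambda>(T, U). (U, T)"])
      (auto simp: Diff_Diff_Int Diff_eq Int_ac mult_ac)
  also have "\<dots> = (\<Sum>U\<in>?in S. \<Sum>T\<in>?sub (S - U). of_nat k * (x U * (x T * X (k - 1) (S - U - T))))"
    by (rule sum.Sigma[symmetric]) (use fin Suc.prems in auto)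
  also have "\<dots> = (\<Sum>U\<in>?in S. of_nat k * (x U * X k (S - U)))"
  proof (intro sum.cong refl)
    fix U assume U: "U \<in> ?in S"
    show "(\<Sum>T\<in>?sub (S - U). of_nat k * (x U * (x T * X (k - 1) (S - U - T)))) = of_nat k * (x U * X k (S - U))"
    proof (cases k)
      case (Suc l)
      have "X (Suc l) (S - U) = (\<Sum>T\<in>?sub (S - U). x T * X l (S - U - T))"
        by (rule rec) (use U Suc Suc.prems card_diff in auto)
      then show ?thesis
        using Suc by (simp add: sum_distrib_left)
    qed simp
  qed
  also have "(\<Sum>T\<in>?in S. x T * X k (S - T)) + (\<Sum>U\<in>?in S. of_nat k * (x U * X k (S - U)))
      = of_nat (Suc k) * (\<Sum>T\<in>?in S. x T * X k (S - T))"
    by (simp add: sum_distrib_left[symmetric] algebra_simps)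
  finally show ?case by simp
qed

context affine_algebraic_group_char_p
begin

text \<open>Evaluation at the unit element, which is the unit of the convolution product.\<close>

definition counit :: "('g \<Rightarrow> 'k) \<Rightarrow> 'k" where "counit f = (if f \<in> A then f \<one> else 0)"

primrec dpow :: "(('g \<Rightarrow> 'k) \<Rightarrow> 'k) \<Rightarrow> nat \<Rightarrow> ('g \<Rightarrow> 'k) \<Rightarrow> 'k" where
  "dpow x 0 = counit"
| "dpow x (Suc k) = dmult x (dpow x k)"

lemma counit_lin: "lin counit"
  using A_add fa.vs.subspace_scale[OF A_sub] by (auto simp: lin_def counit_def fun_apply)

lemma dmult_counit: "lin x \<Longrightarrow> dmult x counit = x"
proof
  fix f assume x: "lin x"
  show "dmult x counit f = x f"
  proof (cases "f \<in> A")
    case True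
    have "(\<lambda>u. counit (\<lambda>v. cm f (u, v))) = f"
    proof
      fix u
      show "counit (\<lambda>v. cm f (u, v)) = f u"
        using slice_closed(1)[OF cm_closed[OF True] x, of u] zero_outside[OF True, of u]
        by (auto simp: counit_def cm_def comult_def)
    qed
    then show ?thesis
      using True by (simp add: dmult_apply tv_def)
  next
    case False
    then show ?thesis
      using lin_outside[OF x False] by (simp add: dist_mult_def ext0_def)
  qed
qed

lemma dpow_1: "lin x \<Longrightarrow> dpow x 1 = x"
  by (simp add: dmult_counit)

lemma dpow_V: "1 \<le> k \<Longrightarrow> x \<in> V n \<Longrightarrow> dpow x k \<in> V (k * n)"
proof (induction k rule: dec_induct)
  case base
  then show ?case using dpow_1[OF V_lin] by simp
next
  case (step k)
  then show ?case using dmult_V[of x n "dpow x k" "k * n"] by simp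
qed

lemma dpow_lin: "lin x \<Longrightarrow> lin (dpow x k)"
  by (induction k) (simp_all add: counit_lin dmult_lin)

lemma dpow_kill: "x \<in> V n \<Longrightarrow> f \<in> P l \<Longrightarrow> k * n < l \<Longrightarrow> dpow x k f = 0"
proof (cases "k = 0")
  case True
  then show "f \<in> P l \<Longrightarrow> k * n < l \<Longrightarrow> ?thesis"
    using P_I[of l] by (auto simp: counit_def I_iff)
next
  case False
  then show "x \<in> V n \<Longrightarrow> f \<in> P l \<Longrightarrow> k * n < l \<Longrightarrow> ?thesis"
    using dpow_V[of k x n] V_kill[of "dpow x k" "k * n" l f] by simp
qed

text \<open>The factor \<open>e\<close> restricts the empty product to the group.\<close>

definition fprod :: "(nat \<Rightarrow> 'g \<Rightarrow> 'k) \<Rightarrow> nat set \<Rightarrow> 'g \<Rightarrow> 'k"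
  where "fprod f S = e * (\<Prod>i\<in>S. f i)"

lemma fprod_P: "finite S \<Longrightarrow> (\<And>i. i \<in> S \<Longrightarrow> f i \<in> I) \<Longrightarrow> fprod f S \<in> P (card S)"
proof (induction S rule: finite_induct)
  case empty
  then show ?case by (simp add: fprod_def e_A)
next
  case (insert i S)
  then have "f i * fprod f S \<in> P (Suc (card S))"
    by (intro P_Suc_base) auto
  then show ?case
    using insert.hyps by (simp add: fprod_def mult_ac)
qed

lemma fprod_A: "finite S \<Longrightarrow> (\<And>i. i \<in> S \<Longrightarrow> f i \<in> I) \<Longrightarrow> fprod f S \<in> A"
  using fprod_P P_A by blast

lemma cm_fprod:
  assumes "finite S" "\<And>i. i \<in> S \<Longrightarrow> f i \<in> I"
  shows "cm (fprod f S) \<in> TT (card S) \<and> (tens e e * (\<Prod>i\<in>S. tens (f i) e + tens e (f i))) \<in> TT (card S) \<and>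
    cm (fprod f S) - tens e e * (\<Prod>i\<in>S. tens (f i) e + tens e (f i)) \<in> TT (Suc (card S))"
  using assms
proof (induction S rule: finite_induct)
  case empty
  have "tens e e \<in> TT 0"
    using TT_base[of e 0 e 0] e_A by simp
  then show ?case
    using fa.vs.subspace_0[OF TT_sub] by (simp add: fprod_def cm_simps)
next
  case (insert i S)
  let ?E = "tens e e * (\<Prod>i\<in>S. tens (f i) e + tens e (f i))" and ?l = "tens (f i) e + tens e (f i)"
  have fi: "f i \<in> P 1" "f i \<in> I" using insert.prems P_1 by auto
  have l: "?l \<in> TT 1"
    using TT_base[of "f i" 1 e 0] TT_base[of e 0 "f i" 1] fi e_A by (intro fa.vs.subspace_add TT_sub) auto
  have R: "cm (f i) - ?l \<in> TT 2"
    using cm_primitive[OF fi(2)] tens_span_TT[of 1 1] P_1 by (auto simp: numeral_2_eq_2 algebra_simps)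
  have c: "cm (f i) \<in> TT 1" by (rule cm_TT[OF fi(1)])
  have IH: "cm (fprod f S) \<in> TT (card S)" "?E \<in> TT (card S)" "cm (fprod f S) - ?E \<in> TT (Suc (card S))"
    using insert by auto
  have "cm (f i) * (cm (fprod f S) - ?E) + (cm (f i) - ?l) * ?E \<in> TT (Suc (Suc (card S)))"
    using TT_mult[OF c IH(3)] TT_mult[OF R IH(2)] by (intro fa.vs.subspace_add TT_sub) auto
  moreover have "cm (f i) * (cm (fprod f S) - ?E) + (cm (f i) - ?l) * ?E = cm (f i) * cm (fprod f S) - ?l * ?E"
    by (simp add: left_diff_distrib right_diff_distrib)
  ultimately have "cm (f i) * cm (fprod f S) - ?l * ?E \<in> TT (Suc (Suc (card S)))"
    by (simp only:)
  moreover have "fprod f (insert i S) = f i * fprod f S"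
    using insert.hyps by (simp add: fprod_def mult_ac)
  moreover have "tens e e * (\<Prod>i\<in>insert i S. tens (f i) e + tens e (f i)) = ?l * ?E"
    using insert.hyps by (simp add: mult_ac)
  moreover have "cm (f i) * cm (fprod f S) \<in> TT (Suc (card S))" "?l * ?E \<in> TT (Suc (card S))"
    using TT_mult[OF c IH(1)] TT_mult[OF l IH(2)] by simp_all
  ultimately show ?case
    unfolding card_insert_disjoint[OF insert.hyps] by (simp only: cm_mult simp_thms)
qed

lemma subset_expansion:
  assumes "finite S"
  shows "tens e e * (\<Prod>i\<in>S. tens (f i) e + tens e (f i)) = (\<Sum>T\<in>Pow S. tens (fprod f T) (fprod f (S - T)))"
    (is "?L = ?R")
proof
  fix z :: "'g \<times> 'g"
  obtain x y where z: "z = (x, y)" by (cases z)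
  show "?L z = ?R z"
  proof (cases "x \<in> carrier G \<and> y \<in> carrier G")
    case True
    then show ?thesis
      using prod_add[OF assms, of "\<lambda>i. f i x" "\<lambda>i. f i y"]
      by (simp add: z e_apply tens_def fun_apply prod_fun_apply sum_fun_apply fprod_def)
  next
    case False
    then have "e x = 0 \<or> e y = 0" by (auto simp: e_apply)
    then show ?thesis
      by (auto simp: z tens_def fun_apply sum_fun_apply fprod_def)
  qed
qed

text \<open>
  Orders of the two factors add up to the number of functions, so only the terms of the coproduct with
  exactly \<open>n\<close> functions in the first variable contribute.
\<close>

lemma dpow_fprod_rec:
  assumes x: "x \<in> V n" and f: "\<And>i. f i \<in> I" and S: "finite S" "card S = Suc k * n"
  shows "dpow x (Suc k) (fprod f S) = (\<Sum>T | T \<subseteq> S \<and> card T = n. x (fprod f T) * dpow x k (fprod f (S - T)))"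
proof -
  note l = V_lin[OF x] dpow_lin[OF V_lin[OF x], of k]
  let ?E = "tens e e * (\<Prod>i\<in>S. tens (f i) e + tens e (f i))"
  have c: "cm (fprod f S) \<in> TT (card S)" "?E \<in> TT (card S)" "cm (fprod f S) - ?E \<in> TT (Suc (card S))"
    using cm_fprod[OF S(1), of f] f by auto
  have fA: "fprod f T \<in> A" if "T \<subseteq> S" for T
    using fprod_A f finite_subset[OF that S(1)] by blast
  have kill: "tv x (dpow x k) F = 0" if "F \<in> TT (Suc (card S))" for F
  proof (rule tv_vanish_span[OF l _ _ that[unfolded TT_def]])
    fix F assume "F \<in> {tens u v | u v c d. u \<in> P c \<and> v \<in> P d \<and> Suc (card S) \<le> c + d}"
    then obtain u v c d where F: "F = tens u v" "u \<in> P c" "v \<in> P d" "Suc (card S) \<le> c + d"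
      by blast
    have A: "u \<in> A" "v \<in> A" using F P_A by auto
    have "n < c \<or> k * n < d" using F(4) S(2) by auto
    then show "tv x (dpow x k) F = 0"
      using V_kill[OF x _ F(2)] dpow_kill[OF x F(3)] by (auto simp: F(1) tv_tens[OF l A])
  qed (use P_A in \<open>auto intro!: tens_spanI\<close>)
  have "tv x (dpow x k) (cm (fprod f S)) - tv x (dpow x k) ?E = 0"
    using kill[OF c(3)] tv_diff[OF l, of "cm (fprod f S)" ?E] c(1,2) TT_AA by auto
  then have "dpow x (Suc k) (fprod f S) = tv x (dpow x k) ?E"
    using fA by (simp add: dmult_apply)
  also have "\<dots> = (\<Sum>T\<in>Pow S. tv x (dpow x k) (tens (fprod f T) (fprod f (S - T))))"
    unfolding subset_expansion[OF S(1)] using fA by (intro tv_sum l tens_spanI) auto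
  also have "\<dots> = (\<Sum>T\<in>Pow S. x (fprod f T) * dpow x k (fprod f (S - T)))"
    using fA by (intro sum.cong refl tv_tens l) auto
  also have "\<dots> = (\<Sum>T | T \<subseteq> S \<and> card T = n. x (fprod f T) * dpow x k (fprod f (S - T)))"
  proof (rule sum.mono_neutral_right)
    show "\<forall>T\<in>Pow S - {T. T \<subseteq> S \<and> card T = n}. x (fprod f T) * dpow x k (fprod f (S - T)) = 0"
    proof
      fix T assume "T \<in> Pow S - {T. T \<subseteq> S \<and> card T = n}"
      then have T: "T \<subseteq> S" "card T \<noteq> n" by auto
      have fin: "finite T" using T S finite_subset by blast
      have "card (S - T) = Suc k * n - card T" "card T \<le> Suc k * n"
        using T S fin card_mono[OF S(1) T(1)] by (auto simp: card_Diff_subset)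
      then have "n < card T \<or> k * n < card (S - T)" using T(2) by auto
      moreover have "fprod f T \<in> P (card T)" "fprod f (S - T) \<in> P (card (S - T))"
        using fprod_P fin S(1) f by auto
      ultimately show "x (fprod f T) * dpow x k (fprod f (S - T)) = 0"
        using V_kill[OF x] dpow_kill[OF x] by (metis mult_eq_0_iff)
    qed
  qed (use S in auto)
  finally show ?thesis .
qed

lemma P_fprod: "1 \<le> n \<Longrightarrow> P n \<subseteq> spn {fprod f {..<n} | f. \<forall>i. f i \<in> I}"
proof (induction n rule: dec_induct)
  case base
  have "f = fprod (\<lambda>_. f) {..<1}" if "f \<in> I" for f
    using that by (simp add: fprod_def I_iff)
  then show ?case
    unfolding P_1 by (blast intro: fa.vs.span_base)
next
  case (step n)
  show ?case
  proof (rule P_Suc_minimal)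
    fix f g assume f: "f \<in> I" and g: "g \<in> P n"
    have "spn {fprod f {..<n} | f. \<forall>i. f i \<in> I} \<subseteq> {g. f * g \<in> spn {fprod f {..<Suc n} | f. \<forall>i. f i \<in> I}}"
    proof (rule fa.vs.span_minimal)
      show "fa.vs.subspace {g. f * g \<in> spn {fprod f {..<Suc n} | f. \<forall>i. f i \<in> I}}"
        by (intro linear_preimage_sub) (auto simp: distrib_left fa.scal_assoc)
      show "{fprod f {..<n} | f. \<forall>i. f i \<in> I} \<subseteq> {g. f * g \<in> spn {fprod f {..<Suc n} | f. \<forall>i. f i \<in> I}}"
      proof clarify
        fix h :: "nat \<Rightarrow> 'g \<Rightarrow> 'k" assume h: "\<forall>i. h i \<in> I"
        have "f * fprod h {..<n} = fprod (h(n := f)) {..<Suc n}"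
          by (simp add: fprod_def lessThan_Suc mult_ac)
        then show "f * fprod h {..<n} \<in> spn {fprod f {..<Suc n} | f. \<forall>i. f i \<in> I}"
          using h f by (intro fa.vs.span_base CollectI exI[of _ "h(n := f)"]) auto
      qed
    qed
    then show "f * g \<in> spn {fprod f {..<Suc n} | f. \<forall>i. f i \<in> I}"
      using g step.IH by blast
  qed simp
qed

text \<open>
  On a product of \<open>p * n\<close> functions from the augmentation ideal the value of the power is a multiple of
  \<open>p\<close>, by the counting argument of \<open>convolution_power_marked\<close>.
\<close>

lemma dpow_p:
  assumes x: "x \<in> V n" and n: "1 \<le> n"
  shows "dpow x p \<in> V (p * n - 1)"
proof -
  have D: "dpow x p \<in> V (p * n)"
    using dpow_V[OF _ x] p_gt_1 by simp
  have "dpow x p (fprod f {..<p * n}) = 0" if "\<forall>i. f i \<in> I" for f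
  proof -
    have "dpow x p (fprod f {..<p * n}) = of_nat p * (\<Sum>T | T \<subseteq> {..<p * n} \<and> card T = n \<and> 0 \<in> T.
        x (fprod f T) * dpow x (p - 1) (fprod f ({..<p * n} - T)))"
      by (rule convolution_power_marked[where X = "\<lambda>k S. dpow x k (fprod f S)" and x = "\<lambda>S. x (fprod f S)"])
        (use dpow_fprod_rec[OF x] that n in auto)
    also have "(of_nat p :: 'k) = 0"
      using char_p of_nat_CHAR by metis
    finally show ?thesis by simp
  qed
  then have kill: "dpow x p f = 0" if "f \<in> {fprod f {..<p * n} | f. \<forall>i. f i \<in> I}" for f
    using that by blast
  have "1 \<le> p * n"
    using n p_gt_1 by simp
  have "dpow x p g = 0" if "g \<in> P (p * n)" for g
    by (rule lin_vanish_span[OF V_lin[OF D] _ kill subsetD[OF P_fprod[OF \<open>1 \<le> p * n\<close>] that]])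
      (auto intro!: fprod_A)
  then show ?thesis
    using D n p_gt_1 by (auto simp: V_iff)
qed

end

section \<open>Central elements from the relations of the enveloping algebra\<close>

text \<open>
  The image of a distribution \<open>x\<close> of order below \<open>p ^ (r + 1)\<close> in the algebra is \<open>g x\<close>, subject to the
  relations of the higher enveloping algebra modulo \<open>Q\<close>.  Outside that range \<open>g\<close> is arbitrary.
\<close>

locale env_presentation =
  affine_algebraic_group_char_p G A p + algebra_quotient \<kappa> Q
  for G :: "('g, 'm) monoid_scheme" (structure) and A :: "('g \<Rightarrow> 'k::alg_closed_field) set" and p
    and \<kappa> :: "'k \<Rightarrow> 'a::ring_1" and Q :: "'a set" +
  fixes r :: nat and g :: "(('g \<Rightarrow> 'k) \<Rightarrow> 'k) \<Rightarrow> 'a"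
  assumes g_add: "x \<in> V (p ^ (r + 1) - 1) \<Longrightarrow> y \<in> V (p ^ (r + 1) - 1) \<Longrightarrow> g (x + y) - (g x + g y) \<in> Q"
    and g_scale: "x \<in> V (p ^ (r + 1) - 1) \<Longrightarrow> g (cf c * x) - \<kappa> c * g x \<in> Q"
    and g_mult: "x \<in> V i \<Longrightarrow> y \<in> V j \<Longrightarrow> i + j < p ^ (r + 1) \<Longrightarrow> g x * g y - g (dmult x y) \<in> Q"
    and g_comm: "x \<in> V i \<Longrightarrow> y \<in> V j \<Longrightarrow> 0 < i \<Longrightarrow> 0 < j \<Longrightarrow> i + j \<le> p ^ (r + 1) \<Longrightarrow>
      ad (g x) (g y) - g (dist_commutator G A x y) \<in> Q"
    and g_generates: "vs.subspace M \<Longrightarrow> Q \<subseteq> M \<Longrightarrow> 1 \<in> M \<Longrightarrow> (\<And>x y. x \<in> M \<Longrightarrow> y \<in> M \<Longrightarrow> x * y \<in> M) \<Longrightarrow>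
      g ` V (p ^ (r + 1) - 1) \<subseteq> M \<Longrightarrow> M = UNIV"
begin

abbreviation "q \<equiv> p ^ (r + 1)"
abbreviation "s \<equiv> p ^ r"

text \<open>
  The relations for commutators cover pairs from \<open>V s\<close> only because of this.
\<close>

lemma two_s: "s + s \<le> q"
proof -
  have "2 * s \<le> p * s"
    by (rule mult_le_mono1) (use p_gt_1 in linarith)
  then show ?thesis
    unfolding Suc_eq_plus1[symmetric] power_Suc by linarith
qed

lemma s_lt_q: "s < q"
  using two_s pow_pos[of r] by linarith

text \<open>
  Subspaces containing \<open>Q\<close> are saturated for congruence modulo \<open>Q\<close>, in both directions.
\<close>

lemma in_mod: "vs.subspace M \<Longrightarrow> Q \<subseteq> M \<Longrightarrow> x - y \<in> Q \<Longrightarrow> y \<in> M \<Longrightarrow> x \<in> M"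
  using vs.subspace_add[of M "x - y" y] by auto

lemma in_mod': "vs.subspace M \<Longrightarrow> Q \<subseteq> M \<Longrightarrow> x - y \<in> Q \<Longrightarrow> x \<in> M \<Longrightarrow> y \<in> M"
  using vs.subspace_diff[of M x "x - y"] by auto

lemma V_top: "i < q \<Longrightarrow> V i \<subseteq> V (q - 1)"
  by (intro V_mono) simp

lemma g_zero: "g 0 \<in> Q"
  using g_scale[of 0 0] fa.vs.subspace_0[OF V_sub] by simp

lemma g_preimage_sub:
  assumes "vs.subspace M" "Q \<subseteq> M"
  shows "fa.vs.subspace {x \<in> V (q - 1). g x \<in> M}"
proof (rule fa.vs.subspaceI)
  show "0 \<in> {x \<in> V (q - 1). g x \<in> M}"
    using fa.vs.subspace_0[OF V_sub] g_zero assms(2) by auto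
next
  fix x y assume "x \<in> {x \<in> V (q - 1). g x \<in> M}" "y \<in> {x \<in> V (q - 1). g x \<in> M}"
  then show "x + y \<in> {x \<in> V (q - 1). g x \<in> M}"
    using in_mod[OF assms g_add] vs.subspace_add[OF assms(1)] fa.vs.subspace_add[OF V_sub] by auto
next
  fix c x assume "x \<in> {x \<in> V (q - 1). g x \<in> M}"
  then show "cf c * x \<in> {x \<in> V (q - 1). g x \<in> M}"
    using in_mod[OF assms g_scale] vs.subspace_scale[OF assms(1)] fa.vs.subspace_scale[OF V_sub] by auto
qed

lemma g_span:
  assumes "vs.subspace M" "Q \<subseteq> M" "X \<subseteq> V (q - 1)" "\<And>x. x \<in> X \<Longrightarrow> g x \<in> M" "x \<in> fa.vs.span X"
  shows "g x \<in> M"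
  using fa.vs.span_minimal[OF _ g_preimage_sub[OF assms(1,2)], of X] assms(3-) by blast

text \<open>
  Since \<open>g\<close> is multiplicative in low orders, \<open>D_decomposition\<close> turns into an induction principle: to place
  the image of \<open>D R m\<close> in a subspace, it suffices to treat products and lower order.
\<close>

lemma g_decompose:
  assumes M: "vs.subspace M" "Q \<subseteq> M" and x: "x \<in> D R m" and m: "1 \<le> m" "m < q" "\<And>k. m = p ^ k \<Longrightarrow> R \<le> k"
    and prods: "\<And>\<alpha> \<beta> a b. \<alpha> \<in> D R a \<Longrightarrow> \<beta> \<in> D R b \<Longrightarrow> 1 \<le> a \<Longrightarrow> 1 \<le> b \<Longrightarrow> a + b = m \<Longrightarrow> g \<alpha> * g \<beta> \<in> M"
    and lower: "\<And>y. y \<in> D R (m - 1) \<Longrightarrow> g y \<in> M"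
  shows "g x \<in> M"
proof (rule g_span[OF M _ _ D_decomposition[OF x m(1,3)]])
  let ?X = "{dmult \<alpha> \<beta> | \<alpha> \<beta> a b. \<alpha> \<in> D R a \<and> \<beta> \<in> D R b \<and> 1 \<le> a \<and> 1 \<le> b \<and> a + b = m}"
  have X: "dmult \<alpha> \<beta> \<in> V (q - 1)" "g (dmult \<alpha> \<beta>) \<in> M"
    if *: "\<alpha> \<in> D R a" "\<beta> \<in> D R b" "1 \<le> a" "1 \<le> b" "a + b = m" for \<alpha> \<beta> a b
  proof -
    have V: "\<alpha> \<in> V a" "\<beta> \<in> V b" using * D_V by auto
    have "dmult \<alpha> \<beta> \<in> V m" using dmult_V[OF V] *(5) by simp
    then show "dmult \<alpha> \<beta> \<in> V (q - 1)" using V_top[OF m(2)] by blast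
    show "g (dmult \<alpha> \<beta>) \<in> M"
      by (rule in_mod'[OF M g_mult[OF V] prods[OF *]]) (use *(5) m(2) in simp)
  qed
  show "?X \<union> D R (m - 1) \<subseteq> V (q - 1)"
    using X(1) D_V[of R "m - 1"] V_top[of "m - 1"] m(2) by fastforce
  fix x assume "x \<in> ?X \<union> D R (m - 1)"
  then show "g x \<in> M" using X(2) lower by blast
qed

definition B :: "nat \<Rightarrow> (('g \<Rightarrow> 'k) \<Rightarrow> 'k) set"
  where "B k = (SOME X. finite X \<and> X \<subseteq> V (p ^ k) \<and> V (p ^ k) \<subseteq> fa.vs.span X)"

lemma B: "finite (B k)" "B k \<subseteq> V (p ^ k)" "V (p ^ k) \<subseteq> fa.vs.span (B k)"
proof -
  have "finite (B k) \<and> B k \<subseteq> V (p ^ k) \<and> V (p ^ k) \<subseteq> fa.vs.span (B k)"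
    unfolding B_def by (rule someI_ex) (rule V_finite)
  then show "finite (B k)" "B k \<subseteq> V (p ^ k)" "V (p ^ k) \<subseteq> fa.vs.span (B k)" by blast+
qed

text \<open>
  The parameter \<open>t\<close> allows \<open>k < t\<close> only.  For \<open>t = r + 1\<close> these are generators of the algebra; those with
  \<open>t = r\<close> generate a finite-dimensional subalgebra.  A letter is tagged with its weight because the same
  distribution may be chosen for several \<open>k\<close>.
\<close>

definition letters :: "nat \<Rightarrow> (nat \<times> (('g \<Rightarrow> 'k) \<Rightarrow> 'k)) set"
  where "letters t = (SIGMA k:{..<t}. B k)"

definition lt :: "nat \<times> (('g \<Rightarrow> 'k) \<Rightarrow> 'k) \<Rightarrow> 'a" where "lt j = g (snd j)"
definition dg :: "nat \<times> (('g \<Rightarrow> 'k) \<Rightarrow> 'k) \<Rightarrow> nat" where "dg j = p ^ fst j"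

sublocale L: weighted_letters \<kappa> Q "letters t" lt dg for t
  by unfold_locales (auto simp: letters_def B dg_def)

text \<open>
  Powers of \<open>p\<close> as orders are accounted for by letters and all other orders by decomposition into products,
  here with \<open>D (r + 1)\<close>, which agrees with \<open>V\<close> below order \<open>p ^ (r + 1)\<close>.
\<close>

lemma g_filt: "t \<le> r + 1 \<Longrightarrow> m < p ^ t \<Longrightarrow> x \<in> V m \<Longrightarrow> g x \<in> L.filt t m"
proof (induction m arbitrary: x rule: less_induct)
  case (less m)
  have tq: "p ^ t \<le> q"
    using less.prems(1) p_gt_1 by (intro power_increasing) auto
  note M = L.filt_subspace[of t m] L.Q_filt[of t m]
  show ?case
  proof (cases "m = 0")
    case True
    then show ?thesis using V_0 less.prems g_zero M(2) by auto
  next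
    case m: False
    show ?thesis
    proof (cases "\<exists>k. m = p ^ k")
      case True
      then obtain k where k: "m = p ^ k" ..
      have kt: "k < t"
        using power_less_imp_less_exp[OF p_gt_1, of k t] less.prems(2) k by simp
      show ?thesis
      proof (rule g_span[OF M])
        show "B k \<subseteq> V (q - 1)"
          using B(2)[of k] V_top[of "p ^ k"] less.prems(2) k tq by auto
        show "x \<in> fa.vs.span (B k)" using B(3)[of k] less.prems(3) k by blast
        fix b assume "b \<in> B k"
        then have "(k, b) \<in> letters t" using kt by (simp add: letters_def)
        from L.letter_filt[OF this, of m] show "g b \<in> L.filt t m"
          using k by (simp add: lt_def dg_def)
      qed
    next
      case False
      show ?thesis
      proof (rule g_decompose[OF M, of x "r + 1" m])
        show "x \<in> D (r + 1) m" using less.prems tq by (simp add: D_eq_V)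
        show "1 \<le> m" "m < q" using m less.prems(2) tq by auto
        show "r + 1 \<le> k" if "m = p ^ k" for k using False that by blast
        show "g \<alpha> * g \<beta> \<in> L.filt t m"
          if "\<alpha> \<in> D (r + 1) a" "\<beta> \<in> D (r + 1) b" "1 \<le> a" "1 \<le> b" "a + b = m" for \<alpha> \<beta> a b
        proof -
          have "g \<alpha> \<in> L.filt t a" "g \<beta> \<in> L.filt t b"
            using that D_V less.prems by (auto intro!: less.IH)
          then show ?thesis using L.filt_mult that(5) by blast
        qed
        show "g y \<in> L.filt t m" if "y \<in> D (r + 1) (m - 1)" for y
        proof -
          have "g y \<in> L.filt t (m - 1)"
            using that D_V m less.prems by (intro less.IH) auto
          then show ?thesis using L.filt_mono[of "m - 1" m t] by auto
        qed
      qed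
    qed
  qed
qed

lemma letter_V: "j \<in> letters t \<Longrightarrow> snd j \<in> V (dg j) \<and> fst j < t \<and> dg j \<le> p ^ (t - 1)"
  using p_gt_1 by (auto simp: letters_def dg_def intro!: power_increasing subsetD[OF B(2)])

text \<open>
  Two letters have weights at most \<open>p ^ (t - 1)\<close>, whose sum is at most \<open>p ^ t\<close>.  So their commutator is the
  image of a distribution of order below \<open>p ^ t\<close>, which is again expressed through letters.
\<close>

lemma commuting_letters: "t \<le> r + 1 \<Longrightarrow> almost_commuting_letters \<kappa> Q (letters t) lt dg"
proof unfold_locales
  fix i j assume t: "t \<le> r + 1" and ij: "i \<in> letters t" "j \<in> letters t"
  have V: "snd i \<in> V (dg i)" "snd j \<in> V (dg j)" and t0: "t \<noteq> 0" and d: "dg i \<le> p ^ (t - 1)" "dg j \<le> p ^ (t - 1)"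
    using letter_V[OF ij(1)] letter_V[OF ij(2)] by auto
  have pos: "dg i > 0" "dg j > 0" by (simp_all add: dg_def)
  have "2 * p ^ (t - 1) \<le> p * p ^ (t - 1)"
    by (rule mult_le_mono1) (use p_gt_1 in linarith)
  moreover have "p * p ^ (t - 1) = p ^ t"
    using t0 by (cases t) simp_all
  ultimately have pt: "p ^ (t - 1) + p ^ (t - 1) \<le> p ^ t" "p ^ t \<le> q"
    using power_increasing[OF t, of p] p_gt_1 by linarith+
  have le: "dg i + dg j \<le> q" using d pt by linarith
  have c: "g (dist_commutator G A (snd i) (snd j)) \<in> L.filt t (dg i + dg j - 1)"
    by (rule g_filt[OF t _ commutator_V[OF V pos(1)]]) (use d pt pos in linarith)
  show "ad (lt i) (lt j) \<in> L.filt t (dg i + dg j - 1)"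
    unfolding lt_def[of i] lt_def[of j]
    by (rule in_mod[OF L.filt_subspace L.Q_filt g_comm[OF V pos le] c])
qed

text \<open>Iterate \<open>g_mult\<close>; the bound keeps every partial product within its range.\<close>

lemma g_power:
  assumes x: "x \<in> V n" and k: "1 \<le> k"
  shows "k * n < q \<Longrightarrow> g x ^ k - g (dpow x k) \<in> Q"
  using k
proof (induction k rule: dec_induct)
  case base
  then show ?case using dpow_1[OF V_lin[OF x]] Q_zero by simp
next
  case (step k)
  have "g x ^ Suc k - g (dpow x (Suc k))
      = g x * (g x ^ k - g (dpow x k)) + (g x * g (dpow x k) - g (dmult x (dpow x k)))"
    by (simp add: algebra_simps)
  moreover have "g x * (g x ^ k - g (dpow x k)) \<in> Q"
    using step by (intro Q_left step.IH) simp
  moreover have "g x * g (dpow x k) - g (dmult x (dpow x k)) \<in> Q"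
    using step by (intro g_mult[OF x dpow_V[OF _ x]]) auto
  ultimately show ?case using Q_add by metis
qed

text \<open>
  For weights \<open>p ^ k\<close> with \<open>k < r\<close> the \<open>p\<close>-th power is still covered by the relations, and there the order
  drops by \<open>dpow_p\<close>.
\<close>

lemma small_letter_power:
  assumes j: "j \<in> letters r" and t: "r \<le> t" "t \<le> r + 1"
  shows "lt j ^ p \<in> L.filt t (p * dg j - 1)"
proof -
  have V: "snd j \<in> V (dg j)" and d: "fst j < r" using letter_V[OF j] by auto
  have ds: "p * dg j \<le> s"
    using p_gt_1 power_increasing[of "Suc (fst j)" r p] d by (simp add: dg_def)
  have "s \<le> p ^ t" using t p_gt_1 by (intro power_increasing) auto
  moreover have "0 < p * dg j" by (simp add: dg_def)
  ultimately have lt: "p * dg j - 1 < p ^ t" using ds by linarith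
  have "g (snd j) ^ p - g (dpow (snd j) p) \<in> Q"
    by (rule g_power[OF V]) (use ds s_lt_q p_gt_1 in linarith)+
  moreover have "g (dpow (snd j) p) \<in> L.filt t (p * dg j - 1)"
    by (rule g_filt[OF t(2) lt dpow_p[OF V]]) (simp add: dg_def Suc_le_eq)
  ultimately show ?thesis
    unfolding lt_def[of j] by (rule in_mod[OF L.filt_subspace L.Q_filt])
qed

text \<open>
  The subalgebra generated by the small letters.  It is defined as a step of the filtration to make it
  visibly finite-dimensional; \<open>filt_Dd\<close> shows that the filtration is constant from there on.
\<close>

definition Dd :: "'a set" where "Dd = L.filt r (\<Sum>j\<in>letters r. p * dg j)"

lemma Dd_sub: "vs.subspace Dd" and Q_Dd: "Q \<subseteq> Dd"
  unfolding Dd_def by (rule L.filt_subspace L.Q_filt)+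

lemma filt_Dd: "L.filt r n \<subseteq> Dd"
proof -
  interpret S: almost_commuting_letters \<kappa> Q "letters r" lt dg
    by (rule commuting_letters) simp
  show ?thesis
  proof (rule S.filt_stabilizes[where m = "\<lambda>_. p" and z = "\<lambda>_. 0"])
    show "0 < p \<and> lt j ^ p - 0 \<in> L.filt r (p * dg j - 1)" if "j \<in> letters r" for j
      using small_letter_power[OF that] by simp
    show "L.filt r (\<Sum>j\<in>letters r. p * dg j) \<subseteq> Dd" by (simp add: Dd_def)
    show "0 * x \<in> Dd" for x using vs.subspace_0[OF Dd_sub] by simp
  qed (rule Dd_sub)
qed

lemma Dd_mult: "x \<in> Dd \<Longrightarrow> y \<in> Dd \<Longrightarrow> x * y \<in> Dd"
  using L.filt_mult filt_Dd unfolding Dd_def by blast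

lemma one_Dd: "1 \<in> Dd"
  using L.word_filt[of "[]" r 0] filt_Dd[of 0] by auto

lemma g_small_Dd: "m < s \<Longrightarrow> x \<in> V m \<Longrightarrow> g x \<in> Dd"
  using g_filt[of r m x] filt_Dd by auto

text \<open>
  Distributions on the Frobenius kernel decompose at all orders \<open>m \<ge> s\<close>, including powers of \<open>p\<close>, hence
  down to orders below \<open>s\<close>.
\<close>

lemma g_D_Dd: "m < q \<Longrightarrow> x \<in> D r m \<Longrightarrow> g x \<in> Dd"
proof (induction m arbitrary: x rule: less_induct)
  case (less m)
  show ?case
  proof (cases "m < s")
    case True
    then show ?thesis using g_small_Dd less.prems(2) D_V by blast
  next
    case False
    have sp: "0 < s" by simp
    show ?thesis
    proof (rule g_decompose[OF Dd_sub Q_Dd less.prems(2) _ less.prems(1)])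
      show "1 \<le> m" using False sp by linarith
      show "r \<le> k" if "m = p ^ k" for k
        using power_le_imp_le_exp[OF p_gt_1, of r k] False that by simp
      show "g \<alpha> * g \<beta> \<in> Dd" if "\<alpha> \<in> D r a" "\<beta> \<in> D r b" "1 \<le> a" "1 \<le> b" "a + b = m" for \<alpha> \<beta> a b
        using that less.prems(1) by (intro Dd_mult less.IH[of a] less.IH[of b]) auto
      show "g y \<in> Dd" if "y \<in> D r (m - 1)" for y
        using that less.prems(1) \<open>1 \<le> m\<close> by (intro less.IH[of "m - 1"]) auto
    qed
  qed
qed

text \<open>
  On a small letter \<open>ad (g x)\<close> is the image of a commutator in \<open>Dist\<close>, which stays on the Frobenius kernel
  by \<open>commutator_D\<close>; on words it acts as a derivation.
\<close>

lemma ad_Dd: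
  assumes x: "x \<in> V s"
  shows "y \<in> Dd \<Longrightarrow> ad (g x) y \<in> Dd"
proof -
  have letter: "ad (g x) (lt j) \<in> Dd" if j: "j \<in> letters r" for j
  proof -
    have V: "snd j \<in> V (dg j)" and d: "dg j < s"
      using letter_V[OF j] p_gt_1 by (auto simp: dg_def intro: power_strict_increasing)
    have pos: "0 < dg j" "0 < s" by (simp_all add: dg_def)
    have "snd j \<in> D r (dg j)" using V d by (simp add: D_eq_V)
    then have "dist_commutator G A x (snd j) \<in> D r (s + dg j - 1)"
      by (rule commutator_D[OF x])
    then have c: "g (dist_commutator G A x (snd j)) \<in> Dd"
      by (rule g_D_Dd[rotated]) (use d two_s pos in linarith)
    have le: "s + dg j \<le> q" using d two_s by linarith
    show ?thesis
      unfolding lt_def[of j] by (rule in_mod[OF Dd_sub Q_Dd g_comm[OF x V pos(2,1) le] c])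
  qed
  have lt_Dd: "lt j \<in> Dd" if "j \<in> letters r" for j
    using L.letter_filt[OF that order_refl] filt_Dd by blast
  have words: "L.word l \<in> Dd \<and> ad (g x) (L.word l) \<in> Dd" if "set l \<subseteq> letters r" for l
    using that
  proof (induction l)
    case Nil
    have "ad (g x) 1 = 0" by (simp add: ad_def)
    then show ?case using one_Dd vs.subspace_0[OF Dd_sub] by simp
  next
    case (Cons j l)
    then show ?case
      using letter[of j] lt_Dd[of j] by (auto simp: ad_mult intro!: Dd_mult vs.subspace_add[OF Dd_sub])
  qed
  show "ad (g x) y \<in> Dd" if "y \<in> Dd"
    by (rule ad_span[OF Dd_sub _ that[unfolded Dd_def L.filt_def]]) (use words ad_in_Q Q_Dd in auto)
qed

lemma Dd_finite: "\<exists>X. finite X \<and> Dd = vs.span (X \<union> Q)"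
  unfolding Dd_def L.filt_def using L.finite_words by blast

text \<open>
  The finite-dimensional space on which \<open>V s\<close> acts by commutators.  The subalgebra \<open>Dd\<close> alone is stable, but
  it need not contain the letters of weight \<open>s\<close>; and their span alone need not be stable, since commutators
  of elements of \<open>V s\<close> have order up to \<open>2 * s - 1\<close>.  By \<open>g_E\<close>, that is within the reach of \<open>E\<close>.
\<close>

definition E :: "'a set" where "E = vs.span (Dd \<union> {g x * u | x u. x \<in> V s \<and> u \<in> Dd})"

lemma E_sub: "vs.subspace E" and Dd_E: "Dd \<subseteq> E" and Q_E: "Q \<subseteq> E"
  unfolding E_def using vs.span_superset Q_Dd by (blast, blast, blast)

lemma W_E: "x \<in> V s \<Longrightarrow> u \<in> Dd \<Longrightarrow> g x * u \<in> E"
  unfolding E_def by (intro vs.span_base) blast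

lemma E_Dd: "y \<in> E \<Longrightarrow> u \<in> Dd \<Longrightarrow> y * u \<in> E"
proof -
  assume y: "y \<in> E" and u: "u \<in> Dd"
  show "y * u \<in> E"
  proof (rule span_mult[OF E_sub _ y[unfolded E_def] vs.span_base[of u Dd]])
    fix a b assume a: "a \<in> Dd \<union> {g x * u | x u. x \<in> V s \<and> u \<in> Dd}" and b: "b \<in> Dd"
    show "a * b \<in> E"
    proof (cases "a \<in> Dd")
      case True
      then show ?thesis using Dd_mult b Dd_E by blast
    next
      case False
      then obtain x u where "a = g x * u" "x \<in> V s" "u \<in> Dd" using a by blast
      then show ?thesis using W_E[OF _ Dd_mult[OF _ b]] by (simp add: mult.assoc)
    qed
  qed (rule u)
qed

lemma Dd_times_E: "u \<in> Dd \<Longrightarrow> y \<in> E \<Longrightarrow> u * y \<in> E"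
proof -
  assume u: "u \<in> Dd" and y: "y \<in> E"
  show "u * y \<in> E"
  proof (rule span_mult[OF E_sub _ vs.span_base[OF u] y[unfolded E_def]])
    fix a b assume a: "a \<in> Dd" and b: "b \<in> Dd \<union> {g x * u | x u. x \<in> V s \<and> u \<in> Dd}"
    show "a * b \<in> E"
    proof (cases "b \<in> Dd")
      case True
      then show ?thesis using Dd_mult a Dd_E by blast
    next
      case False
      then obtain x u where b: "b = g x * u" and xu: "x \<in> V s" "u \<in> Dd" using b by blast
      have "a * b = g x * (a * u) - ad (g x) a * u"
        by (simp add: b ad_def algebra_simps)
      also have "\<dots> \<in> E"
        using xu a ad_Dd[OF xu(1) a] Dd_mult Dd_E
        by (intro vs.subspace_diff[OF E_sub] W_E) auto
      finally show ?thesis .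
    qed
  qed
qed

text \<open>
  In a decomposition of order below \<open>2 * s\<close> one of the two factors has order below \<open>s\<close> and so lies in \<open>Dd\<close>,
  and \<open>E\<close> is a bimodule over \<open>Dd\<close>.
\<close>

lemma g_E: "m < s + s \<Longrightarrow> x \<in> V m \<Longrightarrow> g x \<in> E"
proof (induction m arbitrary: x rule: less_induct)
  case (less m)
  have mq: "m < q" using less.prems(1) two_s by linarith
  consider "m < s" | "m = s" | "s < m" by linarith
  then show ?case
  proof cases
    case 1
    then show ?thesis using g_small_Dd less.prems Dd_E by blast
  next
    case 2
    then show ?thesis using W_E[OF _ one_Dd] less.prems by simp
  next
    case 3
    show ?thesis
    proof (rule g_decompose[OF E_sub Q_E, of x "r + 1" m])
      show "x \<in> D (r + 1) m" using less.prems(2) D_eq_V[OF mq] by simp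
      show "1 \<le> m" using 3 by linarith
      show "r + 1 \<le> k" if "m = p ^ k" for k
        using power_less_imp_less_exp[OF p_gt_1, of r k] 3 that by simp
      show "g \<alpha> * g \<beta> \<in> E" if *: "\<alpha> \<in> D (r + 1) a" "\<beta> \<in> D (r + 1) b" "1 \<le> a" "1 \<le> b" "a + b = m" for \<alpha> \<beta> a b
      proof -
        have V: "\<alpha> \<in> V a" "\<beta> \<in> V b" using * D_V by auto
        have IH: "g \<alpha> \<in> E" "g \<beta> \<in> E"
          using less.IH[of a \<alpha>] less.IH[of b \<beta>] V *(3-5) less.prems(1) by auto
        have "a < s \<or> b < s" using *(5) less.prems(1) by linarith
        then show ?thesis
          using g_small_Dd V IH E_Dd Dd_times_E by blast
      qed
      show "g y \<in> E" if "y \<in> D (r + 1) (m - 1)" for y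
        using that D_V less.prems(1) 3 by (intro less.IH[of "m - 1"]) auto
    qed (rule mq)
  qed
qed

lemma ad_E: "x \<in> V s \<Longrightarrow> y \<in> E \<Longrightarrow> ad (g x) y \<in> E"
proof (rule ad_span[OF E_sub, of "Dd \<union> {g x * u | x u. x \<in> V s \<and> u \<in> Dd}"])
  assume x: "x \<in> V s"
  fix a assume a: "a \<in> Dd \<union> {g x * u | x u. x \<in> V s \<and> u \<in> Dd}"
  show "ad (g x) a \<in> E"
  proof (cases "a \<in> Dd")
    case True
    then show ?thesis using ad_Dd[OF x] Dd_E by blast
  next
    case False
    then obtain x' u where a: "a = g x' * u" and xu: "x' \<in> V s" "u \<in> Dd" using a by blast
    have sp: "0 < s" by simp
    have "g (dist_commutator G A x x') \<in> E"
      by (rule g_E[OF _ commutator_V[OF x xu(1) sp]]) (use sp in linarith)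
    then have "ad (g x) (g x') \<in> E"
      by (rule in_mod[OF E_sub Q_E g_comm[OF x xu(1) sp sp two_s]])
    then show ?thesis
      unfolding a ad_mult using xu ad_Dd[OF x xu(2)]
      by (intro vs.subspace_add[OF E_sub] E_Dd W_E)
  qed
qed (auto simp: E_def)

lemma E_finite: "\<exists>X. finite X \<and> E = vs.span (X \<union> Q)"
proof -
  obtain X where X: "finite X" "Dd = vs.span (X \<union> Q)"
    using Dd_finite by blast
  let ?Y = "X \<union> (\<lambda>(b, u). g b * u) ` (B r \<times> X)"
  let ?M = "vs.span (?Y \<union> Q)"
  have QM: "Q \<subseteq> ?M"
    by (rule order_trans[OF _ vs.span_superset]) auto
  have DM: "Dd \<subseteq> ?M" unfolding X(2) by (rule vs.span_mono) auto
  have XD: "X \<subseteq> Dd" unfolding X(2) by (rule order_trans[OF _ vs.span_superset]) auto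
  have "g x * u \<in> ?M" if x: "x \<in> V s" and u: "u \<in> Dd" for x u
  proof -
    have "g x \<in> vs.span (g ` B r \<union> Q)"
    proof (rule g_span[where X = "B r"])
      show "B r \<subseteq> V (q - 1)" using B(2)[of r] V_top[OF s_lt_q] by blast
      show "x \<in> fa.vs.span (B r)" using B(3)[of r] x by blast
    qed (auto intro: vs.span_base)
    then show ?thesis
    proof (rule span_mult[of ?M, rotated 2])
      show "u \<in> vs.span (X \<union> Q)" using u X(2) by simp
      fix a b assume ab: "a \<in> g ` B r \<union> Q" "b \<in> X \<union> Q"
      show "a * b \<in> ?M"
      proof (cases "a \<in> Q \<or> b \<in> Q")
        case True
        then show ?thesis using Q_left Q_right QM by blast
      next
        case False
        then show ?thesis using ab by (intro vs.span_base) auto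
      qed
    qed simp
  qed
  then have "E \<subseteq> ?M"
    unfolding E_def using DM by (intro vs.span_minimal) auto
  moreover have "?M \<subseteq> E"
    using XD Dd_E Q_E by (intro vs.span_minimal[OF _ E_sub]) (auto intro!: W_E subsetD[OF B(2)])
  ultimately show ?thesis
    using X(1) B(1) by (intro exI[of _ ?Y]) auto
qed

lemma everything_filtered: "\<exists>n. y \<in> L.filt (r + 1) n"
proof -
  let ?M = "{y. \<exists>n. y \<in> L.filt (r + 1) n}"
  have up: "y \<in> L.filt (r + 1) (max m n)" if "y \<in> L.filt (r + 1) m \<or> y \<in> L.filt (r + 1) n" for y m n
    using that L.filt_mono[of m "max m n"] L.filt_mono[of n "max m n"] by auto
  have "?M = UNIV"
  proof (rule g_generates)
    show "vs.subspace ?M"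
    proof (rule vs.subspaceI)
      show "0 \<in> ?M" using vs.subspace_0[OF L.filt_subspace] by blast
      show "x + y \<in> ?M" if xy: "x \<in> ?M" "y \<in> ?M" for x y
      proof -
        obtain m n where "x \<in> L.filt (r + 1) m" "y \<in> L.filt (r + 1) n" using xy by blast
        then have "x + y \<in> L.filt (r + 1) (max m n)"
          using up by (intro vs.subspace_add[OF L.filt_subspace]) blast+
        then show ?thesis by blast
      qed
      show "\<kappa> c * x \<in> ?M" if "x \<in> ?M" for c x
        using that vs.subspace_scale[OF L.filt_subspace] by blast
    qed
    show "Q \<subseteq> ?M" using L.Q_filt by blast
    show "1 \<in> ?M" using L.word_filt[of "[]" "r + 1" 0] by auto
    show "x * y \<in> ?M" if "x \<in> ?M" "y \<in> ?M" for x y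
      using that L.filt_mult by blast
    show "g ` V (q - 1) \<subseteq> ?M"
      using g_filt[of "r + 1" "q - 1"] by fastforce
  qed
  then show ?thesis by blast
qed

text \<open>
  The \<open>p\<close>-polynomial that commutes with \<open>E\<close> commutes with all letters, which lie in \<open>E\<close> and generate the
  algebra.
\<close>

lemma central_p_polynomial:
  assumes x: "x \<in> V s"
  shows "\<exists>N a. g x ^ (p ^ N) - (\<Sum>i<N. \<kappa> (a i) * g x ^ (p ^ i)) \<in> centre_mod"
proof -
  obtain X where X: "finite X" "E = vs.span (X \<union> Q)"
    using E_finite by blast
  obtain N a where Na: "\<forall>y\<in>E. ad (g x ^ (p ^ N) - (\<Sum>i<N. \<kappa> (a i) * g x ^ (p ^ i))) y \<in> Q"
    using p_polynomial_centralizes[OF prime_p char_p X(1), of "g x"] ad_E[OF x] unfolding X(2)[symmetric] by blast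
  let ?z = "g x ^ (p ^ N) - (\<Sum>i<N. \<kappa> (a i) * g x ^ (p ^ i))"
  let ?M = "{y. ad ?z y \<in> Q}"
  have M: "vs.subspace ?M"
    by (rule vs.subspaceI)
      (auto simp: ad_add ad_scal Q_add Q_left intro: ad_in_Q[OF Q_zero])
  have lt: "lt j \<in> ?M" if "j \<in> letters (r + 1)" for j
  proof -
    have "snd j \<in> V (dg j)" "dg j \<le> s"
      using letter_V[OF that] by auto
    moreover have "s < s + s" by simp
    ultimately have "snd j \<in> V (dg j)" "dg j < s + s" by linarith+
    then have "g (snd j) \<in> E" by (intro g_E)
    then show ?thesis using Na by (simp add: lt_def)
  qed
  have "L.word l \<in> ?M" if "set l \<subseteq> letters (r + 1)" for l
    using that
  proof (induction l)
    case Nil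
    then show ?case using Q_zero by (simp add: ad_def)
  next
    case (Cons j l)
    then show ?case using lt[of j] by (auto intro: ad_centralizer_mult)
  qed
  then have "L.filt (r + 1) n \<subseteq> ?M" for n
    using ad_in_Q by (intro L.filt_minimal M) auto
  then have "?z \<in> centre_mod"
    using everything_filtered unfolding centre_mod_def by blast
  then show ?thesis by blast
qed

text \<open>
  For a letter of weight \<open>s\<close> take \<open>w ^ (p ^ N)\<close> and its central \<open>p\<close>-polynomial; the difference involves lower
  powers only.  For smaller letters take the \<open>p\<close>-th power and the central element \<open>0\<close>.
\<close>

theorem finite_over_central_subalgebra:
  obtains zs X where "set zs \<subseteq> centre_mod" "finite X"
    "vs.span ({monomial zs a * b | a b. length a = length zs \<and> b \<in> X} \<union> Q) = UNIV"
proof -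
  interpret F: almost_commuting_letters \<kappa> Q "letters (r + 1)" lt dg
    by (rule commuting_letters) simp
  have "\<exists>m z. m > 0 \<and> lt j ^ m - z \<in> L.filt (r + 1) (m * dg j - 1) \<and> z \<in> centre_mod"
    if j: "j \<in> letters (r + 1)" for j
  proof (cases "j \<in> letters r")
    case True
    then show ?thesis
      using small_letter_power[OF True, of "r + 1"] Q_zero Q_centre_mod
      by (intro exI[of _ p] exI[of _ 0]) auto
  next
    case False
    then have js: "dg j = s" "snd j \<in> V s"
      using j letter_V[OF j] by (auto simp: letters_def dg_def less_Suc_eq)
    obtain N a where z: "g (snd j) ^ (p ^ N) - (\<Sum>i<N. \<kappa> (a i) * g (snd j) ^ (p ^ i)) \<in> centre_mod" (is "?z \<in> _")
      using central_p_polynomial[OF js(2)] by blast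
    have pw: "lt j ^ k \<in> L.filt (r + 1) (k * s)" for k
      using L.word_filt[of "replicate k j" "r + 1" "k * s"] j js(1) by (simp add: set_replicate_conv_if)
    have "lt j ^ (p ^ N) - ?z = (\<Sum>i<N. \<kappa> (a i) * lt j ^ (p ^ i))"
      by (simp add: lt_def)
    also have "\<dots> \<in> L.filt (r + 1) (p ^ N * dg j - 1)"
    proof (intro vs.subspace_sum[OF L.filt_subspace] vs.subspace_scale[OF L.filt_subspace])
      fix i assume "i \<in> {..<N}"
      then have "p ^ i < p ^ N" using p_gt_1 by (intro power_strict_increasing) auto
      then have "p ^ i * s < p ^ N * dg j" using js(1) by simp
      then have "p ^ i * s \<le> p ^ N * dg j - 1" by linarith
      then show "lt j ^ (p ^ i) \<in> L.filt (r + 1) (p ^ N * dg j - 1)"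
        using pw[of "p ^ i"] L.filt_mono by blast
    qed
    finally show ?thesis
      using z by (intro exI[of _ "p ^ N"] exI[of _ ?z]) simp
  qed
  then obtain m z where mz: "\<And>j. j \<in> letters (r + 1) \<Longrightarrow> m j > 0 \<and> lt j ^ m j - z j \<in> L.filt (r + 1) (m j * dg j - 1) \<and> z j \<in> centre_mod"
    by metis
  show ?thesis
    by (rule F.finite_over_central_powers[of m z]) (use mz everything_filtered that in blast)+
qed

end

section \<open>The enveloping algebra as a quotient of a free algebra\<close>

instantiation list :: (type) monoid_add
begin
definition plus_list :: "'a list \<Rightarrow> 'a list \<Rightarrow> 'a list" where "plus_list = append"
definition zero_list :: "'a list" where "zero_list = []"
instance by standard (simp_all add: plus_list_def zero_list_def)
end

type_synonym ('v, 'k) free = "'v list \<Rightarrow>\<^sub>0 'k"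

text \<open>
  With concatenation as addition of words, the convolution product of finitely supported functions is a sum
  over the ways to cut a word in two, as in \<open>free_algebra\<close>.
\<close>

lemma lookup_mult_list:
  fixes f g :: "('v, 'k::field) free"
  shows "Poly_Mapping.lookup (f * g) w = (\<Sum>n\<le>length w. Poly_Mapping.lookup f (take n w) * Poly_Mapping.lookup g (drop n w))"
proof -
  let ?h = "\<lambda>n. (take n w, drop n w)"
  have inj: "inj_on ?h {..length w}"
    by (rule inj_onI) (metis atMost_iff length_take min_absorb2 prod.inject)
  have "Poly_Mapping.lookup (f * g) w = (\<Sum>(a, b). Poly_Mapping.lookup f a * Poly_Mapping.lookup g b when w = a + b)"
    by (simp add: times_poly_mapping.rep_eq prod_fun_unfold_prod)
  also have "\<dots> = (\<Sum>x\<in>?h ` {..length w}. case x of (a, b) \<Rightarrow> Poly_Mapping.lookup f a * Poly_Mapping.lookup g b when w = a + b)"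
  proof (rule Sum_any.expand_superset)
    show "{x. (case x of (a, b) \<Rightarrow> Poly_Mapping.lookup f a * Poly_Mapping.lookup g b when w = a + b) \<noteq> 0} \<subseteq> ?h ` {..length w}"
    proof clarify
      fix a b assume "(Poly_Mapping.lookup f a * Poly_Mapping.lookup g b when w = a + b) \<noteq> 0"
      then have "w = a @ b" by (auto simp: when_def plus_list_def split: if_splits)
      then show "(a, b) \<in> ?h ` {..length w}" by (intro image_eqI[of _ _ "length a"]) auto
    qed
  qed simp
  also have "\<dots> = (\<Sum>n\<le>length w. Poly_Mapping.lookup f (take n w) * Poly_Mapping.lookup g (drop n w))"
    by (simp add: sum.reindex[OF inj] plus_list_def)
  finally show ?thesis .
qed

lemma free_induct:
  fixes f :: "('v, 'k::field) free"
  assumes "0 \<in> M" "\<And>w c. Poly_Mapping.single w c \<in> M" "\<And>f g. f \<in> M \<Longrightarrow> g \<in> M \<Longrightarrow> f + g \<in> M"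
  shows "f \<in> M"
proof (induction f rule: update_induct)
  case const
  show ?case by (rule assms(1))
next
  case (update f a b)
  have "Poly_Mapping.update a b f = f + Poly_Mapping.single a b"
    using update.hyps
    by (intro poly_mapping_eqI) (auto simp: lookup_update lookup_add lookup_single when_def in_keys_iff)
  then show ?case using assms(2,3) update.IH by simp
qed

definition free_const :: "'k::field \<Rightarrow> ('v, 'k) free" where "free_const c = Poly_Mapping.single 0 c"

lemma central_scalars_free: "central_scalars (free_const :: 'k::field \<Rightarrow> ('v, 'k) free)"
proof
  fix c and x :: "('v, 'k) free"
  have "x \<in> {x. free_const c * x = x * free_const c}"
    by (rule free_induct) (auto simp: free_const_def mult_single distrib_left distrib_right mult.commute)
  then show "free_const c * x = x * free_const c" by simp
qed (simp_all add: free_const_def single_add mult_single)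

definition ring_map :: "('a::ring_1 \<Rightarrow> 'u) \<Rightarrow> ('u, 'n) ring_scheme \<Rightarrow> bool" where
  "ring_map \<pi> R \<longleftrightarrow> ring R \<and> (\<forall>x. \<pi> x \<in> carrier R) \<and> (\<forall>x y. \<pi> (x + y) = \<pi> x \<oplus>\<^bsub>R\<^esub> \<pi> y) \<and>
    (\<forall>x y. \<pi> (x * y) = \<pi> x \<otimes>\<^bsub>R\<^esub> \<pi> y) \<and> \<pi> 1 = \<one>\<^bsub>R\<^esub>"

lemma ring_map_zero: "ring_map \<pi> R \<Longrightarrow> \<pi> 0 = \<zero>\<^bsub>R\<^esub>"
proof -
  assume m: "ring_map \<pi> R"
  then interpret ring R by (simp add: ring_map_def)
  have "\<pi> 0 \<oplus>\<^bsub>R\<^esub> \<pi> 0 = \<pi> 0 \<oplus>\<^bsub>R\<^esub> \<zero>\<^bsub>R\<^esub>" "\<pi> 0 \<in> carrier R"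
    using m unfolding ring_map_def by (metis add_0 r_zero, blast)
  then show ?thesis by simp
qed

lemma ring_map_diff: "ring_map \<pi> R \<Longrightarrow> \<pi> (x - y) = \<pi> x \<ominus>\<^bsub>R\<^esub> \<pi> y"
proof -
  assume m: "ring_map \<pi> R"
  then interpret ring R by (simp add: ring_map_def)
  have c: "\<pi> x \<in> carrier R" "\<pi> y \<in> carrier R" "\<pi> (x - y) \<in> carrier R"
    using m by (auto simp: ring_map_def)
  have "\<pi> x = \<pi> (x - y) \<oplus>\<^bsub>R\<^esub> \<pi> y"
    using m unfolding ring_map_def by (metis diff_add_cancel)
  then show ?thesis
    using c by (simp add: a_minus_def a_assoc r_neg)
qed

lemma ring_map_quotient:
  assumes "ring_map \<pi> R" "ideal J R"
  shows "ring_map (\<lambda>x. J +>\<^bsub>R\<^esub> \<pi> x) (R Quot J)"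
    and "range \<pi> = carrier R \<Longrightarrow> range (\<lambda>x. J +>\<^bsub>R\<^esub> \<pi> x) = carrier (R Quot J)"
    and "\<pi> x \<in> J \<Longrightarrow> J +>\<^bsub>R\<^esub> \<pi> x = \<zero>\<^bsub>R Quot J\<^esub>"
proof -
  interpret J: ideal J R by fact
  have hom: "(+>\<^bsub>R\<^esub>) J \<in> ring_hom R (R Quot J)" by (rule J.rcos_ring_hom)
  show "ring_map (\<lambda>x. J +>\<^bsub>R\<^esub> \<pi> x) (R Quot J)"
    using assms(1) ring_hom_closed[OF hom] ring_hom_add[OF hom] ring_hom_mult[OF hom] ring_hom_one[OF hom]
      J.quotient_is_ring by (simp add: ring_map_def)
  show "range (\<lambda>x. J +>\<^bsub>R\<^esub> \<pi> x) = carrier (R Quot J)" if "range \<pi> = carrier R"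
    using that by (auto simp: FactRing_def A_RCOSETS_def' image_iff) (metis rangeE)+
  show "J +>\<^bsub>R\<^esub> \<pi> x = \<zero>\<^bsub>R Quot J\<^esub>" if "\<pi> x \<in> J"
    using J.a_rcos_const[OF that] by (simp add: FactRing_def)
qed

text \<open>
  The free algebra on the whole type of letters maps onto the free algebra on \<open>V\<close> by sending the letters
  outside \<open>V\<close> to \<open>0\<close>.
\<close>

definition to_free_algebra :: "'v set \<Rightarrow> ('v, 'k::field) free \<Rightarrow> 'v list \<Rightarrow> 'k"
  where "to_free_algebra V f = (\<lambda>w. if set w \<subseteq> V then Poly_Mapping.lookup f w else 0)"

lemma to_free_algebra: "ring_map (to_free_algebra V) (free_algebra V :: ('v list \<Rightarrow> 'k::field) ring)"
  and to_free_algebra_surj: "range (to_free_algebra V) = carrier (free_algebra V :: ('v list \<Rightarrow> 'k::field) ring)"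
proof -
  let ?\<phi> = "to_free_algebra V :: ('v, 'k) free \<Rightarrow> _"
  have closed: "?\<phi> f \<in> carrier (free_algebra V)" for f
  proof -
    have "{w. ?\<phi> f w \<noteq> 0} \<subseteq> Poly_Mapping.keys f" by (auto simp: to_free_algebra_def in_keys_iff)
    then have "finite {w. ?\<phi> f w \<noteq> 0}" using finite_keys finite_subset by blast
    then show ?thesis by (auto simp: free_algebra_def to_free_algebra_def split: if_splits)
  qed
  have mult: "?\<phi> (f * g) = ?\<phi> f \<otimes>\<^bsub>free_algebra V\<^esub> ?\<phi> g" for f g
  proof
    fix w
    have tw: "set (take n w) \<subseteq> V \<and> set (drop n w) \<subseteq> V \<longleftrightarrow> set w \<subseteq> V" for n
      by (metis append_take_drop_id set_append Un_subset_iff)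
    show "?\<phi> (f * g) w = (?\<phi> f \<otimes>\<^bsub>free_algebra V\<^esub> ?\<phi> g) w"
    proof (cases "set w \<subseteq> V")
      case True
      then show ?thesis using tw by (simp add: to_free_algebra_def free_algebra_def lookup_mult_list)
    next
      case False
      then have "?\<phi> f (take n w) * ?\<phi> g (drop n w) = 0" for n
        using tw[of n] by (auto simp: to_free_algebra_def)
      then have "(\<Sum>n\<le>length w. ?\<phi> f (take n w) * ?\<phi> g (drop n w)) = 0"
        by (intro sum.neutral) blast
      then show ?thesis using False by (simp add: to_free_algebra_def[of _ "f * g"] free_algebra_def)
    qed
  qed
  have "?\<phi> 1 = \<one>\<^bsub>free_algebra V\<^esub>"
    by (auto simp: to_free_algebra_def free_algebra_def lookup_one zero_list_def when_def)
  then show "ring_map ?\<phi> (free_algebra V)"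
    using closed mult free_algebra_ring
    by (auto simp: ring_map_def) (auto simp: to_free_algebra_def free_algebra_def lookup_add)
  have "a \<in> range ?\<phi>" if a: "a \<in> carrier (free_algebra V)" for a
  proof -
    have fin: "finite {w. a w \<noteq> 0}" and out: "\<And>w. \<not> set w \<subseteq> V \<Longrightarrow> a w = 0"
      using a by (auto simp: free_algebra_def)
    have "?\<phi> (Abs_poly_mapping a) = a"
      using fin out by (auto simp: to_free_algebra_def fun_eq_iff)
    then show ?thesis by (metis rangeI)
  qed
  then show "range ?\<phi> = carrier (free_algebra V)"
    using closed by blast
qed

definition letter :: "'v \<Rightarrow> ('v, 'k::field) free" where "letter x = Poly_Mapping.single [x] 1"

lemma to_free_algebra_letter: "x \<in> V \<Longrightarrow> to_free_algebra V (letter x) = free_gen x"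
  by (auto simp: to_free_algebra_def letter_def free_gen_def lookup_single when_def)

lemma to_free_algebra_const: "to_free_algebra V (free_const c) = free_scalar c"
  by (auto simp: to_free_algebra_def free_const_def free_scalar_def lookup_single when_def zero_list_def)

lemma to_free_algebra_const_letter:
  "x \<in> V \<Longrightarrow> to_free_algebra V (free_const c * letter x) = (\<lambda>w. c * free_gen x w)"
  by (rule ext)
    (auto simp: to_free_algebra_def free_const_def letter_def free_gen_def mult_single lookup_single when_def)

lemma to_free_algebra_diff: "to_free_algebra V (f - g) = (\<lambda>w. to_free_algebra V f w - to_free_algebra V g w)"
  by (auto simp: to_free_algebra_def lookup_minus)

context affine_algebraic_group_char_p
begin

context
  fixes r :: nat
begin

abbreviation "ES \<equiv> env_space G A r"
abbreviation "TA \<equiv> tensor_algebra ES"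
abbreviation "UE \<equiv> higher_env G A r"

lemma ES_eq: "ES = V (p ^ (r + 1) - 1)"
  by (simp add: env_space_def char_p)

lemma ES_add: "x \<in> ES \<Longrightarrow> y \<in> ES \<Longrightarrow> (\<lambda>t. x t + y t) \<in> ES"
  using fa.vs.subspace_add[OF V_sub, of x _ y] by (simp add: ES_eq plus_fun_def)

lemma ES_scale: "x \<in> ES \<Longrightarrow> (\<lambda>t. c * x t) \<in> ES"
  using fa.vs.subspace_scale[OF V_sub, of x _ c] by (simp add: ES_eq times_fun_def cf_def)

lemma linear_ideal_ES: "ideal (linear_ideal ES) (free_algebra ES)"
  by (rule tensor_algebra_ring(1)[OF ES_add ES_scale])

text \<open>The canonical map from the free algebra to the tensor algebra.\<close>

definition \<rho> where "\<rho> f = linear_ideal ES +>\<^bsub>free_algebra ES\<^esub> to_free_algebra ES f"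

lemma \<rho>_map: "ring_map \<rho> TA"
  unfolding \<rho>_def[abs_def] tensor_algebra_def
  by (rule ring_map_quotient(1)[OF to_free_algebra linear_ideal_ES])

lemma \<rho>_surj: "range \<rho> = carrier TA"
  unfolding \<rho>_def[abs_def] tensor_algebra_def
  by (rule ring_map_quotient(2)[OF to_free_algebra linear_ideal_ES to_free_algebra_surj])

lemma \<rho>_zero: "to_free_algebra ES f \<in> linear_ideal ES \<Longrightarrow> \<rho> f = \<zero>\<^bsub>TA\<^esub>"
  unfolding \<rho>_def tensor_algebra_def
  by (rule ring_map_quotient(3)[OF to_free_algebra linear_ideal_ES])

lemma \<rho>_letter: "x \<in> ES \<Longrightarrow> \<rho> (letter x) = tensor_gen ES x"
  by (simp add: \<rho>_def tensor_gen_def to_free_algebra_letter)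

lemma \<rho>_carrier: "\<rho> f \<in> carrier TA"
  using \<rho>_surj by blast

lemma \<rho>_relation:
  "x \<in> ES \<Longrightarrow> y \<in> ES \<Longrightarrow> z \<in> ES \<Longrightarrow> \<rho> (letter x * letter y - letter z)
    = tensor_gen ES x \<otimes>\<^bsub>TA\<^esub> tensor_gen ES y \<ominus>\<^bsub>TA\<^esub> tensor_gen ES z"
  "x \<in> ES \<Longrightarrow> y \<in> ES \<Longrightarrow> z \<in> ES \<Longrightarrow> \<rho> ((letter x * letter y - letter y * letter x) - letter z)
    = (tensor_gen ES x \<otimes>\<^bsub>TA\<^esub> tensor_gen ES y \<ominus>\<^bsub>TA\<^esub> tensor_gen ES y \<otimes>\<^bsub>TA\<^esub> tensor_gen ES x) \<ominus>\<^bsub>TA\<^esub> tensor_gen ES z"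
  using \<rho>_map by (simp_all add: ring_map_diff[OF \<rho>_map] \<rho>_letter ring_map_def)

lemma linear_relations_closed: "linear_relations ES \<subseteq> carrier (free_algebra ES)"
  and linear_relations_eq:
  "x \<in> ES \<Longrightarrow> y \<in> ES \<Longrightarrow> to_free_algebra ES (letter (x + y) - letter x - letter y) \<in> linear_relations ES"
  "x \<in> ES \<Longrightarrow> to_free_algebra ES (letter (cf c * x) - free_const c * letter x) \<in> linear_relations ES"
proof -
  have 1: "to_free_algebra ES (letter (x + y) - letter x - letter y)
      = (\<lambda>w. free_gen (\<lambda>t. x t + y t) w - free_gen x w - free_gen y w)" if "x \<in> ES" "y \<in> ES" for x y
    using that ES_add[OF that] by (simp add: to_free_algebra_diff to_free_algebra_letter plus_fun_def)
  have 2: "to_free_algebra ES (letter (cf c * x) - free_const c * letter x)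
      = (\<lambda>w. free_gen (\<lambda>t. c * x t) w - c * free_gen x w)" if "x \<in> ES" for c x
    using that ES_scale[OF that, of c]
    by (simp add: to_free_algebra_diff to_free_algebra_letter to_free_algebra_const_letter times_fun_def cf_def)
  show "to_free_algebra ES (letter (x + y) - letter x - letter y) \<in> linear_relations ES" if "x \<in> ES" "y \<in> ES"
    unfolding 1[OF that] linear_relations_def using that by blast
  show "to_free_algebra ES (letter (cf c * x) - free_const c * letter x) \<in> linear_relations ES" if "x \<in> ES"
    unfolding 2[OF that] linear_relations_def using that by blast
  have car: "to_free_algebra ES f \<in> carrier (free_algebra ES)" for f :: "(('g \<Rightarrow> 'k) \<Rightarrow> 'k, 'k) free"
    using to_free_algebra_surj[of ES] by blast
  show "linear_relations ES \<subseteq> carrier (free_algebra ES)"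
    unfolding linear_relations_def using car 1 2 by (auto simp flip: 1 2)
qed

lemma V_ES: "n < p ^ (r + 1) \<Longrightarrow> x \<in> V n \<Longrightarrow> x \<in> ES"
  unfolding ES_eq by (erule rev_subsetD, rule V_mono) linarith

lemma dmult_ES: "x \<in> V i \<Longrightarrow> y \<in> V j \<Longrightarrow> i + j < p ^ (r + 1) \<Longrightarrow> dmult x y \<in> ES"
  by (rule V_ES[OF _ dmult_V])

text \<open>
  For \<open>i = 0\<close> the order \<open>i + j - 1\<close> is not available; but then \<open>x = 0\<close> may be regarded as having order \<open>1\<close>
  while \<open>y\<close> lies in the generating space.
\<close>

lemma commutator_ES:
  assumes x: "x \<in> V i" "x \<in> ES" and y: "y \<in> V j" "y \<in> ES" and ij: "i + j \<le> p ^ (r + 1)"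
  shows "dist_commutator G A x y \<in> ES"
proof (cases "i = 0")
  case True
  then have "x \<in> V 1" using x V_mono[of 0 1] by auto
  then have "dist_commutator G A x y \<in> V (1 + (p ^ (r + 1) - 1) - 1)"
    using y(2) by (intro commutator_V) (auto simp: ES_eq)
  then show ?thesis by (simp add: ES_eq)
next
  case False
  then have "dist_commutator G A x y \<in> V (i + j - 1)"
    by (intro commutator_V x y) simp
  then show ?thesis using False ij by (intro V_ES[of "i + j - 1"]) linarith+
qed

lemma env_relations_closed: "env_relations G A r \<subseteq> carrier TA"
proof
  fix a assume "a \<in> env_relations G A r"
  then consider
      x y i j where "x \<in> ES" "y \<in> ES" "x \<in> V i" "y \<in> V j" "i + j < p ^ (r + 1)"
        "a = tensor_gen ES x \<otimes>\<^bsub>TA\<^esub> tensor_gen ES y \<ominus>\<^bsub>TA\<^esub> tensor_gen ES (dmult x y)"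
    | x y i j where "x \<in> ES" "y \<in> ES" "x \<in> V i" "y \<in> V j" "i + j \<le> p ^ (r + 1)"
        "a = (tensor_gen ES x \<otimes>\<^bsub>TA\<^esub> tensor_gen ES y \<ominus>\<^bsub>TA\<^esub> tensor_gen ES y \<otimes>\<^bsub>TA\<^esub> tensor_gen ES x) \<ominus>\<^bsub>TA\<^esub> tensor_gen ES (dist_commutator G A x y)"
    unfolding env_relations_def Let_def char_p by blast
  then show "a \<in> carrier TA"
  proof cases
    case 1
    then show ?thesis
      using \<rho>_relation(1)[of x y "dmult x y"] dmult_ES \<rho>_carrier by metis
  next
    case 2
    then show ?thesis
      using \<rho>_relation(2)[of x y "dist_commutator G A x y"] commutator_ES \<rho>_carrier by metis
  qed
qed

lemma TA_ring: "ring TA"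
  using \<rho>_map by (simp add: ring_map_def)

lemma env_ideal: "ideal (env_ideal G A r) TA" "env_relations G A r \<subseteq> env_ideal G A r"
  unfolding env_ideal_def
  using ring.genideal_ideal[OF TA_ring env_relations_closed] ring.genideal_self[OF TA_ring env_relations_closed] by auto

text \<open>The canonical map from the free algebra to the higher enveloping algebra, with kernel \<open>ker\<close>.\<close>

definition \<pi> where "\<pi> f = env_ideal G A r +>\<^bsub>TA\<^esub> \<rho> f"

lemma \<pi>_map: "ring_map \<pi> UE"
  unfolding \<pi>_def[abs_def] higher_env_def by (rule ring_map_quotient(1)[OF \<rho>_map env_ideal(1)])

lemma \<pi>_surj: "range \<pi> = carrier UE"
  unfolding \<pi>_def[abs_def] higher_env_def by (rule ring_map_quotient(2)[OF \<rho>_map env_ideal(1) \<rho>_surj])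

lemma \<pi>_relation: "\<rho> f \<in> env_ideal G A r \<Longrightarrow> \<pi> f = \<zero>\<^bsub>UE\<^esub>"
  unfolding \<pi>_def higher_env_def by (rule ring_map_quotient(3)[OF \<rho>_map env_ideal(1)])

lemma \<pi>_zeroI: "\<rho> f = \<zero>\<^bsub>TA\<^esub> \<Longrightarrow> \<pi> f = \<zero>\<^bsub>UE\<^esub>"
  using additive_subgroup.zero_closed[OF ideal.axioms(1)[OF env_ideal(1)]] by (intro \<pi>_relation) simp

lemma \<pi>_const: "\<pi> (free_const c) = higher_env_scalar G A r c"
  by (simp add: \<pi>_def \<rho>_def higher_env_scalar_def tensor_scalar_def to_free_algebra_const)

definition ker where "ker = {f. \<pi> f = \<zero>\<^bsub>UE\<^esub>}"

lemma kerI: "\<rho> f \<in> env_relations G A r \<Longrightarrow> f \<in> ker"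
  unfolding ker_def using subsetD[OF env_ideal(2)] by (intro CollectI \<pi>_relation)

lemma presentation: "quotient_presentation free_const ker UE \<pi>"
proof -
  interpret U: ring UE using \<pi>_map by (simp add: ring_map_def)
  interpret central_scalars "free_const :: 'k \<Rightarrow> (('g \<Rightarrow> 'k) \<Rightarrow> 'k, 'k) free"
    by (rule central_scalars_free)
  show ?thesis
    using \<pi>_map \<pi>_surj ring_map_zero[OF \<pi>_map]
    by unfold_locales (auto simp: ker_def ring_map_def)
qed

lemma letter_ker: "x \<notin> ES \<Longrightarrow> letter x \<in> ker"
proof -
  assume "x \<notin> ES"
  then have "to_free_algebra ES (letter x :: (('g \<Rightarrow> 'k) \<Rightarrow> 'k, 'k) free) = to_free_algebra ES 0"
    by (auto simp: to_free_algebra_def letter_def lookup_single when_def fun_eq_iff)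
  then have "\<rho> (letter x) = \<zero>\<^bsub>TA\<^esub>"
    using ring_map_zero[OF \<rho>_map] by (simp add: \<rho>_def)
  then show ?thesis by (simp add: ker_def \<pi>_zeroI)
qed

lemma linear_ker: "to_free_algebra ES f \<in> linear_relations ES \<Longrightarrow> f \<in> ker"
  using ring.genideal_self[OF free_algebra_ring linear_relations_closed] \<rho>_zero[of f] \<pi>_zeroI[of f]
  by (auto simp: ker_def linear_ideal_def)

text \<open>
  The assumption on \<open>g\<close> to generate the algebra holds because letters outside the generating space lie in
  the kernel.
\<close>

lemma env_presentation_higher_env: "env_presentation G A p free_const ker r letter"
proof -
  interpret quotient_presentation free_const ker UE \<pi> by (rule presentation)
  show ?thesis
  proof
    fix x y assume "x \<in> V (p ^ (r + 1) - 1)" "y \<in> V (p ^ (r + 1) - 1)"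
    then have "letter (x + y) - letter x - letter y \<in> ker"
      by (intro linear_ker linear_relations_eq) (simp_all add: ES_eq)
    then show "letter (x + y) - (letter x + letter y) \<in> ker"
      by (simp add: algebra_simps)
  next
    fix c x assume "x \<in> V (p ^ (r + 1) - 1)"
    then show "letter (cf c * x) - free_const c * letter x \<in> ker"
      by (intro linear_ker linear_relations_eq) (simp add: ES_eq)
  next
    fix x y i j assume xy: "x \<in> V i" "y \<in> V j" "i + j < p ^ (r + 1)"
    have E: "x \<in> ES" "y \<in> ES"
      by (rule V_ES[OF _ xy(1)], use xy in linarith) (rule V_ES[OF _ xy(2)], use xy in linarith)
    have "\<rho> (letter x * letter y - letter (dmult x y)) \<in> env_relations G A r"
      unfolding \<rho>_relation(1)[OF E dmult_ES[OF xy]] env_relations_def Let_def char_p using E xy by blast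
    then show "letter x * letter y - letter (dmult x y) \<in> ker"
      by (rule kerI)
  next
    fix x y i j assume xy: "x \<in> V i" "y \<in> V j" "0 < i" "0 < j" "i + j \<le> p ^ (r + 1)"
    have E: "x \<in> ES" "y \<in> ES"
      by (rule V_ES[OF _ xy(1)], use xy in linarith) (rule V_ES[OF _ xy(2)], use xy in linarith)
    have "\<rho> ((letter x * letter y - letter y * letter x) - letter (dist_commutator G A x y)) \<in> env_relations G A r"
      unfolding \<rho>_relation(2)[OF E commutator_ES[OF xy(1) E(1) xy(2) E(2) xy(5)]] env_relations_def Let_def char_p
      using E xy by blast
    then show "ad (letter x) (letter y) - letter (dist_commutator G A x y) \<in> ker"
      unfolding ad_def by (rule kerI)
  next
    fix M :: "(('g \<Rightarrow> 'k) \<Rightarrow> 'k, 'k) free set"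
    assume M: "vs.subspace M" "ker \<subseteq> M" "1 \<in> M" "\<And>x y. x \<in> M \<Longrightarrow> y \<in> M \<Longrightarrow> x * y \<in> M"
      "letter ` V (p ^ (r + 1) - 1) \<subseteq> M"
    have letter: "letter x \<in> M" for x
      using letter_ker[of x] M(2,5) by (cases "x \<in> ES") (auto simp: ES_eq)
    have word: "Poly_Mapping.single w 1 \<in> M" for w
    proof (induction w)
      case Nil
      then show ?case using M(3) by (simp add: zero_list_def[symmetric])
    next
      case (Cons x w)
      have "Poly_Mapping.single (x # w) (1 :: 'k) = letter x * Poly_Mapping.single w 1"
        by (simp add: letter_def mult_single plus_list_def)
      then show ?case using M(4)[OF letter Cons] by simp
    qed
    have single: "Poly_Mapping.single w c = free_const c * Poly_Mapping.single w 1"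
      for w :: "(('g \<Rightarrow> 'k) \<Rightarrow> 'k) list" and c :: 'k
      by (simp add: free_const_def mult_single)
    have single_M: "Poly_Mapping.single w c \<in> M" for w c
      by (subst single) (rule vs.subspace_scale[OF M(1) word])
    have "f \<in> M" for f
      by (rule free_induct[OF vs.subspace_0[OF M(1)] single_M vs.subspace_add[OF M(1)]])
    then show "M = UNIV" by blast
  qed
qed

lemma higher_env_centre:
  "fin_gen_algebra UE (higher_env_scalar G A r) (ring_centre UE) \<and> fin_gen_module_over UE (ring_centre UE)"
proof -
  interpret Q: quotient_presentation free_const ker UE \<pi> by (rule presentation)
  interpret E: env_presentation G A p free_const ker r letter by (rule env_presentation_higher_env)
  obtain zs X where zX: "set zs \<subseteq> Q.centre_mod" "finite X"
    "Q.vs.span ({Q.monomial zs a * b | a b. length a = length zs \<and> b \<in> X} \<union> ker) = UNIV"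
    by (rule E.finite_over_central_subalgebra)
  have "(\<lambda>c. \<pi> (free_const c)) = higher_env_scalar G A r"
    by (simp add: fun_eq_iff \<pi>_const)
  then show ?thesis
    using Q.centre_finiteness[OF zX] by simp
qed

end

end

theorem proposition3p4p1:
  fixes G :: "('g, 'm) monoid_scheme"
    and A :: "('g \<Rightarrow> 'k::alg_closed_field) set"
    and p r :: nat
  assumes "reductive_group G A"
    and "CHAR('k) = p" and "p > 0"
  shows "fin_gen_algebra (higher_env G A r) (higher_env_scalar G A r) (ring_centre (higher_env G A r))
    \<and> fin_gen_module_over (higher_env G A r) (ring_centre (higher_env G A r))"
proof -
  interpret affine_algebraic_group G A
    using assms(1) by (simp add: reductive_group_def)
  have "prime p"
    using prime_CHAR_semidom[where ?'a = 'k] assms by simp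
  then interpret affine_algebraic_group_char_p G A p
    using assms(2) by unfold_locales
  show ?thesis
    by (rule higher_env_centre)
qed

end
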